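(* Let $n\ge2$, $q\ge1$, and let $f:M^n\looparrowright\mathbb S^{n+q}(1)$ be a closed minimal immersion. Let $p\in f(M)$ be a point of multiplicity $m=\#f^{-1}(p)$. Put $\varphi_p=\langle f,p\rangle$ and $$\mathcal R_p=\int_{\{\varphi_p>0\}}\frac{\varphi_p|p^\perp|^2}{(1-\varphi_p^2)^{n/2+1}}\,dV .$$ Then $$\operatorname{Vol}(M)\ge m\,\omega_n+\frac{\omega_n}{\beta_n}\mathcal R_p+\frac1{n+2}\int_M|p^\perp|^2\,dV .$$
   Context: All manifolds and immersions are smooth; $M$ is closed (compact without boundary) with the induced metric and volume measure $dV$; $\mathbb S^{n+q}(1)\subset\mathbb R^{n+q+1}$ is the unit sphere. Minimal means that the mean curvature vector of $M$ in the sphere vanishes. For a fixed vector $p\in\mathbb R^{n+q+1}$, $p^\perp$ denotes at each $x\in M$ the component of $p$ in the normal space $N_xM$ of $M$ inside the sphere, i.e. $p=\varphi_p f+\nabla\varphi_p+p^\perp$. $\omega_n=\operatorname{Vol}(\mathbb S^n)$ and $\beta_n=\operatorname{Vol}(\mathbb B^n)$ is the volume of the Euclidean unit ball. The integrand of $\mathcal R_p$ is undefined only on the null set $f^{-1}(p)$. *)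

theory Defs
  imports "HOL-Analysis.Analysis"
begin

section \<open>Smooth maps and closed manifolds\<close>

text \<open>The predicates are meant for open \<open>S\<close>: derivatives are taken with \<open>at x\<close>.\<close>

primrec Ck_on :: "nat \<Rightarrow> 'a::real_normed_vector set \<Rightarrow> ('a \<Rightarrow> 'b::real_normed_vector) \<Rightarrow> bool"
  where
    "Ck_on 0 S f \<longleftrightarrow> continuous_on S f"
  | "Ck_on (Suc k) S f \<longleftrightarrow>
       (\<forall>x\<in>S. f differentiable (at x)) \<and>
       (\<forall>v. Ck_on k S (\<lambda>x. frechet_derivative f (at x) v))"

definition smooth_on :: "'a::real_normed_vector set \<Rightarrow> ('a \<Rightarrow> 'b::real_normed_vector) \<Rightarrow> bool"
  where "smooth_on S f \<longleftrightarrow> (\<forall>k. Ck_on k S f)"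

text \<open>An atlas is a set of local parametrizations \<open>(V, \<psi>)\<close>, with \<open>\<psi>\<close> a homeomorphism from an
  open \<open>V\<close> in \<open>\<real>\<^sup>n\<close> onto an open subset of \<open>M\<close>; the values of \<open>\<psi>\<close> outside \<open>V\<close> are irrelevant.
  The set on which the transition map is required to be smooth is
  \<open>\<psi>\<^sup>-\<^sup>1(\<psi>(V) \<inter> \<psi>'(V'))\<close>.\<close>

type_synonym ('n, 'a) atlas = "((real^'n) set \<times> (real^'n \<Rightarrow> 'a)) set"

definition smooth_atlas :: "'a::topological_space set \<Rightarrow> ('n::finite, 'a) atlas \<Rightarrow> bool"
  where "smooth_atlas M A \<longleftrightarrow>
    (\<Union>(V, \<psi>)\<in>A. \<psi> ` V) = M \<and>
    (\<forall>(V, \<psi>)\<in>A. open V \<and> openin (top_of_set M) (\<psi> ` V) \<and> (\<exists>\<phi>. homeomorphism V (\<psi> ` V) \<psi> \<phi>)) \<and>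
    (\<forall>(V, \<psi>)\<in>A. \<forall>(V', \<psi>')\<in>A. smooth_on (V \<inter> \<psi> -` (\<psi>' ` V')) (inv_into V' \<psi>' \<circ> \<psi>))"

text \<open>Second countability is automatic for a compact locally Euclidean space.  Neither
  connectedness nor orientability is part of the definition.\<close>

definition closed_manifold :: "'a::t2_space set \<Rightarrow> ('n::finite, 'a) atlas \<Rightarrow> bool"
  where "closed_manifold M A \<longleftrightarrow> compact M \<and> smooth_atlas M A"

section \<open>Immersions into the unit sphere\<close>

definition immersion_into_sphere ::
    "'a::t2_space set \<Rightarrow> ('n::finite, 'a) atlas \<Rightarrow> ('a \<Rightarrow> 'e::euclidean_space) \<Rightarrow> bool"
  where "immersion_into_sphere M A f \<longleftrightarrow>
    f ` M \<subseteq> sphere 0 1 \<and>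
    (\<forall>(V, \<psi>)\<in>A. smooth_on V (f \<circ> \<psi>) \<and>
       (\<forall>u\<in>V. inj (frechet_derivative (f \<circ> \<psi>) (at u))))"

text \<open>The image of \<open>df\<^sub>x\<close>; it does not depend on the parametrization around \<open>x\<close>, so the union
  is a single linear subspace.\<close>

definition tangent_space ::
    "('n::finite, 'a) atlas \<Rightarrow> ('a \<Rightarrow> 'e::euclidean_space) \<Rightarrow> 'a \<Rightarrow> 'e set"
  where "tangent_space A f x =
    (\<Union>(V, \<psi>)\<in>A. \<Union>u\<in>{u \<in> V. \<psi> u = x}. range (frechet_derivative (f \<circ> \<psi>) (at u)))"

text \<open>The normal space inside the sphere: besides being normal to \<open>M\<close>, its vectors are tangent
  to the sphere, that is, orthogonal to the position vector.\<close>

definition normal_space ::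
    "('n::finite, 'a) atlas \<Rightarrow> ('a \<Rightarrow> 'e::euclidean_space) \<Rightarrow> 'a \<Rightarrow> 'e set"
  where "normal_space A f x = orthogonal_comp (insert (f x) (tangent_space A f x))"

definition orthogonal_projection :: "'e::euclidean_space set \<Rightarrow> 'e \<Rightarrow> 'e"
  where "orthogonal_projection W v = (THE w. w \<in> W \<and> v - w \<in> orthogonal_comp W)"

definition normal_part ::
    "('n::finite, 'a) atlas \<Rightarrow> ('a \<Rightarrow> 'e::euclidean_space) \<Rightarrow> 'a \<Rightarrow> 'e \<Rightarrow> 'e"
  where "normal_part A f x v = orthogonal_projection (normal_space A f x) v"

definition partial :: "'n::finite \<Rightarrow> (real^'n \<Rightarrow> 'e::euclidean_space) \<Rightarrow> real^'n \<Rightarrow> 'e"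
  where "partial i F u = frechet_derivative F (at u) (axis i 1)"

definition metric_matrix :: "(real^'n::finite \<Rightarrow> 'e::euclidean_space) \<Rightarrow> real^'n \<Rightarrow> real^'n^'n"
  where "metric_matrix F u = (\<chi> i j. partial i F u \<bullet> partial j F u)"

text \<open>In a parametrization, with \<open>F = f \<circ> \<psi>\<close>, the second fundamental form of \<open>M\<close> in the sphere
  is \<open>II(\<partial>\<^sub>i, \<partial>\<^sub>j) = (\<partial>\<^sub>i\<partial>\<^sub>j F)\<^sup>N\<close>, because \<open>\<partial>\<^sub>i\<partial>\<^sub>j F\<close> differs from the covariant derivative in the
  sphere by a multiple of \<open>F\<close>.  The mean curvature vector is the metric trace of \<open>II\<close>.\<close>

definition second_fundamental_form ::
    "('n::finite, 'a) atlas \<Rightarrow> ('a \<Rightarrow> 'e::euclidean_space) \<Rightarrow> (real^'n \<Rightarrow> 'a) \<Rightarrow>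
      real^'n \<Rightarrow> 'n \<Rightarrow> 'n \<Rightarrow> 'e"
  where "second_fundamental_form A f \<psi> u i j =
    normal_part A f (\<psi> u) (partial i (partial j (f \<circ> \<psi>)) u)"

definition mean_curvature_vector ::
    "('n::finite, 'a) atlas \<Rightarrow> ('a \<Rightarrow> 'e::euclidean_space) \<Rightarrow> (real^'n \<Rightarrow> 'a) \<Rightarrow> real^'n \<Rightarrow> 'e"
  where "mean_curvature_vector A f \<psi> u =
    (\<Sum>i\<in>UNIV. \<Sum>j\<in>UNIV.
      matrix_inv (metric_matrix (f \<circ> \<psi>) u) $ i $ j *\<^sub>R second_fundamental_form A f \<psi> u i j)"

definition minimal :: "('n::finite, 'a) atlas \<Rightarrow> ('a \<Rightarrow> 'e::euclidean_space) \<Rightarrow> bool"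
  where "minimal A f \<longleftrightarrow> (\<forall>(V, \<psi>)\<in>A. \<forall>u\<in>V. mean_curvature_vector A f \<psi> u = 0)"

section \<open>Volume\<close>

text \<open>The Riemannian measure \<open>dV\<close> of the induced metric is the unique Borel measure on \<open>M\<close> that
  is \<open>\<surd>(det g) du\<close> in every parametrization.\<close>

definition volume_measure ::
    "'a::t2_space set \<Rightarrow> ('n::finite, 'a) atlas \<Rightarrow> ('a \<Rightarrow> 'e::euclidean_space) \<Rightarrow> 'a measure"
  where "volume_measure M A f =
    (THE \<mu>. sets \<mu> = sets (restrict_space borel M) \<and>
       (\<forall>(V, \<psi>)\<in>A. \<forall>B\<in>sets \<mu>. B \<subseteq> \<psi> ` V \<longrightarrow>
          emeasure \<mu> B =
            (\<integral>\<^sup>+u\<in>V \<inter> \<psi> -` B. ennreal (sqrt (det (metric_matrix (f \<circ> \<psi>) u))) \<partial>lborel)))"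

definition Vol :: "'a::t2_space set \<Rightarrow> ('n::finite, 'a) atlas \<Rightarrow> ('a \<Rightarrow> 'e::euclidean_space) \<Rightarrow> real"
  where "Vol M A f = measure (volume_measure M A f) M"

text \<open>The unit sphere of \<open>\<real>\<^sup>n \<times> \<real>\<close>, which is \<open>\<real>\<^sup>n\<^sup>+\<^sup>1\<close> with its Euclidean inner product, carries
  the atlas of the two inverse stereographic projections: \<open>s = 1\<close> misses only \<open>(0, -1)\<close>, and
  \<open>s = -1\<close> misses only \<open>(0, 1)\<close>.\<close>

definition stereographic :: "real \<Rightarrow> real^'n::finite \<Rightarrow> (real^'n) \<times> real"
  where "stereographic s u =
    ((2 / (1 + (norm u)\<^sup>2)) *\<^sub>R u, s * (1 - (norm u)\<^sup>2) / (1 + (norm u)\<^sup>2))"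

definition sphere_atlas :: "('n::finite, (real^'n) \<times> real) atlas"
  where "sphere_atlas = {(UNIV, stereographic 1), (UNIV, stereographic (-1))}"

text \<open>\<open>\<omega>\<^sub>n\<close> and \<open>\<beta>\<^sub>n\<close> for \<open>n = CARD('n)\<close>.\<close>

definition sphere_vol :: "'n::finite itself \<Rightarrow> real"
  where "sphere_vol _ =
    Vol (sphere (0 :: (real^'n) \<times> real) 1) (sphere_atlas :: ('n, (real^'n) \<times> real) atlas) (\<lambda>x. x)"

definition ball_vol :: "'n::finite itself \<Rightarrow> real"
  where "ball_vol _ = measure lborel (ball (0 :: real^'n) 1)"

section \<open>The integrand of the functional \<open>\<R>\<^sub>p\<close>\<close>

text \<open>On \<open>f\<^sup>-\<^sup>1(p)\<close>, which is a null set, the quotient has the default value \<open>0\<close>.\<close>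

definition R_integrand ::
    "('n::finite, 'a) atlas \<Rightarrow> ('a \<Rightarrow> 'e::euclidean_space) \<Rightarrow> 'e \<Rightarrow> 'a \<Rightarrow> real"
  where "R_integrand A f p x =
    (f x \<bullet> p) * (norm (normal_part A f x p))\<^sup>2 /
      (1 - (f x \<bullet> p)\<^sup>2) powr (real CARD('n) / 2 + 1)"

definition R_functional ::
    "'a::t2_space set \<Rightarrow> ('n::finite, 'a) atlas \<Rightarrow> ('a \<Rightarrow> 'e::euclidean_space) \<Rightarrow> 'e \<Rightarrow> real"
  where "R_functional M A f p =
    (LINT x:{x \<in> M. f x \<bullet> p > 0}|volume_measure M A f. R_integrand A f p x)"

end

theory Submission
  imports Defs
begin

text \<open>Write \<open>\<phi> = \<langle>f, p\<rangle>\<close>, \<open>S = |p\<^sup>\<bottom>|\<^sup>2\<close> and \<open>T = \<nabla>\<phi>\<close>.  Then \<open>p = \<phi> f + T + p\<^sup>\<bottom>\<close> gives \<open>|T|\<^sup>2 = 1 - \<phi>\<^sup>2 - S\<close>, and minimality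
  gives \<open>\<Delta>\<phi> = - n \<phi>\<close>.  Integrating the divergence of \<open>h(\<phi>) \<nabla>\<phi>\<close> over \<open>M\<close> therefore yields, for every
  \<open>C\<^sup>1\<close> function \<open>h\<close> near \<open>[-1, 1]\<close>,
  \<open>\<integral> h'(\<phi>) (1 - \<phi>\<^sup>2 - S) - n \<phi> h(\<phi>) dV = 0\<close>
  (\<open>integral_profile\<close>).  The inequality comes from two choices of \<open>h\<close>.

  The first profile \<open>L\<close> equals \<open>(1 - t\<^sup>2)\<^bsup>-n/2\<^esup> - 1\<close> for \<open>t > 0\<close> and \<open>0\<close> for \<open>t \<le> 0\<close>; it solves
  \<open>h' (1 - t\<^sup>2) - n t h = n t\<^sup>+\<close> and is singular at \<open>t = 1\<close>.  Inserting \<open>L(l \<phi>)\<close> with \<open>l < 1\<close> expresses \<open>\<integral> \<phi>\<^sup>+\<close> as a sum of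
  two integrals of nonnegative functions.  As \<open>l\<close> tends to \<open>1\<close>, one integrand converges to that of \<open>\<R>\<^sub>p\<close>, while
  the other one concentrates at the points of \<open>f\<^sup>-\<^sup>1(p)\<close>; blown up in a chart it converges to
  \<open>(1 + |y|\<^sup>2)\<^bsup>-(n+2)/2\<^esup>\<close>, whose integral over \<open>\<real>\<^sup>n\<close> is \<open>\<beta>\<^sub>n\<close>.  Since only a lower bound is wanted, Fatou's lemma
  suffices and no uniform estimates near \<open>f\<^sup>-\<^sup>1(p)\<close> enter:
  \<open>\<integral> \<phi>\<^sup>+ \<ge> m \<beta>\<^sub>n + \<R>\<^sub>p\<close> (\<open>positive_part_bound\<close>).

  The second profile \<open>H\<close> is the odd solution of \<open>h' (1 - t\<^sup>2) - n t h = 1 - c |t|\<close> with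
  \<open>c = n \<integral>\<^sub>0\<^sup>1 (1 - s\<^sup>2)\<^bsup>n/2-1\<^esup> ds\<close>, the constant for which it stays bounded at the poles.  An elementary monotonicity argument
  shows \<open>H' \<ge> 1 / (n + 2)\<close> (\<open>H_profile'_bound\<close>), and therefore
  \<open>Vol M - c \<integral> |\<phi>| \<ge> (\<integral> S) / (n + 2)\<close> (\<open>volume_lower_bound\<close>).

  The choice \<open>h = 1\<close> gives \<open>\<integral> \<phi> = 0\<close>, so \<open>\<integral> |\<phi>| = 2 \<integral> \<phi>\<^sup>+\<close>, and stereographic coordinates give \<open>\<omega>\<^sub>n = 2 c \<beta>\<^sub>n\<close>
  (\<open>sphere_vol_eq\<close>).  The two estimates combine to the claim.

  The geometric input is developed from charts.  The volume measure is assembled from a finite partition into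
  chart pieces, its independence of the charts being the change of variables formula.  The divergence
  theorem reduces by a partition of unity to compactly supported functions on \<open>\<real>\<^sup>n\<close>, and in a chart \<open>\<Delta>\<phi> = - n \<phi>\<close>
  follows from Jacobi's formula for the derivative of a determinant and the symmetry of second
  derivatives (\<open>divergence_grad\<close>).\<close>


abbreviation fderiv :: "('a::real_normed_vector \<Rightarrow> 'b::real_normed_vector) \<Rightarrow> 'a \<Rightarrow> 'a \<Rightarrow> 'b"
  where "fderiv F x \<equiv> frechet_derivative F (at x)"

section \<open>Gram matrices and determinants\<close>

definition gram :: "(real^'n::finite \<Rightarrow> 'e::euclidean_space) \<Rightarrow> real^'n^'n"
  where "gram L = (\<chi> i j. L (axis i 1) \<bullet> L (axis j 1))"

lemma metric_matrix_gram: "metric_matrix F u = gram (fderiv F u)"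
  by (simp add: metric_matrix_def gram_def partial_def)

lemma linear_expand_axis:
  fixes L :: "real^'n::finite \<Rightarrow> 'e::real_vector"
  assumes "linear L"
  shows "L x = (\<Sum>i\<in>UNIV. x $ i *\<^sub>R L (axis i 1))"
proof -
  have "x = (\<Sum>i\<in>UNIV. x $ i *\<^sub>R axis i 1)"
    by (simp add: basis_expansion flip: scalar_mult_eq_scaleR)
  then have "L x = L (\<Sum>i\<in>UNIV. x $ i *\<^sub>R axis i 1)" by simp
  also have "\<dots> = (\<Sum>i\<in>UNIV. x $ i *\<^sub>R L (axis i 1))"
    by (simp add: linear_sum[OF assms] linear_scale[OF assms])
  finally show ?thesis .
qed

lemma gram_mult_vec:
  fixes L :: "real^'n::finite \<Rightarrow> 'e::euclidean_space"
  assumes "linear L"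
  shows "(gram L *v x) $ i = L (axis i 1) \<bullet> L x"
  by (subst linear_expand_axis[OF assms, of x])
     (simp add: gram_def matrix_vector_mult_def inner_sum_right mult.commute)

lemma gram_compose:
  fixes L :: "real^'n::finite \<Rightarrow> 'e::euclidean_space" and T :: "real^'n \<Rightarrow> real^'n"
  assumes "linear L" "linear T"
  shows "gram (L \<circ> T) = transpose (matrix T) ** gram L ** matrix T"
proof -
  have "gram (L \<circ> T) $ i $ j = (transpose (matrix T) ** gram L ** matrix T) $ i $ j" for i j
  proof -
    have "gram (L \<circ> T) $ i $ j =
        (\<Sum>k\<in>UNIV. T (axis i 1) $ k *\<^sub>R L (axis k 1)) \<bullet> (\<Sum>l\<in>UNIV. T (axis j 1) $ l *\<^sub>R L (axis l 1))"
      by (simp add: gram_def flip: linear_expand_axis[OF assms(1)])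
    also have "\<dots> = (\<Sum>l\<in>UNIV. (\<Sum>k\<in>UNIV. T (axis i 1) $ k * (L (axis k 1) \<bullet> L (axis l 1))) * T (axis j 1) $ l)"
      by (simp add: inner_sum_left inner_sum_right sum_distrib_left sum_distrib_right mult_ac)
    also have "\<dots> = (transpose (matrix T) ** gram L ** matrix T) $ i $ j"
      by (simp add: matrix_matrix_mult_def transpose_def matrix_def gram_def)
    finally show ?thesis .
  qed
  then show ?thesis by (simp add: vec_eq_iff)
qed

text \<open>An isometry between the image of \<open>L\<close> and the coordinate space turns \<open>L\<close> into a square
  matrix with the same Gram matrix; this is the square root of the metric without any spectral
  theory.\<close>

lemma square_matrix_with_same_gram:
  fixes L :: "real^'n::finite \<Rightarrow> 'e::euclidean_space"
  assumes "linear L" "inj L"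
  obtains B :: "real^'n^'n" where "det B \<noteq> 0" "\<And>x. norm (B *v x) = norm (L x)"
    "gram L = transpose B ** B"
proof -
  have dims: "dim (range L) = dim (UNIV :: (real^'n) set)"
    using dim_image_eq[OF assms(1), of UNIV] assms(2) by simp
  obtain h :: "'e \<Rightarrow> real^'n" where h: "linear h" "\<forall>x\<in>range L. norm (h x) = norm x"
    using isometry_subspaces[OF linear_subspace_image[OF assms(1) subspace_UNIV] subspace_UNIV dims]
    by metis
  have lin: "linear (h \<circ> L)" using h assms(1) by (simp add: linear_compose)
  define B where "B = matrix (h \<circ> L)"
  have B: "B *v x = h (L x)" for x unfolding B_def using lin by (simp add: matrix_works)
  have nm: "norm (B *v x) = norm (L x)" for x using h(2) B by auto
  have ip: "(B *v x) \<bullet> (B *v y) = L x \<bullet> L y" for x y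
  proof -
    have "norm (B *v x + B *v y) = norm (L x + L y)"
      using nm[of "x + y"] by (simp add: matrix_vector_right_distrib linear_add[OF assms(1)])
    then show ?thesis using nm[of x] nm[of y]
      by (simp add: dot_norm)
  qed
  have "inj ((*v) B)"
    by (metis (no_types, lifting) assms inj_on_def norm_eq_zero linear_injective_0 matrix_vector_mul_linear nm)
  then have "det B \<noteq> 0" using det_nz_iff_inj[of "(*v) B"] by simp
  moreover have "gram L = transpose B ** B"
  proof -
    have "gram L = gram ((*v) B)" by (simp add: gram_def ip)
    also have "\<dots> = transpose B ** B"
      by (simp add: gram_def vec_eq_iff matrix_matrix_mult_def transpose_def inner_vec_def
          matrix_vector_mult_basis column_def)
    finally show ?thesis .
  qed
  ultimately show ?thesis using nm that by blast
qed

lemma det_gram_pos: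
  fixes L :: "real^'n::finite \<Rightarrow> 'e::euclidean_space"
  assumes "linear L" "inj L"
  shows "det (gram L) > 0"
proof -
  obtain B :: "real^'n^'n" where B: "det B \<noteq> 0" "gram L = transpose B ** B"
    using square_matrix_with_same_gram[OF assms] by metis
  then have "det (gram L) = det B * det B" by (simp add: det_mul)
  then show ?thesis using B(1) by (metis not_real_square_gt_zero)
qed

lemma sqrt_det_gram_compose:
  fixes L :: "real^'n::finite \<Rightarrow> 'e::euclidean_space" and T :: "real^'n \<Rightarrow> real^'n"
  assumes "linear L" "linear T"
  shows "sqrt (det (gram (L \<circ> T))) = \<bar>det (matrix T)\<bar> * sqrt (det (gram L))"
  by (simp add: gram_compose[OF assms] det_mul real_sqrt_mult mult_ac)

text \<open>At the identity every permutation other than the identity contributes a product with two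
  vanishing factors, so only the diagonal survives differentiation.\<close>

lemma has_derivative_det_at_one:
  fixes M :: "'a::real_normed_vector \<Rightarrow> real^'n^'n::finite"
  assumes "\<And>i j. ((\<lambda>x. M x $ i $ j) has_derivative D i j) (at x)" and "M x = mat 1"
  shows "((\<lambda>x. det (M x)) has_derivative (\<lambda>h. \<Sum>i\<in>UNIV. D i i h)) (at x)"
proof -
  let ?PU = "{p. p permutes (UNIV::'n set)}"
  have fin: "finite ?PU" by (simp add: finite_permutations)
  have "((\<lambda>x. \<Prod>i\<in>UNIV. M x $ i $ p i) has_derivative
      (\<lambda>h. \<Sum>i\<in>UNIV. D i (p i) h * (\<Prod>j\<in>UNIV - {i}. M x $ j $ p j))) (at x)" for p
    by (rule has_derivative_prod) (rule assms)
  then have "((\<lambda>x. det (M x)) has_derivative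
     (\<lambda>h. \<Sum>p\<in>?PU. of_int (sign p) * (\<Sum>i\<in>UNIV. D i (p i) h * (\<Prod>j\<in>UNIV - {i}. M x $ j $ p j)))) (at x)"
    unfolding det_def by (intro has_derivative_sum has_derivative_mult_right)
  moreover have "(\<Sum>p\<in>?PU. of_int (sign p) * (\<Sum>i\<in>UNIV. D i (p i) h * (\<Prod>j\<in>UNIV - {i}. M x $ j $ p j)))
     = (\<Sum>i\<in>UNIV. D i i h)" for h
  proof -
    have z: "(\<Prod>j\<in>UNIV - {i}. M x $ j $ p j) = 0" if perm: "p permutes UNIV" "p \<noteq> id" for p :: "'n \<Rightarrow> 'n" and i
    proof -
      obtain j where "p j \<noteq> j" using perm(2) by (metis eq_id_iff)
      \<comment> \<open>a permutation that is not the identity moves at least two indices\<close>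
      then obtain j where "p j \<noteq> j" "j \<noteq> i"
        by (metis permutes_inj[OF perm(1)] injD)
      then show ?thesis using assms(2) by (intro prod_zero bexI[of _ j]) (auto simp: mat_def)
    qed
    have "(\<Sum>p\<in>?PU. of_int (sign p) * (\<Sum>i\<in>UNIV. D i (p i) h * (\<Prod>j\<in>UNIV - {i}. M x $ j $ p j)))
      = (\<Sum>p\<in>{id}. of_int (sign p) * (\<Sum>i\<in>UNIV. D i (p i) h * (\<Prod>j\<in>UNIV - {i}. M x $ j $ p j)))"
      by (rule sum.mono_neutral_right[OF fin]) (auto simp: permutes_id z)
    also have "\<dots> = (\<Sum>i\<in>UNIV. D i i h)" using assms(2) by (simp add: mat_def)
    finally show ?thesis .
  qed
  ultimately show ?thesis by simp
qed

lemma matrix_inv_left_right: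
  fixes A :: "real^'n^'n::finite"
  assumes "det A \<noteq> 0"
  shows "matrix_inv A ** A = mat 1" "A ** matrix_inv A = mat 1"
proof -
  have "\<exists>A'. A ** A' = mat 1 \<and> A' ** A = mat 1"
    using assms by (simp add: invertible_det_nz[symmetric] invertible_def)
  then have "A ** matrix_inv A = mat 1 \<and> matrix_inv A ** A = mat 1"
    unfolding matrix_inv_def by (rule someI_ex)
  then show "matrix_inv A ** A = mat 1" "A ** matrix_inv A = mat 1" by auto
qed

text \<open>Jacobi's formula; multiplication by the inverse reduces it to the identity matrix.\<close>

lemma has_derivative_det:
  fixes M :: "'a::real_normed_vector \<Rightarrow> real^'n^'n::finite"
  assumes D: "\<And>i j. ((\<lambda>x. M x $ i $ j) has_derivative D i j) (at x)" and nz: "det (M x) \<noteq> 0"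
  shows "((\<lambda>x. det (M x)) has_derivative
    (\<lambda>h. det (M x) * (\<Sum>i\<in>UNIV. \<Sum>j\<in>UNIV. matrix_inv (M x) $ i $ j * D j i h))) (at x)"
proof -
  have "((\<lambda>y. det (matrix_inv (M x) ** M y)) has_derivative
     (\<lambda>h. \<Sum>i\<in>UNIV. \<Sum>j\<in>UNIV. matrix_inv (M x) $ i $ j * D j i h)) (at x)"
  proof (rule has_derivative_det_at_one[where D = "\<lambda>i j h. \<Sum>k\<in>UNIV. matrix_inv (M x) $ i $ k * D k j h"])
    show "((\<lambda>y. (matrix_inv (M x) ** M y) $ i $ j) has_derivative
        (\<lambda>h. \<Sum>k\<in>UNIV. matrix_inv (M x) $ i $ k * D k j h)) (at x)" for i j
      unfolding matrix_matrix_mult_def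
      by (simp, intro has_derivative_sum has_derivative_mult_right D)
  qed (simp add: matrix_inv_left_right nz)
  then have "((\<lambda>y. det (M x) * det (matrix_inv (M x) ** M y)) has_derivative
     (\<lambda>h. det (M x) * (\<Sum>i\<in>UNIV. \<Sum>j\<in>UNIV. matrix_inv (M x) $ i $ j * D j i h))) (at x)"
    by (rule has_derivative_mult_right)
  moreover have "det (M x) * det (matrix_inv (M x) ** M y) = det (M y)" for y
    by (simp flip: det_mul add: matrix_mul_assoc matrix_inv_left_right nz)
  ultimately show ?thesis by simp
qed

section \<open>Change of variables over an arbitrary finite index type\<close>

text \<open>A copy of a finite type, ordered by an arbitrary enumeration.  Reindexing coordinates by the
  bijection with the copy changes neither Lebesgue measure nor determinants, so the change of
  variables formula for well-ordered index types carries over to all finite index types.\<close>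

typedef 'a well = "UNIV :: 'a set" by auto

instance well :: (finite) finite
proof
  have "(UNIV :: 'a well set) = Abs_well ` UNIV"
    by (metis Abs_well_cases UNIV_eq_I imageI)
  then show "finite (UNIV :: 'a well set)" by (metis finite finite_imageI)
qed

definition well_code :: "'a::finite well \<Rightarrow> nat"
  where "well_code = (SOME g. inj g)"

lemma inj_well_code: "inj (well_code :: 'a::finite well \<Rightarrow> nat)"
proof -
  have "\<exists>g :: 'a well \<Rightarrow> nat. inj g"
    using finite_imp_inj_to_nat_seg[of "UNIV :: 'a well set"] by auto
  then show ?thesis unfolding well_code_def by (rule someI_ex)
qed

instantiation well :: (finite) wellorder
begin

definition less_eq_well :: "'a well \<Rightarrow> 'a well \<Rightarrow> bool"
  where "less_eq_well x y \<longleftrightarrow> well_code x \<le> well_code y"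

definition less_well :: "'a well \<Rightarrow> 'a well \<Rightarrow> bool"
  where "less_well x y \<longleftrightarrow> well_code x < well_code y"

instance
proof
  fix x y z :: "'a well" and P
  show "(x < y) = (x \<le> y \<and> \<not> y \<le> x)" by (auto simp: less_eq_well_def less_well_def)
  show "x \<le> x" by (simp add: less_eq_well_def)
  show "x \<le> y \<Longrightarrow> y \<le> z \<Longrightarrow> x \<le> z" by (simp add: less_eq_well_def)
  show "x \<le> y \<Longrightarrow> y \<le> x \<Longrightarrow> x = y" using inj_well_code by (auto simp: less_eq_well_def inj_def)
  show "x \<le> y \<or> y \<le> x" by (auto simp: less_eq_well_def)
  show "(\<And>x. (\<And>y. y < x \<Longrightarrow> P y) \<Longrightarrow> P x) \<Longrightarrow> P x" 
    unfolding less_well_def using measure_induct_rule[of well_code P] by blast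
qed

end

lemma det_reindex:
  fixes A :: "real^'n^'n::finite" and r :: "'m::finite \<Rightarrow> 'n"
  assumes r: "bij r"
  shows "det (\<chi> i j. A $ r i $ r j) = det A"
proof -
  let ?f = "map_permutation (UNIV::'m set) r"
  have bij: "bij_betw ?f {p. p permutes UNIV} {p. p permutes UNIV}"
    using bij_betw_permutations[OF r[unfolded bij_betw_def[symmetric]]]
    by (rule bij_betw_cong[THEN iffD1, rotated]) (use r in \<open>auto simp: map_permutation_def fun_eq_iff restrict_id_def bij_def\<close>)
  have "det A = (\<Sum>p\<in>{p. p permutes (UNIV::'m set)}. of_int (sign (?f p)) * (\<Prod>i\<in>UNIV. A $ i $ ?f p i))"
    unfolding det_def by (rule sum.reindex_bij_betw[OF bij, symmetric])
  also have "\<dots> = (\<Sum>p\<in>{p. p permutes (UNIV::'m set)}. of_int (sign p) * (\<Prod>i\<in>UNIV. A $ r i $ r (p i)))"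
  proof (intro sum.cong refl)
    fix p :: "'m \<Rightarrow> 'm" assume p: "p \<in> {p. p permutes UNIV}"
    have "sign (?f p) = sign p"
      using p r by (intro sign_map_permutation) (auto simp: bij_def)
    moreover have "(\<Prod>i\<in>UNIV. A $ i $ ?f p i) = (\<Prod>i\<in>UNIV. A $ r i $ ?f p (r i))"
      by (rule prod.reindex_bij_betw[OF r, symmetric])
    moreover have "?f p (r i) = r (p i)" for i
      using r by (simp add: map_permutation_def bij_def restrict_id_def)
    ultimately show "of_int (sign (?f p)) * (\<Prod>i\<in>UNIV. A $ i $ ?f p i) =
        of_int (sign p) * (\<Prod>i\<in>UNIV. A $ r i $ r (p i))" by simp
  qed
  finally show ?thesis unfolding det_def by simp
qed


text \<open>The area formula for sets of finite image measure, extended to infinite values: a finite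
  integral of the Jacobian would force the image to have finite measure.\<close>

lemma emeasure_differentiable_image_wellorder:
  fixes g :: "real^'m::{finite,wellorder} \<Rightarrow> real^'m::_"
  assumes S: "S \<in> sets borel" "g ` S \<in> sets borel"
    and der: "\<And>x. x \<in> S \<Longrightarrow> (g has_derivative g' x) (at x within S)"
    and inj: "inj_on g S"
  shows "emeasure lborel (g ` S) = (\<integral>\<^sup>+x\<in>S. ennreal \<bar>det (matrix (g' x))\<bar> \<partial>lborel)"
proof -
  let ?D = "\<lambda>x. \<bar>det (matrix (g' x))\<bar>"
  have SL: "S \<in> sets lebesgue" using S(1) by simp
  note iff = has_measure_differentiable_image[OF SL der inj]
  show ?thesis
  proof (cases "emeasure lborel (g ` S) < \<infinity>")
    case True
    then have L: "g ` S \<in> lmeasurable" using S(2) by (simp add: fmeasurable_def)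
    then have "(?D has_integral measure lebesgue (g ` S)) S" using iff by blast
    then have "(\<integral>\<^sup>+x\<in>S. ?D x \<partial>lborel) = ennreal (measure lebesgue (g ` S))"
      by (intro nn_integral_has_integral_lebesgue') auto
    also have "\<dots> = emeasure lborel (g ` S)"
      using emeasure_eq_measure2[OF L] S(2) by simp
    finally show ?thesis by simp
  next
    case False
    have "(\<integral>\<^sup>+x\<in>S. ?D x \<partial>lborel) = \<infinity>"
    proof (rule ccontr)
      assume "(\<integral>\<^sup>+x\<in>S. ?D x \<partial>lborel) \<noteq> \<infinity>"
      then obtain r where r: "(\<integral>\<^sup>+x\<in>S. ?D x \<partial>lborel) = ennreal r" "r \<ge> 0"
        by (cases "\<integral>\<^sup>+x\<in>S. ?D x \<partial>lborel") auto
      let ?f = "\<lambda>x. if x \<in> S then ?D x else 0"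
      have "(\<lambda>x. det (matrix (g' x))) \<in> borel_measurable (lebesgue_on S)"
        by (rule borel_measurable_det_Jacobian[OF SL der])
      then have "?D \<in> borel_measurable (lebesgue_on S)" by measurable
      then have m: "?f \<in> lebesgue \<rightarrow>\<^sub>M borel"
        using SL by (simp add: borel_measurable_if)
      have "integral\<^sup>N lebesgue ?f = (\<integral>\<^sup>+x\<in>S. ?D x \<partial>lborel)"
        unfolding nn_integral_completion by (intro nn_integral_cong) (auto simp: indicator_def)
      then have "(?f has_integral r) UNIV"
        using r m by (subst has_integral_iff_nn_integral_lebesgue) auto
      then have "(?D has_integral r) S" by (simp add: has_integral_restrict_UNIV)
      then have "g ` S \<in> lmeasurable" using iff by blast
      then have "emeasure lebesgue (g ` S) < \<infinity>"
        by (auto simp only: fmeasurable_def mem_Collect_eq)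
      moreover have "emeasure lebesgue (g ` S) = emeasure lborel (g ` S)"
        using S(2) main_part_sets[of "g ` S" lborel] by simp
      ultimately show False using False by simp
    qed
    then show ?thesis using False by (simp add: less_top[symmetric])
  qed
qed

text \<open>Reindexing maps boxes to boxes with the same side lengths, in another order.\<close>

lemma lborel_distr_reindex:
  fixes r :: "'m::finite \<Rightarrow> 'n::finite"
  assumes r: "bij r"
  shows "distr lborel borel (\<lambda>x :: real^'n. \<chi> j. x $ r j) = (lborel :: (real^'m) measure)"
proof (rule lborel_eqI[symmetric])
  let ?R = "\<lambda>x :: real^'n. (\<chi> j. x $ r j) :: real^'m"
  let ?Q = "\<lambda>y :: real^'m. (\<chi> i. y $ inv r i) :: real^'n"
  have [measurable]: "?R \<in> borel_measurable borel"
    by (intro borel_measurable_continuous_onI continuous_intros)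
  fix l u :: "real^'m" assume lu: "\<And>b. b \<in> Basis \<Longrightarrow> l \<bullet> b \<le> u \<bullet> b"
  have lu': "l $ i \<le> u $ i" for i using lu[of "axis i 1"] by (simp add: inner_axis)
  have pr: "(\<Prod>b\<in>Basis. v \<bullet> b) = (\<Prod>i\<in>UNIV. v $ i)" for v :: "real^'k::finite"
    by (simp add: Basis_vec_def UNION_singleton_eq_range prod.reindex inj_on_def axis_eq_axis inner_axis)
  have e: "inv r (r j) = j" "r (inv r i) = i" for i j
    using r by (auto simp: bij_def inv_f_f surj_f_inv_f)
  have "?R -` box l u = box (?Q l) (?Q u)"
    by (auto simp: mem_box_cart) (metis e)+
  then have "emeasure (distr lborel borel ?R) (box l u) = emeasure lborel (box (?Q l) (?Q u))"
    by (simp add: emeasure_distr)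
  also have "\<dots> = (\<Prod>b\<in>Basis. (?Q u - ?Q l) \<bullet> b)"
    by (rule emeasure_lborel_box) (use lu' in \<open>auto simp: Basis_vec_def inner_axis\<close>)
  also have "(\<Prod>b\<in>Basis. (?Q u - ?Q l) \<bullet> b) = (\<Prod>i\<in>UNIV. (u - l) $ inv r i)"
    unfolding pr by simp
  also have "\<dots> = (\<Prod>i\<in>UNIV. (u - l) $ i)"
    by (rule prod.reindex_bij_betw[of "inv r" UNIV UNIV "\<lambda>i. (u - l) $ i"]) (use r bij_imp_bij_inv in blast)
  finally show "emeasure (distr lborel borel ?R) (box l u) = (\<Prod>b\<in>Basis. (u - l) \<bullet> b)"
    unfolding pr .
qed simp

text \<open>Conjugating the map with the reindexing isometry reduces the claim to the well-ordered copy.\<close>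

lemma emeasure_differentiable_image:
  fixes g :: "real^'n::finite \<Rightarrow> real^'n"
  assumes S: "S \<in> sets borel" "g ` S \<in> sets borel"
    and der: "\<And>x. x \<in> S \<Longrightarrow> (g has_derivative g' x) (at x within S)"
    and inj: "inj_on g S"
    and cont: "continuous_on S (\<lambda>x. det (matrix (g' x)))"
  shows "emeasure lborel (g ` S) = (\<integral>\<^sup>+x\<in>S. ennreal \<bar>det (matrix (g' x))\<bar> \<partial>lborel)"
proof -
  let ?r = "Rep_well :: 'n well \<Rightarrow> 'n" and ?r' = "Abs_well :: 'n \<Rightarrow> 'n well"
  define R :: "real^'n \<Rightarrow> real^'n well" where "R = (\<lambda>x. \<chi> j. x $ ?r j)"
  define Q :: "real^'n well \<Rightarrow> real^'n" where "Q = (\<lambda>y. \<chi> i. y $ ?r' i)"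
  have rr: "?r (?r' i) = i" "?r' (?r j) = j" for i j
    by (simp_all add: Abs_well_inverse Rep_well_inverse)
  have bij: "bij ?r" "bij ?r'" by (metis rr bijI')+
  have RQ: "R (Q y) = y" "Q (R x) = x" for x y
    by (simp_all add: R_def Q_def vec_eq_iff rr)
  have lin: "linear R" "linear Q"
    by (auto simp: R_def Q_def vec_eq_iff intro!: linearI)
  have bl: "bounded_linear R" "bounded_linear Q" using lin by (auto simp: linear_linear)
  have [measurable]: "R \<in> borel_measurable borel" "Q \<in> borel_measurable borel"
    using bl by (auto intro!: borel_measurable_continuous_onI linear_continuous_on)
  have dR: "distr lborel borel R = lborel" and dQ: "distr lborel borel Q = lborel"
    unfolding R_def Q_def by (intro lborel_distr_reindex bij)+
  have imR: "R ` A = Q -` A" for A by (auto simp: RQ image_iff) (metis RQ(1))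
  have vimR: "emeasure lborel A = emeasure lborel (R ` A)" "R ` A \<in> sets borel" if "A \<in> sets borel" for A
  proof -
    have "emeasure lborel A = emeasure (distr lborel borel Q) A" by (simp add: dQ)
    also have "\<dots> = emeasure lborel (R ` A)"
      using that by (simp add: emeasure_distr imR)
    finally show "emeasure lborel A = emeasure lborel (R ` A)" .
    show "R ` A \<in> sets borel" unfolding imR using that measurable_sets[of Q borel borel A] by simp
  qed
  let ?g = "\<lambda>y. R (g (Q y))" and ?g' = "\<lambda>y h. R (g' (Q y) (Q h))"
  have im: "?g ` (R ` S) = R ` (g ` S)" by (auto simp: RQ image_image)
  have lin': "linear (g' x)" if "x \<in> S" for x using der[OF that] by (rule has_derivative_linear)
  have det: "det (matrix (?g' y)) = det (matrix (g' (Q y)))" for y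
  proof -
    have Qa: "Q (axis j 1) = axis (?r j) 1" for j by (auto simp: Q_def vec_eq_iff axis_def rr)
    have "matrix (?g' y) = (\<chi> i j. matrix (g' (Q y)) $ ?r i $ ?r j)"
      by (simp add: matrix_def vec_eq_iff R_def Qa)
    then show ?thesis using det_reindex[OF bij(1)] by simp
  qed
  have "emeasure lborel (g ` S) = emeasure lborel (?g ` (R ` S))"
    unfolding im by (rule vimR(1)) (rule S)
  also have "\<dots> = (\<integral>\<^sup>+y\<in>R ` S. ennreal \<bar>det (matrix (?g' y))\<bar> \<partial>lborel)"
  proof (rule emeasure_differentiable_image_wellorder)
    show "R ` S \<in> sets borel" "?g ` (R ` S) \<in> sets borel" unfolding im using vimR(2) S by auto
    show "inj_on ?g (R ` S)" using inj by (auto simp: inj_on_def RQ) (metis RQ(2))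
    fix y assume y: "y \<in> R ` S"
    then have yS: "Q y \<in> S" and QS: "Q ` (R ` S) = S" by (auto simp: RQ image_image)
    have "((\<lambda>y. g (Q y)) has_derivative (\<lambda>h. g' (Q y) (Q h))) (at y within R ` S)"
      by (rule has_derivative_in_compose[OF bounded_linear_imp_has_derivative[OF bl(2)]])
         (use der[OF yS] QS in simp)
    then show "(?g has_derivative ?g' y) (at y within R ` S)"
      by (rule bounded_linear.has_derivative[OF bl(1)])
  qed
  also have "\<dots> = (\<integral>\<^sup>+y. ennreal \<bar>indicator S (Q y) * det (matrix (g' (Q y)))\<bar> \<partial>lborel)"
    unfolding det imR by (intro nn_integral_cong) (auto simp: indicator_def)
  also have "\<dots> = (\<integral>\<^sup>+x. ennreal \<bar>indicator S x * det (matrix (g' x))\<bar> \<partial>distr lborel borel Q)"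
  proof -
    have "(\<lambda>x. indicator S x *\<^sub>R det (matrix (g' x))) \<in> borel_measurable borel"
      by (rule borel_measurable_continuous_on_indicator[OF S(1) cont])
    then show ?thesis by (subst nn_integral_distr) simp_all
  qed
  also have "\<dots> = (\<integral>\<^sup>+x\<in>S. ennreal \<bar>det (matrix (g' x))\<bar> \<partial>lborel)"
    unfolding dQ by (intro nn_integral_cong) (auto simp: indicator_def)
  finally show ?thesis .
qed

text \<open>Both sides integrate \<open>h\<close> against a Borel measure, and the two measures agree on every Borel
  set by the formula for images.\<close>

theorem nn_integral_change_of_variables:
  fixes g :: "real^'n::finite \<Rightarrow> real^'n"
  assumes S: "S \<in> sets borel" "g ` S \<in> sets borel"
    and der: "\<And>x. x \<in> S \<Longrightarrow> (g has_derivative g' x) (at x within S)"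
    and inj: "inj_on g S"
    and cont: "continuous_on S (\<lambda>x. det (matrix (g' x)))"
    and h[measurable]: "h \<in> borel_measurable borel"
  shows "(\<integral>\<^sup>+y\<in>g ` S. h y \<partial>lborel) = (\<integral>\<^sup>+x\<in>S. h (g x) * ennreal \<bar>det (matrix (g' x))\<bar> \<partial>lborel)"
proof -
  note [measurable] = S
  have gc: "continuous_on S g"
    using der by (meson continuous_on_eq_continuous_within has_derivative_continuous)
  define G where "G = (\<lambda>x. indicator S x *\<^sub>R g x)"
  define D where "D = (\<lambda>x. indicator S x *\<^sub>R det (matrix (g' x)))"
  have [measurable]: "G \<in> borel_measurable borel" "D \<in> borel_measurable borel"
    unfolding G_def D_def
    by (intro borel_measurable_continuous_on_indicator S gc cont)+
  have "density lborel (indicator (g ` S)) = distr (density lborel (\<lambda>x. ennreal \<bar>D x\<bar>)) borel G"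
  proof (rule measure_eqI)
    fix E assume "E \<in> sets (density lborel (indicator (g ` S) :: _ \<Rightarrow> ennreal))"
    then have E[measurable]: "E \<in> sets borel" by simp
    have SE[measurable]: "S \<inter> G -` E \<in> sets borel" by measurable
    have im: "g ` (S \<inter> G -` E) = g ` S \<inter> E" by (auto simp: G_def)
    have "emeasure (density lborel (indicator (g ` S))) E = emeasure lborel (g ` (S \<inter> G -` E))"
      unfolding im by (simp add: emeasure_density flip: indicator_inter_arith)
    also have "\<dots> = (\<integral>\<^sup>+x\<in>S \<inter> G -` E. ennreal \<bar>det (matrix (g' x))\<bar> \<partial>lborel)"
    proof (rule emeasure_differentiable_image)
      show "g ` (S \<inter> G -` E) \<in> sets borel" unfolding im by simp
      show "inj_on g (S \<inter> G -` E)" using inj by (rule inj_on_subset) auto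
      show "continuous_on (S \<inter> G -` E) (\<lambda>x. det (matrix (g' x)))"
        using cont by (rule continuous_on_subset) auto
      show "(g has_derivative g' x) (at x within S \<inter> G -` E)" if "x \<in> S \<inter> G -` E" for x
        using der[of x] that by (auto intro: has_derivative_subset)
    qed simp
    also have "\<dots> = (\<integral>\<^sup>+x. ennreal \<bar>D x\<bar> * indicator (G -` E) x \<partial>lborel)"
      by (intro nn_integral_cong) (auto simp: D_def indicator_def)
    also have "\<dots> = emeasure (distr (density lborel (\<lambda>x. ennreal \<bar>D x\<bar>)) borel G) E"
      using measurable_sets[of G borel borel E] by (simp add: emeasure_distr emeasure_density)
    finally show "emeasure (density lborel (indicator (g ` S))) E =
        emeasure (distr (density lborel (\<lambda>x. ennreal \<bar>D x\<bar>)) borel G) E" .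
  qed simp
  then have "(\<integral>\<^sup>+y. h y \<partial>density lborel (indicator (g ` S))) =
     (\<integral>\<^sup>+y. h y \<partial>distr (density lborel (\<lambda>x. ennreal \<bar>D x\<bar>)) borel G)" by simp
  also have "\<dots> = (\<integral>\<^sup>+x. ennreal \<bar>D x\<bar> * h (G x) \<partial>lborel)"
    by (subst nn_integral_distr) (auto simp: nn_integral_density)
  also have "\<dots> = (\<integral>\<^sup>+x\<in>S. h (g x) * ennreal \<bar>det (matrix (g' x))\<bar> \<partial>lborel)"
    by (intro nn_integral_cong) (auto simp: D_def G_def indicator_def mult.commute)
  finally show ?thesis by (simp add: nn_integral_density mult.commute)
qed

section \<open>Continuously differentiable maps\<close>

abbreviation C1_on :: "'a::real_normed_vector set \<Rightarrow> ('a \<Rightarrow> 'b::real_normed_vector) \<Rightarrow> bool"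
  where "C1_on \<equiv> Ck_on (Suc 0)"

text \<open>Directional continuity of the derivative is what \<open>Ck_on\<close> asks for; on a finite-dimensional
  domain it amounts to the usual notion.  The rules below hold on arbitrary sets \<open>S\<close>, because
  derivatives are taken in the ambient space.\<close>

lemma C1_onI:
  assumes "\<And>x. x \<in> S \<Longrightarrow> (f has_derivative D x) (at x)"
    and "\<And>v. continuous_on S (\<lambda>x. D x v)"
  shows "C1_on S f"
proof -
  have "fderiv f x = D x" if "x \<in> S" for x
    using frechet_derivative_at[OF assms(1)[OF that]] by simp
  then have "continuous_on S (\<lambda>x. fderiv f x v)" for v
    using assms(2)[of v] by (simp cong: continuous_on_cong)
  moreover have "\<forall>x\<in>S. f differentiable (at x)"
    using assms(1) by (auto simp: differentiable_def)
  ultimately show ?thesis by simp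
qed

lemma C1_on_has_derivative:
  "C1_on S f \<Longrightarrow> x \<in> S \<Longrightarrow> (f has_derivative fderiv f x) (at x)"
  by (simp add: frechet_derivative_works)

lemma C1_on_continuous_derivative:
  "C1_on S f \<Longrightarrow> continuous_on S (\<lambda>x. fderiv f x v)"
  by simp

lemma C1_on_continuous: "C1_on S f \<Longrightarrow> continuous_on S f"
  by (meson C1_on_has_derivative continuous_at_imp_continuous_on has_derivative_continuous)

lemma C1_on_linear: "C1_on S f \<Longrightarrow> x \<in> S \<Longrightarrow> linear (fderiv f x)"
  by (rule has_derivative_linear[OF C1_on_has_derivative])

lemma C1_on_subset: "C1_on S f \<Longrightarrow> T \<subseteq> S \<Longrightarrow> C1_on T f"
  by (auto intro: continuous_on_subset)

lemma C1_on_local: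
  assumes "\<And>x. x \<in> S \<Longrightarrow> \<exists>U. open U \<and> x \<in> U \<and> C1_on U f"
  shows "C1_on S f"
proof (rule C1_onI)
  show "(f has_derivative fderiv f x) (at x)" if "x \<in> S" for x
    using assms[OF that] C1_on_has_derivative by blast
  show "continuous_on S (\<lambda>x. fderiv f x v)" for v
  proof (rule continuous_at_imp_continuous_on, rule ballI)
    fix x assume "x \<in> S"
    then obtain U where "open U" "x \<in> U" "C1_on U f" using assms by blast
    then show "isCont (\<lambda>x. fderiv f x v) x"
      using C1_on_continuous_derivative[of U f v] by (simp add: continuous_on_eq_continuous_at)
  qed
qed

lemma frechet_derivative_eq_on_open:
  assumes "open S" "x \<in> S" "\<And>y. y \<in> S \<Longrightarrow> f y = g y"
  shows "fderiv f x = fderiv g x"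
proof -
  have "(f has_derivative D) (at x) \<longleftrightarrow> (g has_derivative D) (at x)" for D
    using has_derivative_transform_within_open[OF _ assms(1,2)] assms(3) by metis
  then show ?thesis by (simp add: frechet_derivative_def)
qed

lemma Ck_on_cong_open:
  assumes "open S" "\<And>x. x \<in> S \<Longrightarrow> f x = g x" "Ck_on k S f"
  shows "Ck_on k S g"
  using assms(2,3)
proof (induction k arbitrary: f g)
  case 0
  then show ?case by (simp cong: continuous_on_cong)
next
  case (Suc k)
  have eq: "fderiv f x = fderiv g x" if "x \<in> S" for x
    by (rule frechet_derivative_eq_on_open[OF assms(1) that Suc.prems(1)])
  have "g differentiable (at x)" if "x \<in> S" for x
    using Suc.prems that has_derivative_transform_within_open[OF _ assms(1) that]
    unfolding Ck_on.simps differentiable_def by metis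
  moreover have "Ck_on k S (\<lambda>x. fderiv g x v)" for v
    by (rule Suc.IH[of "\<lambda>x. fderiv f x v"]) (use eq Suc.prems in auto)
  ultimately show ?case by simp
qed

lemma C1_on_const: "C1_on S (\<lambda>x. c)"
  by (rule C1_onI[where D = "\<lambda>x v. 0"]) (auto intro!: derivative_eq_intros)

lemma C1_on_linear_map:
  assumes "bounded_linear f" shows "C1_on S f"
  by (rule C1_onI[where D = "\<lambda>x. f"])
     (auto intro: bounded_linear_imp_has_derivative assms)

lemma C1_on_add:
  assumes "C1_on S f" "C1_on S g" shows "C1_on S (\<lambda>x. f x + g x)"
  by (rule C1_onI)
     (auto intro!: has_derivative_add C1_on_has_derivative[OF assms(1)] C1_on_has_derivative[OF assms(2)]
        continuous_on_add C1_on_continuous_derivative[OF assms(1)] C1_on_continuous_derivative[OF assms(2)])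

lemma C1_on_diff:
  assumes "C1_on S f" "C1_on S g" shows "C1_on S (\<lambda>x. f x - g x)"
  by (rule C1_onI)
     (auto intro!: has_derivative_diff C1_on_has_derivative[OF assms(1)] C1_on_has_derivative[OF assms(2)]
        continuous_on_diff C1_on_continuous_derivative[OF assms(1)] C1_on_continuous_derivative[OF assms(2)])

lemma C1_on_bilinear:
  assumes b: "bounded_bilinear b" and f: "C1_on S f" and g: "C1_on S g"
  shows "C1_on S (\<lambda>x. b (f x) (g x))"
proof (rule C1_onI)
  show "((\<lambda>x. b (f x) (g x)) has_derivative
      (\<lambda>h. b (f x) (fderiv g x h) + b (fderiv f x h) (g x))) (at x)"
    if "x \<in> S" for x
    by (rule bounded_bilinear.FDERIV[OF b]) (auto intro: C1_on_has_derivative f g that)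
  show "continuous_on S (\<lambda>x. b (f x) (fderiv g x v) + b (fderiv f x v) (g x))" for v
    by (intro continuous_on_add bounded_bilinear.continuous_on[OF b]
        C1_on_continuous[OF f] C1_on_continuous[OF g]
        C1_on_continuous_derivative[OF f] C1_on_continuous_derivative[OF g])
qed

lemmas C1_on_mult = C1_on_bilinear[OF bounded_bilinear_mult]
lemmas C1_on_inner = C1_on_bilinear[OF bounded_bilinear_inner]

lemma C1_on_sum:
  assumes "\<And>i. i \<in> I \<Longrightarrow> C1_on S (f i)"
  shows "C1_on S (\<lambda>x. \<Sum>i\<in>I. f i x)"
  using assms
proof (induction I rule: infinite_finite_induct)
  case (insert i I)
  then show ?case using C1_on_add[of S "f i" "\<lambda>x. \<Sum>i\<in>I. f i x"] by (simp del: Ck_on.simps)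
qed (simp_all add: C1_on_const del: Ck_on.simps)

lemma C1_on_prod:
  fixes f :: "_ \<Rightarrow> _ \<Rightarrow> real"
  assumes "\<And>i. i \<in> I \<Longrightarrow> C1_on S (f i)"
  shows "C1_on S (\<lambda>x. \<Prod>i\<in>I. f i x)"
  using assms
proof (induction I rule: infinite_finite_induct)
  case (insert i I)
  then show ?case using C1_on_mult[of S "f i" "\<lambda>x. \<Prod>i\<in>I. f i x"] by (simp del: Ck_on.simps)
qed (simp_all add: C1_on_const del: Ck_on.simps)

lemma C1_on_det:
  fixes M :: "'a::real_normed_vector \<Rightarrow> real^'n^'n::finite"
  assumes "\<And>i j. C1_on S (\<lambda>x. M x $ i $ j)"
  shows "C1_on S (\<lambda>x. det (M x))"
  unfolding det_def by (intro C1_on_sum C1_on_mult C1_on_const C1_on_prod assms)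

lemma C1_on_compose_real:
  fixes f :: "'a::real_normed_vector \<Rightarrow> real" and h :: "real \<Rightarrow> real"
  assumes f: "C1_on S f" and im: "f ` S \<subseteq> U"
    and h: "\<And>t. t \<in> U \<Longrightarrow> (h has_real_derivative h' t) (at t)" and c: "continuous_on U h'"
  shows "C1_on S (\<lambda>x. h (f x))"
proof (rule C1_onI)
  show "((\<lambda>x. h (f x)) has_derivative (\<lambda>v. h' (f x) * fderiv f x v)) (at x)"
    if "x \<in> S" for x
    using has_derivative_compose[OF C1_on_has_derivative[OF f that], of h "(*) (h' (f x))"]
      h[of "f x"] im that by (auto simp: has_field_derivative_def)
  have "continuous_on S (\<lambda>x. h' (f x))"
    by (rule continuous_on_compose2[OF c C1_on_continuous[OF f] im])
  then show "continuous_on S (\<lambda>x. h' (f x) * fderiv f x v)" for v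
    by (intro continuous_on_mult C1_on_continuous_derivative[OF f])
qed

lemma C1_on_inverse:
  fixes f :: "'a::real_normed_vector \<Rightarrow> real"
  assumes "C1_on S f" "\<And>x. x \<in> S \<Longrightarrow> f x \<noteq> 0"
  shows "C1_on S (\<lambda>x. inverse (f x))"
  by (rule C1_on_compose_real[OF assms(1), where U = "-{0}" and h' = "\<lambda>t. - (inverse t * inverse t)"])
     (use assms(2) in \<open>auto intro!: derivative_eq_intros continuous_intros simp: power2_eq_square\<close>)

lemma C1_on_divide:
  fixes f g :: "'a::real_normed_vector \<Rightarrow> real"
  assumes "C1_on S f" "C1_on S g" "\<And>x. x \<in> S \<Longrightarrow> g x \<noteq> 0"
  shows "C1_on S (\<lambda>x. f x / g x)"
  unfolding divide_inverse by (intro C1_on_mult C1_on_inverse assms)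

lemma C1_on_sqrt:
  fixes f :: "'a::real_normed_vector \<Rightarrow> real"
  assumes "C1_on S f" "\<And>x. x \<in> S \<Longrightarrow> f x > 0"
  shows "C1_on S (\<lambda>x. sqrt (f x))"
  by (rule C1_on_compose_real[OF assms(1), where U = "{0<..}" and h' = "\<lambda>t. inverse (sqrt t) / 2"])
     (use assms(2) in \<open>auto intro!: derivative_eq_intros continuous_intros simp: field_simps\<close>)

text \<open>The derivative of \<open>g\<close> is taken in a direction that varies with the point; expanding this
  direction in the standard basis leaves finitely many fixed directions.\<close>

lemma C1_on_compose:
  fixes f :: "'a::real_normed_vector \<Rightarrow> real^'m::finite" and g :: "real^'m \<Rightarrow> 'b::real_normed_vector"
  assumes f: "C1_on S f" and im: "f ` S \<subseteq> T" and g: "C1_on T g"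
  shows "C1_on S (\<lambda>x. g (f x))"
proof (rule C1_onI)
  show "((\<lambda>x. g (f x)) has_derivative
      (\<lambda>v. fderiv g (f x) (fderiv f x v))) (at x)" if "x \<in> S" for x
    using im that by (intro has_derivative_compose[OF C1_on_has_derivative[OF f that]] C1_on_has_derivative[OF g]) auto
  fix v
  have "continuous_on S (\<lambda>x. \<Sum>i\<in>UNIV. fderiv f x v $ i *\<^sub>R
      fderiv g (f x) (axis i 1))"
    by (intro continuous_on_sum continuous_on_scaleR continuous_on_component C1_on_continuous_derivative[OF f]
        continuous_on_compose2[OF C1_on_continuous_derivative[OF g] C1_on_continuous[OF f] im])
  moreover have "fderiv g (f x) (fderiv f x v) =
      (\<Sum>i\<in>UNIV. fderiv f x v $ i *\<^sub>R fderiv g (f x) (axis i 1))"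
    if "x \<in> S" for x
    using im that by (intro linear_expand_axis C1_on_linear[OF g]) auto
  ultimately show "continuous_on S (\<lambda>x. fderiv g (f x) (fderiv f x v))"
    by (simp cong: continuous_on_cong)
qed

text \<open>The square of the positive part is the \<open>C\<^sup>1\<close> cut-off from which both the bump functions and the
  one-sided profile are built.\<close>

lemma DERIV_max0_square: "((\<lambda>t::real. (max 0 t)\<^sup>2) has_real_derivative 2 * max 0 t) (at t)"
proof -
  consider "t > 0" | "t < 0" | "t = 0" by linarith
  then show ?thesis
  proof cases
    case 1
    have "((\<lambda>t::real. t\<^sup>2) has_real_derivative 2 * max 0 t) (at t)"
      using 1 by (auto intro!: derivative_eq_intros)
    then show ?thesis
      by (rule has_field_derivative_transform_within_open[of _ _ _ "{0<..}"]) (use 1 in auto)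
  next
    case 2
    have "((\<lambda>t::real. 0) has_real_derivative 2 * max 0 t) (at t)" using 2 by simp
    then show ?thesis
      by (rule has_field_derivative_transform_within_open[of _ _ _ "{..<0}"]) (use 2 in auto)
  next
    case 3
    have "(\<lambda>h::real. (max 0 h)\<^sup>2 / h) \<midarrow>0\<rightarrow> 0"
    proof (rule Lim_null_comparison)
      show "\<forall>\<^sub>F h in at 0. norm ((max 0 h)\<^sup>2 / h) \<le> \<bar>h\<bar>"
        by (auto simp: eventually_at max_def power2_eq_square intro!: exI[of _ 1])
      show "(\<lambda>h::real. \<bar>h\<bar>) \<midarrow>0\<rightarrow> 0" by (rule tendsto_rabs_zero) (rule tendsto_ident_at)
    qed
    then show ?thesis unfolding 3 DERIV_def by simp
  qed
qed

lemma frechet_derivative_outside_support: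
  assumes "closed K" "\<And>y. y \<notin> K \<Longrightarrow> w y = 0" "x \<notin> K"
  shows "fderiv w x v = 0"
proof -
  have "fderiv w x = fderiv (\<lambda>y. 0) x"
    by (rule frechet_derivative_eq_on_open[of "-K"]) (use assms in auto)
  then show ?thesis by simp
qed

text \<open>The extension is \<open>w\<close> on the open set \<open>V\<close> and \<open>0\<close> on the open set \<open>- K\<close>, and these cover.\<close>

lemma C1_on_extend_by_zero:
  assumes V: "open V" and w: "C1_on V w" and K: "closed K" "K \<subseteq> V" "\<And>x. x \<in> V - K \<Longrightarrow> w x = 0"
  shows "C1_on UNIV (\<lambda>x. if x \<in> V then w x else 0)"
proof (rule C1_on_local)
  fix x
  show "\<exists>U. open U \<and> x \<in> U \<and> C1_on U (\<lambda>x. if x \<in> V then w x else 0)"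
  proof (cases "x \<in> V")
    case True
    have "C1_on V (\<lambda>x. if x \<in> V then w x else 0)"
      by (rule Ck_on_cong_open[OF V _ w]) simp
    then show ?thesis using V True by blast
  next
    case False
    have "C1_on (-K) (\<lambda>x. if x \<in> V then w x else 0)"
      by (rule Ck_on_cong_open[OF _ _ C1_on_const[of _ 0]]) (use K in auto)
    then show ?thesis using K False by (intro exI[of _ "-K"]) auto
  qed
qed

text \<open>Translation invariance says that the difference quotients of a compactly supported function
  have integral zero, and the derivative is their dominated limit.\<close>

lemma integral_derivative_compact_support:
  fixes w :: "'a::euclidean_space \<Rightarrow> real"
  assumes w: "C1_on UNIV w" and K: "compact K" "\<And>x. x \<notin> K \<Longrightarrow> w x = 0"
  shows "integrable lborel (\<lambda>x. fderiv w x v)"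
    and "(\<integral>x. fderiv w x v \<partial>lborel) = 0"
proof -
  let ?D = "\<lambda>x. fderiv w x v"
  have contw: "continuous_on A w" for A
    using C1_on_continuous[OF w] continuous_on_subset by blast
  have contD: "continuous_on A ?D" for A
    using C1_on_continuous_derivative[OF w] continuous_on_subset by blast
  have Dz: "?D x = 0" if "x \<notin> K" for x
    by (rule frechet_derivative_outside_support[OF compact_imp_closed[OF K(1)] K(2) that])
  have supp: "integrable lborel h" if "continuous_on K h" "\<And>x. x \<notin> K \<Longrightarrow> h x = 0" for h :: "'a \<Rightarrow> real"
  proof -
    have "integrable lborel (\<lambda>x. indicator K x *\<^sub>R h x)"
      by (rule borel_integrable_compact[OF K(1) that(1)])
    moreover have "(\<lambda>x. indicator K x *\<^sub>R h x) = h" by (intro ext) (auto simp: indicator_def that(2))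
    ultimately show ?thesis by simp
  qed
  have iw: "integrable lborel w" by (rule supp[OF contw K(2)])
  show "integrable lborel ?D" by (rule supp[OF contD Dz])
  obtain C where C: "\<And>x. x \<in> K \<Longrightarrow> \<bar>?D x\<bar> \<le> C"
    using compact_imp_bounded[OF compact_continuous_image[OF contD K(1)]]
    by (force simp: bounded_iff)
  have CD: "\<bar>?D x\<bar> \<le> \<bar>C\<bar>" for x using C[of x] Dz[of x] by (cases "x \<in> K") auto
  obtain R where R: "\<And>x. x \<in> K \<Longrightarrow> norm x \<le> R"
    using compact_imp_bounded[OF K(1)] by (auto simp: bounded_iff)
  define t :: "nat \<Rightarrow> real" where "t k = inverse (real (Suc k))" for k
  have t: "0 < t k" "t k \<le> 1" for k by (auto simp: t_def field_simps)
  have tl: "t \<longlonglongrightarrow> 0" unfolding t_def by (rule LIMSEQ_inverse_real_of_nat)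
  define q where "q k x = (w (x + t k *\<^sub>R v) - w x) / t k" for k x
  have dline: "((\<lambda>s. w (x + s *\<^sub>R v)) has_real_derivative ?D (x + s *\<^sub>R v)) (at s)" for x s
  proof -
    have "((\<lambda>s. w (x + s *\<^sub>R v)) has_derivative (\<lambda>h. fderiv w (x + s *\<^sub>R v) (h *\<^sub>R v))) (at s)"
      by (rule has_derivative_compose[OF _ C1_on_has_derivative[OF w]]) (auto intro!: derivative_eq_intros)
    moreover have "fderiv w (x + s *\<^sub>R v) (h *\<^sub>R v) = ?D (x + s *\<^sub>R v) * h" for h
      using C1_on_linear[OF w, of "x + s *\<^sub>R v"] by (simp add: linear_scale)
    ultimately show ?thesis by (simp add: has_field_derivative_def)
  qed
  have bound: "norm (q k x) \<le> \<bar>C\<bar> * indicator (cball 0 (R + norm v)) x" for k x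
  proof (cases "norm x \<le> R + norm v")
    case True
    obtain s where s: "w (x + t k *\<^sub>R v) - w (x + 0 *\<^sub>R v) = (t k - 0) * ?D (x + s *\<^sub>R v)"
      using MVT2[of 0 "t k" "\<lambda>s. w (x + s *\<^sub>R v)" "\<lambda>s. ?D (x + s *\<^sub>R v)"] t dline by blast
    then have "q k x = ?D (x + s *\<^sub>R v)" using t[of k] by (simp add: q_def)
    then show ?thesis using True CD by (simp add: indicator_def)
  next
    case False
    have "norm x - norm (t k *\<^sub>R v) \<le> norm (x + t k *\<^sub>R v)"
      using norm_triangle_ineq2[of x "- (t k *\<^sub>R v)"] by simp
    moreover have "norm (t k *\<^sub>R v) \<le> norm v" using t[of k] by (simp add: mult_left_le_one_le)
    ultimately have "norm (x + t k *\<^sub>R v) > R" using False by linarith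
    moreover have "norm x > R" using False norm_ge_zero[of v] by linarith
    ultimately have "w (x + t k *\<^sub>R v) = 0" "w x = 0" using R K(2) by (meson not_le)+
    then show ?thesis by (simp add: q_def)
  qed
  have trans: "integrable lborel (\<lambda>x. w (x + c))" "(\<integral>x. w (x + c) \<partial>lborel) = (\<integral>x. w x \<partial>lborel)" for c
  proof -
    have d: "lborel = distr lborel borel (\<lambda>x. x + c)"
      using lborel_distr_plus[of c] unfolding add.commute[of c] by simp
    have m: "w \<in> borel_measurable borel" using iw by simp
    show "integrable lborel (\<lambda>x. w (x + c))"
      using iw by (subst (asm) d) (simp add: integrable_distr_eq m)
    show "(\<integral>x. w (x + c) \<partial>lborel) = (\<integral>x. w x \<partial>lborel)"
      by (subst (2) d) (simp add: integral_distr m)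
  qed
  have "(\<lambda>k. \<integral>x. q k x \<partial>lborel) \<longlonglongrightarrow> (\<integral>x. ?D x \<partial>lborel)"
  proof (rule integral_dominated_convergence)
    show "integrable lborel (\<lambda>x. \<bar>C\<bar> * indicator (cball 0 (R + norm v)) x :: real)"
      by (intro integrable_mult_right integrable_real_indicator)
         (simp_all only: emeasure_lborel_cball_finite sets_lborel borel_closed closed_cball)
    show "AE x in lborel. norm (q k x) \<le> \<bar>C\<bar> * indicator (cball 0 (R + norm v)) x" for k
      using bound by simp
    show "AE x in lborel. (\<lambda>k. q k x) \<longlonglongrightarrow> ?D x"
    proof (rule AE_I2)
      fix x
      have "((\<lambda>h. (w (x + h *\<^sub>R v) - w x) / h) \<longlongrightarrow> ?D x) (at 0)"
        using dline[of x 0] by (simp add: DERIV_def)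
      then show "(\<lambda>k. q k x) \<longlonglongrightarrow> ?D x"
        unfolding q_def by (rule filterlim_compose) (use tl t in \<open>auto simp: filterlim_at less_imp_neq[symmetric]\<close>)
    qed
    show "q k \<in> borel_measurable lborel" for k
      unfolding q_def using trans(1)[of "t k *\<^sub>R v"] iw by (auto dest!: borel_measurable_integrable)
    show "?D \<in> borel_measurable lborel" using contD borel_measurable_continuous_onI by auto
  qed
  moreover have "(\<integral>x. q k x \<partial>lborel) = 0" for k
    unfolding q_def using trans iw by simp
  ultimately show "(\<integral>x. ?D x \<partial>lborel) = 0" by (simp add: LIMSEQ_const_iff)
qed

text \<open>Symmetry of second derivatives: the second difference of \<open>G\<close> is symmetric in the two
  directions, and the mean value theorem turns it into either mixed derivative.\<close>

lemma second_difference_mean_value: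
  fixes G :: "'a::real_normed_vector \<Rightarrow> real"
  assumes C1: "C1_on (ball x r) G" "C1_on (ball x r) (\<lambda>y. fderiv G y a)"
    and t: "t > 0" "t * (norm a + norm b) < r"
  obtains y where "dist y x \<le> t * (norm a + norm b)"
    "G (x + t *\<^sub>R a + t *\<^sub>R b) - G (x + t *\<^sub>R a) - G (x + t *\<^sub>R b) + G x
      = t * (t * fderiv (\<lambda>y. fderiv G y a) y b)"
proof -
  have near: "dist (x + s *\<^sub>R a + s' *\<^sub>R b) x \<le> t * (norm a + norm b)"
    if "0 \<le> s" "s \<le> t" "0 \<le> s'" "s' \<le> t" for s s'
  proof -
    have "dist (x + s *\<^sub>R a + s' *\<^sub>R b) x = norm (s *\<^sub>R a + s' *\<^sub>R b)" by (simp add: dist_norm)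
    also have "\<dots> \<le> s * norm a + s' * norm b" using norm_triangle_ineq[of "s *\<^sub>R a" "s' *\<^sub>R b"] that by simp
    also have "\<dots> \<le> t * norm a + t * norm b" using that by (intro add_mono mult_right_mono) auto
    finally show ?thesis by (simp add: distrib_left)
  qed
  have inb: "x + s *\<^sub>R a + s' *\<^sub>R b \<in> ball x r"
    if "0 \<le> s" "s \<le> t" "0 \<le> s'" "s' \<le> t" for s s'
    using near[OF that] t(2) by (simp add: dist_commute)
  have line: "((\<lambda>s. h (z + s *\<^sub>R c)) has_real_derivative fderiv h (z + s *\<^sub>R c) c) (at s)"
    if "C1_on (ball x r) h" "z + s *\<^sub>R c \<in> ball x r" for h :: "'a \<Rightarrow> real" and z c s
  proof -
    have "((\<lambda>s. h (z + s *\<^sub>R c)) has_derivative (\<lambda>k. fderiv h (z + s *\<^sub>R c) (k *\<^sub>R c))) (at s)"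
      by (rule has_derivative_compose[of "\<lambda>s. z + s *\<^sub>R c" "\<lambda>k. k *\<^sub>R c" s UNIV h,
            OF _ C1_on_has_derivative[OF that]]) (auto intro!: derivative_eq_intros)
    moreover have "fderiv h (z + s *\<^sub>R c) (k *\<^sub>R c) = fderiv h (z + s *\<^sub>R c) c * k" for k
      using C1_on_linear[OF that] by (simp add: linear_scale)
    ultimately show ?thesis by (simp add: has_field_derivative_def)
  qed
  let ?Da = "\<lambda>y. fderiv G y a"
  define g where "g s = G (x + t *\<^sub>R b + s *\<^sub>R a) - G (x + s *\<^sub>R a)" for s
  have "(g has_real_derivative ?Da (x + t *\<^sub>R b + s *\<^sub>R a) - ?Da (x + s *\<^sub>R a)) (at s)"
    if "0 \<le> s" "s \<le> t" for s
    unfolding g_def using inb[of s t] inb[of s 0] that t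
    by (intro DERIV_diff line[OF C1(1)]) (auto simp: add_ac)
  then obtain s where s: "0 < s" "s < t" "g t - g 0 = (t - 0) * (?Da (x + t *\<^sub>R b + s *\<^sub>R a) - ?Da (x + s *\<^sub>R a))"
    using MVT2[of 0 t g "\<lambda>s. ?Da (x + t *\<^sub>R b + s *\<^sub>R a) - ?Da (x + s *\<^sub>R a)"] t(1) by metis
  have "((\<lambda>s'. ?Da (x + s *\<^sub>R a + s' *\<^sub>R b)) has_real_derivative
      fderiv ?Da (x + s *\<^sub>R a + s' *\<^sub>R b) b) (at s')" if "0 \<le> s'" "s' \<le> t" for s'
    using inb[of s s'] that s by (intro line[OF C1(2)]) auto
  then obtain s' where s': "0 < s'" "s' < t" "?Da (x + s *\<^sub>R a + t *\<^sub>R b) - ?Da (x + s *\<^sub>R a + 0 *\<^sub>R b)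
      = (t - 0) * fderiv ?Da (x + s *\<^sub>R a + s' *\<^sub>R b) b"
    using MVT2[of 0 t "\<lambda>s'. ?Da (x + s *\<^sub>R a + s' *\<^sub>R b)"
        "\<lambda>s'. fderiv ?Da (x + s *\<^sub>R a + s' *\<^sub>R b) b"] t(1) by blast
  show ?thesis
  proof
    show "dist (x + s *\<^sub>R a + s' *\<^sub>R b) x \<le> t * (norm a + norm b)" using near s s' by simp
    show "G (x + t *\<^sub>R a + t *\<^sub>R b) - G (x + t *\<^sub>R a) - G (x + t *\<^sub>R b) + G x
      = t * (t * fderiv ?Da (x + s *\<^sub>R a + s' *\<^sub>R b) b)"
      using s(3) s'(3) by (simp add: g_def add_ac)
  qed
qed

lemma second_derivative_symmetric_real:
  fixes G :: "'a::real_normed_vector \<Rightarrow> real"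
  assumes S: "open S" "x \<in> S" and G: "C1_on S G"
    and Ga: "C1_on S (\<lambda>y. fderiv G y a)"
    and Gb: "C1_on S (\<lambda>y. fderiv G y b)"
  shows "fderiv (\<lambda>y. fderiv G y a) x b
       = fderiv (\<lambda>y. fderiv G y b) x a"
proof -
  let ?Dab = "\<lambda>y. fderiv (\<lambda>y. fderiv G y a) y b"
  let ?Dba = "\<lambda>y. fderiv (\<lambda>y. fderiv G y b) y a"
  obtain r where r: "r > 0" "ball x r \<subseteq> S" using S open_contains_ball by blast
  define t where "t k = r / (norm a + norm b + 1) / real (Suc (Suc k))" for k :: nat
  define N where "N = norm a + norm b"
  have N: "N \<ge> 0" by (simp add: N_def)
  have t: "t k > 0" "t k * N < r" for k
  proof -
    have "r / (N + 1) / real (Suc (Suc k)) > 0" using r(1) N by (intro divide_pos_pos) linarith+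
    then show "t k > 0" by (simp only: t_def N_def)
    have "t k * N = r * (N / (N + 1)) / real (Suc (Suc k))" by (simp add: t_def N_def)
    also have "\<dots> \<le> r * 1 / real (Suc (Suc k))"
      using r N by (intro divide_right_mono mult_left_mono) auto
    also have "\<dots> < r" using r(1) by (simp add: divide_less_eq add_pos_nonneg)
    finally show "t k * N < r" .
  qed
  have tl: "(\<lambda>k. t k * N) \<longlonglongrightarrow> 0"
  proof -
    have "(\<lambda>k. (r / (N + 1)) * N * inverse (real (Suc (Suc k)))) \<longlonglongrightarrow> r / (N+1) * N * 0"
      by (intro tendsto_mult_left LIMSEQ_Suc[OF LIMSEQ_inverse_real_of_nat])
    then show ?thesis by (simp add: t_def N_def divide_inverse mult_ac)
  qed
  have "\<exists>y z. dist y x \<le> t k * N \<and> dist z x \<le> t k * N \<and> ?Dab y = ?Dba z" for k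
  proof -
    obtain y where y: "dist y x \<le> t k * N"
      "G (x + t k *\<^sub>R a + t k *\<^sub>R b) - G (x + t k *\<^sub>R a) - G (x + t k *\<^sub>R b) + G x = t k * (t k * ?Dab y)"
      by (rule second_difference_mean_value[where a = a and b = b, OF C1_on_subset[OF G r(2)] C1_on_subset[OF Ga r(2)] t(1)[of k]])
         (use t(2)[of k] in \<open>auto simp: N_def\<close>)
    obtain z where z: "dist z x \<le> t k * (norm b + norm a)"
      "G (x + t k *\<^sub>R b + t k *\<^sub>R a) - G (x + t k *\<^sub>R b) - G (x + t k *\<^sub>R a) + G x = t k * (t k * ?Dba z)"
      by (rule second_difference_mean_value[where a = b and b = a, OF C1_on_subset[OF G r(2)] C1_on_subset[OF Gb r(2)] t(1)[of k]])
         (use t(2)[of k] in \<open>auto simp: N_def add.commute\<close>)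
    have sw: "x + t k *\<^sub>R b + t k *\<^sub>R a = x + t k *\<^sub>R a + t k *\<^sub>R b" by (simp add: add_ac)
    have "t k * (t k * ?Dab y) = t k * (t k * ?Dba z)"
      using y(2) z(2) arg_cong[OF sw, of G] by linarith
    then have "?Dab y = ?Dba z" using t(1)[of k] by simp
    then show ?thesis using y(1) z(1) by (auto simp: N_def add.commute)
  qed
  then obtain y z where yz: "\<And>k. dist (y k) x \<le> t k * N" "\<And>k. dist (z k) x \<le> t k * N"
      "\<And>k. ?Dab (y k) = ?Dba (z k)" by metis
  have lim: "y \<longlonglongrightarrow> x" "z \<longlonglongrightarrow> x"
    by (rule metric_tendsto_imp_tendsto[OF tl], simp add: yz(1,2) N less_imp_le[OF t(1)])+
  have "isCont ?Dab x" "isCont ?Dba x"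
    using C1_on_continuous_derivative[OF Ga, of b] C1_on_continuous_derivative[OF Gb, of a] S
    by (auto simp: continuous_on_eq_continuous_at)
  then have "(\<lambda>k. ?Dab (y k)) \<longlonglongrightarrow> ?Dab x" "(\<lambda>k. ?Dba (z k)) \<longlonglongrightarrow> ?Dba x"
    using lim isCont_tendsto_compose by blast+
  then show ?thesis using yz(3) LIMSEQ_unique by force
qed

lemma second_derivative_symmetric:
  fixes F :: "'a::real_normed_vector \<Rightarrow> 'e::euclidean_space"
  assumes S: "open S" "x \<in> S" and F: "C1_on S F" "\<And>a. C1_on S (\<lambda>y. fderiv F y a)"
  shows "fderiv (\<lambda>y. fderiv F y a) x b
       = fderiv (\<lambda>y. fderiv F y b) x a"
proof (rule euclidean_eqI)
  fix c :: 'e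
  have comp: "fderiv (\<lambda>y. H y \<bullet> c) y v = fderiv H y v \<bullet> c"
    if "C1_on S H" "y \<in> S" for H v y
    using frechet_derivative_at[OF has_derivative_inner_left[OF C1_on_has_derivative[OF that]], of c]
    by metis
  have C: "C1_on S (\<lambda>y. H y \<bullet> c)" if "C1_on S H" for H :: "'a \<Rightarrow> 'e"
    by (rule C1_on_inner[OF that C1_on_const])
  have Ca: "C1_on S (\<lambda>y. fderiv (\<lambda>y. F y \<bullet> c) y a)" for a
    by (rule Ck_on_cong_open[OF S(1) _ C[OF F(2)[of a]]]) (simp add: comp[OF F(1)])
  have "fderiv (\<lambda>y. fderiv F y a) x b \<bullet> c =
      fderiv (\<lambda>y. fderiv (\<lambda>y. F y \<bullet> c) y a) x b" for a b
    unfolding comp[OF F(2) S(2), symmetric]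
    by (rule arg_cong[where f = "\<lambda>D. D b"], rule frechet_derivative_eq_on_open[OF S]) (simp add: comp[OF F(1)])
  then show "fderiv (\<lambda>y. fderiv F y a) x b \<bullet> c
       = fderiv (\<lambda>y. fderiv F y b) x a \<bullet> c"
    using second_derivative_symmetric_real[OF S C[OF F(1)] Ca Ca] by simp
qed

section \<open>Charts of an immersed manifold\<close>

text \<open>The target is an arbitrary Euclidean space, so that the unit sphere with its inclusion is an
  instance as well; this computes \<open>\<omega>\<^sub>n\<close>.\<close>

locale immersed_manifold =
  fixes M :: "'a::t2_space set"
    and A :: "('n::finite, 'a) atlas"
    and f :: "'a \<Rightarrow> 'e::euclidean_space"
  assumes closed: "closed_manifold M A" and immersion: "immersion_into_sphere M A f"
begin

definition volume_density :: "(real^'n \<Rightarrow> 'a) \<Rightarrow> real^'n \<Rightarrow> real"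
  where "volume_density \<psi> u = sqrt (det (metric_matrix (f \<circ> \<psi>) u))"

abbreviation "DF \<psi> u \<equiv> fderiv (f \<circ> \<psi>) u"

lemma compact_M: "compact M"
  using closed by (simp add: closed_manifold_def)

lemma charts_cover: "x \<in> M \<Longrightarrow> \<exists>V \<psi> u. (V, \<psi>) \<in> A \<and> u \<in> V \<and> \<psi> u = x"
  using closed unfolding closed_manifold_def smooth_atlas_def by fastforce

lemma
  assumes c: "(V, \<psi>) \<in> A"
  shows chart_open: "open V"
    and chart_image_openin: "openin (top_of_set M) (\<psi> ` V)"
    and chart_homeomorphism: "\<exists>\<phi>. homeomorphism V (\<psi> ` V) \<psi> \<phi>"
  using closed c unfolding closed_manifold_def smooth_atlas_def by fast+

lemma
  assumes c: "(V, \<psi>) \<in> A"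
  shows chart_image_subset: "\<psi> ` V \<subseteq> M"
    and chart_in: "u \<in> V \<Longrightarrow> \<psi> u \<in> M"
    and chart_inj: "inj_on \<psi> V"
    and chart_continuous: "continuous_on V \<psi>"
proof -
  show "\<psi> ` V \<subseteq> M" using chart_image_openin[OF c] openin_imp_subset by blast
  then show "u \<in> V \<Longrightarrow> \<psi> u \<in> M" by blast
  show "inj_on \<psi> V" using chart_homeomorphism[OF c] by (metis homeomorphism_def inj_on_inverseI)
  show "continuous_on V \<psi>" using chart_homeomorphism[OF c] by (auto simp: homeomorphism_def)
qed

lemma chart_open_map:
  assumes c: "(V, \<psi>) \<in> A" and "open U" "U \<subseteq> V"
  shows "openin (top_of_set M) (\<psi> ` U)"
proof -
  obtain \<phi> where "homeomorphism V (\<psi> ` V) \<psi> \<phi>" using chart_homeomorphism[OF c] by blast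
  then have "openin (top_of_set (\<psi> ` V)) (\<psi> ` U)"
    by (rule homeomorphism_imp_open_map) (use assms in \<open>auto intro: open_subset\<close>)
  then show ?thesis using chart_image_openin[OF c] by (rule openin_trans)
qed

lemma chart_vimage_open:
  assumes c: "(V, \<psi>) \<in> A" and "openin (top_of_set M) U"
  shows "open (V \<inter> \<psi> -` U)"
proof -
  obtain T where T: "open T" "U = M \<inter> T" using assms(2) by (auto simp: openin_open)
  have "open (V \<inter> \<psi> -` T)"
    by (rule continuous_open_preimage[OF chart_continuous[OF c] chart_open[OF c] T(1)])
  moreover have "V \<inter> \<psi> -` U = V \<inter> \<psi> -` T" using T chart_in[OF c] by auto
  ultimately show ?thesis by simp
qed

lemma
  assumes c: "(V, \<psi>) \<in> A"
  shows chart_C1: "C1_on V (f \<circ> \<psi>)"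
    and chart_C2: "C1_on V (\<lambda>u. DF \<psi> u v)"
    and chart_DF_inj: "u \<in> V \<Longrightarrow> inj (DF \<psi> u)"
proof -
  have "Ck_on (Suc 0) V (f \<circ> \<psi>)" "Ck_on (Suc (Suc 0)) V (f \<circ> \<psi>)"
    using immersion c unfolding immersion_into_sphere_def smooth_on_def by blast+
  then show "C1_on V (f \<circ> \<psi>)" "C1_on V (\<lambda>u. DF \<psi> u v)" by (metis Ck_on.simps(2))+
  show "u \<in> V \<Longrightarrow> inj (DF \<psi> u)"
    using immersion c unfolding immersion_into_sphere_def by blast
qed

lemma chart_DF_linear: "(V, \<psi>) \<in> A \<Longrightarrow> u \<in> V \<Longrightarrow> linear (DF \<psi> u)"
  by (rule C1_on_linear[OF chart_C1])

lemma continuous_on_M: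
  fixes h :: "'a \<Rightarrow> 'b::topological_space"
  assumes h: "\<And>V \<psi>. (V, \<psi>) \<in> A \<Longrightarrow> continuous_on V (h \<circ> \<psi>)"
  shows "continuous_on M h"
proof -
  have "\<exists>T. open T \<and> x \<in> T \<and> continuous_on (M \<inter> T) h" if x: "x \<in> M" for x
  proof -
    obtain V \<psi> u where c: "(V, \<psi>) \<in> A" "u \<in> V" "\<psi> u = x" using charts_cover[OF x] by blast
    obtain \<phi> where \<phi>: "homeomorphism V (\<psi> ` V) \<psi> \<phi>" using chart_homeomorphism[OF c(1)] by blast
    have "continuous_on (\<psi> ` V) (\<lambda>y. (h \<circ> \<psi>) (\<phi> y))"
      by (rule continuous_on_compose2[OF h[OF c(1)]]) (use \<phi> in \<open>auto simp: homeomorphism_def\<close>)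
    then have "continuous_on (\<psi> ` V) h"
      by (rule continuous_on_eq) (use \<phi> in \<open>auto simp: homeomorphism_def\<close>)
    moreover obtain T where "open T" "\<psi> ` V = M \<inter> T"
      using chart_image_openin[OF c(1)] by (auto simp: openin_open)
    ultimately show ?thesis using c by (intro exI[of _ T]) auto
  qed
  then have "continuous (at x within M) h" if "x \<in> M" for x
    using that at_within_nhd[of x _ M "M \<inter> _"] unfolding continuous_on_eq_continuous_within
    by (metis Int_absorb Int_assoc Int_iff inf_commute)
  then show ?thesis by (simp add: continuous_on_eq_continuous_within)
qed

lemma f_continuous: "continuous_on M f"
  by (rule continuous_on_M) (rule C1_on_continuous[OF chart_C1])

lemma metric_matrix_C1:
  assumes c: "(V, \<psi>) \<in> A"
  shows "C1_on V (\<lambda>u. metric_matrix (f \<circ> \<psi>) u $ i $ j)"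
  unfolding metric_matrix_gram gram_def
  by (simp del: Ck_on.simps, intro C1_on_inner chart_C2[OF c])

lemma det_metric_pos:
  assumes c: "(V, \<psi>) \<in> A" "u \<in> V"
  shows "det (metric_matrix (f \<circ> \<psi>) u) > 0"
  unfolding metric_matrix_gram
  by (intro det_gram_pos chart_DF_linear[OF c] chart_DF_inj[OF c])

lemma volume_density_pos: "(V, \<psi>) \<in> A \<Longrightarrow> u \<in> V \<Longrightarrow> volume_density \<psi> u > 0"
  using det_metric_pos by (simp add: volume_density_def)

lemma volume_density_C1: "(V, \<psi>) \<in> A \<Longrightarrow> C1_on V (volume_density \<psi>)"
  unfolding volume_density_def[abs_def]
  by (intro C1_on_sqrt C1_on_det metric_matrix_C1 det_metric_pos)

text \<open>The transition map \<open>\<tau>\<close> from \<open>\<psi>\<close> to \<open>\<psi>'\<close>.  The chain rule for \<open>f \<circ> \<psi> = (f \<circ> \<psi>') \<circ> \<tau>\<close> gives the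
  transformation of the Gram matrix, and with it that of the volume density.\<close>

lemma transition:
  assumes c: "(V, \<psi>) \<in> A" "(V', \<psi>') \<in> A"
  defines "W \<equiv> V \<inter> \<psi> -` (\<psi>' ` V')" and "\<tau> \<equiv> inv_into V' \<psi>' \<circ> \<psi>"
  shows "open W" "C1_on W \<tau>" "inj_on \<tau> W" "\<And>u. u \<in> W \<Longrightarrow> \<tau> u \<in> V'" "\<And>u. u \<in> W \<Longrightarrow> \<psi>' (\<tau> u) = \<psi> u"
    "\<And>u. u \<in> W \<Longrightarrow> DF \<psi> u = DF \<psi>' (\<tau> u) \<circ> fderiv \<tau> u"
    "\<And>u. u \<in> W \<Longrightarrow> volume_density \<psi> u =
        \<bar>det (matrix (fderiv \<tau> u))\<bar> * volume_density \<psi>' (\<tau> u)"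
proof -
  show op: "open W" unfolding W_def by (rule chart_vimage_open[OF c(1) chart_image_openin[OF c(2)]])
  have "smooth_on W \<tau>"
    using closed c unfolding closed_manifold_def smooth_atlas_def W_def \<tau>_def by fast
  then show C1: "C1_on W \<tau>" unfolding smooth_on_def by blast
  show in': "\<tau> u \<in> V'" and eq: "\<psi>' (\<tau> u) = \<psi> u" if "u \<in> W" for u
    using that by (auto simp: W_def \<tau>_def inv_into_into f_inv_into_f)
  show "inj_on \<tau> W"
    using chart_inj[OF c(1)] eq unfolding inj_on_def W_def by (metis IntD1)
  show D: "DF \<psi> u = DF \<psi>' (\<tau> u) \<circ> fderiv \<tau> u" if u: "u \<in> W" for u
  proof -
    have "((\<lambda>u. (f \<circ> \<psi>') (\<tau> u)) has_derivative (\<lambda>v. DF \<psi>' (\<tau> u) (fderiv \<tau> u v))) (at u)"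
      by (rule has_derivative_compose[OF C1_on_has_derivative[OF C1 u] C1_on_has_derivative[OF chart_C1[OF c(2)] in'[OF u]]])
    then have "fderiv (\<lambda>u. (f \<circ> \<psi>') (\<tau> u)) u = DF \<psi>' (\<tau> u) \<circ> fderiv \<tau> u"
      by (simp add: frechet_derivative_at[symmetric] o_def)
    moreover have "DF \<psi> u = fderiv (\<lambda>u. (f \<circ> \<psi>') (\<tau> u)) u"
      by (rule frechet_derivative_eq_on_open[OF op u]) (simp add: eq)
    ultimately show ?thesis by simp
  qed
  show "volume_density \<psi> u = \<bar>det (matrix (fderiv \<tau> u))\<bar> * volume_density \<psi>' (\<tau> u)"
    if u: "u \<in> W" for u
    unfolding volume_density_def metric_matrix_gram D[OF u]
    by (rule sqrt_det_gram_compose[OF chart_DF_linear[OF c(2) in'[OF u]] C1_on_linear[OF C1 u]])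
qed

section \<open>The volume measure\<close>

abbreviation "borel_M \<equiv> restrict_space borel M"

lemma space_borel_M [simp]: "space borel_M = M"
  by (simp add: space_restrict_space)

lemma openin_sets: "openin (top_of_set M) U \<Longrightarrow> U \<in> sets borel_M"
proof -
  assume "openin (top_of_set M) U"
  then obtain T where "open T" "U = M \<inter> T" by (auto simp: openin_open)
  then show "U \<in> sets borel_M" unfolding sets_restrict_space by (intro image_eqI[of _ _ T]) simp_all
qed

lemma chart_measurable:
  assumes c: "(V, \<psi>) \<in> A"
  shows "\<psi> \<in> restrict_space borel V \<rightarrow>\<^sub>M borel_M"
proof (rule measurable_restrict_space2)
  show "\<psi> \<in> space (restrict_space borel V) \<rightarrow> M" using chart_in[OF c] by (auto simp: space_restrict_space)
  show "\<psi> \<in> restrict_space borel V \<rightarrow>\<^sub>M borel"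
    by (rule borel_measurable_continuous_on_restrict[OF chart_continuous[OF c]])
qed

lemma chart_vimage_sets:
  assumes c: "(V, \<psi>) \<in> A" and "E \<in> sets borel_M"
  shows "V \<inter> \<psi> -` E \<in> sets borel"
proof -
  have V: "V \<inter> space borel \<in> sets borel" using chart_open[OF c] by simp
  have "\<psi> -` E \<inter> V \<in> sets (restrict_space borel V)"
    using measurable_sets[OF chart_measurable[OF c] assms(2)] by (simp add: space_restrict_space)
  then show ?thesis unfolding sets_restrict_space_iff[OF V] by (simp add: Int_commute)
qed

lemma volume_density_measurable:
  assumes c: "(V, \<psi>) \<in> A" and S: "S \<in> sets borel" "S \<subseteq> V"
  shows "(\<lambda>u. ennreal (volume_density \<psi> u) * indicator S u) \<in> borel_measurable borel"
proof -
  have "continuous_on S (volume_density \<psi>)"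
    using C1_on_continuous[OF volume_density_C1[OF c]] S(2) continuous_on_subset by blast
  then have "(\<lambda>u. indicator S u *\<^sub>R volume_density \<psi> u) \<in> borel_measurable borel"
    by (rule borel_measurable_continuous_on_indicator[OF S(1)])
  then have "(\<lambda>u. ennreal (indicator S u *\<^sub>R volume_density \<psi> u)) \<in> borel_measurable borel" by simp
  moreover have "(\<lambda>u. ennreal (indicator S u *\<^sub>R volume_density \<psi> u)) = (\<lambda>u. ennreal (volume_density \<psi> u) * indicator S u)"
    by (auto simp: indicator_def)
  ultimately show ?thesis by simp
qed

definition chart_volume :: "(real^'n) set \<Rightarrow> (real^'n \<Rightarrow> 'a) \<Rightarrow> 'a set \<Rightarrow> ennreal"
  where "chart_volume V \<psi> E = (\<integral>\<^sup>+u\<in>V \<inter> \<psi> -` E. ennreal (volume_density \<psi> u) \<partial>lborel)"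

text \<open>The Jacobian of the transition map is the quotient of the two volume densities, so the change
  of variables formula identifies the two integrals.\<close>

lemma chart_volume_unique:
  assumes c: "(V, \<psi>) \<in> A" "(V', \<psi>') \<in> A"
    and E: "E \<in> sets borel_M" "E \<subseteq> \<psi> ` V" "E \<subseteq> \<psi>' ` V'"
  shows "chart_volume V \<psi> E = chart_volume V' \<psi>' E"
proof -
  define \<tau> where "\<tau> = inv_into V' \<psi>' \<circ> \<psi>"
  define S where "S = V \<inter> \<psi> -` E"
  define S' where "S' = V' \<inter> \<psi>' -` E"
  note T = transition[OF c, folded \<tau>_def]
  have SW: "S \<subseteq> V \<inter> \<psi> -` (\<psi>' ` V')" using E by (auto simp: S_def)
  have meas: "S \<in> sets borel" "S' \<in> sets borel"
    unfolding S_def S'_def using chart_vimage_sets c E(1) by blast+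
  have im: "\<tau> ` S = S'"
  proof
    show "\<tau> ` S \<subseteq> S'" using T(4,5) SW by (auto simp: S_def S'_def)
    show "S' \<subseteq> \<tau> ` S"
    proof
      fix y assume y: "y \<in> S'"
      then obtain u where u: "u \<in> V" "\<psi> u = \<psi>' y" using E by (force simp: S'_def)
      then have "u \<in> S" using y by (simp add: S_def S'_def)
      moreover have "\<tau> u = y"
        using u y chart_inj[OF c(2)] by (simp add: \<tau>_def S'_def inv_into_f_f)
      ultimately show "y \<in> \<tau> ` S" by blast
    qed
  qed
  let ?d = "\<lambda>u. det (matrix (fderiv \<tau> u))"
  let ?h = "\<lambda>y. ennreal (volume_density \<psi>' y) * indicator S' y"
  have "chart_volume V' \<psi>' E = (\<integral>\<^sup>+y\<in>\<tau> ` S. ?h y \<partial>lborel)"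
    unfolding chart_volume_def im by (intro nn_integral_cong) (auto simp: S'_def indicator_def)
  also have "\<dots> = (\<integral>\<^sup>+u\<in>S. ?h (\<tau> u) * ennreal \<bar>?d u\<bar> \<partial>lborel)"
  proof (rule nn_integral_change_of_variables)
    show "inj_on \<tau> S" using T(3) SW by (rule inj_on_subset)
    show "(\<tau> has_derivative fderiv \<tau> u) (at u within S)" if "u \<in> S" for u
      using C1_on_has_derivative[OF T(2), of u] that SW has_derivative_at_withinI by blast
    show "?h \<in> borel_measurable borel"
      by (rule volume_density_measurable[OF c(2) meas(2)]) (auto simp: S'_def)
    have "continuous_on S (\<lambda>u. fderiv \<tau> u (axis j 1) $ i)" for i j
      using continuous_on_subset[OF C1_on_continuous_derivative[OF T(2)] SW]
      by (intro continuous_on_component)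
    then show "continuous_on S ?d"
      unfolding det_def matrix_def
      by (simp, intro continuous_on_sum continuous_on_mult continuous_on_const continuous_on_prod) blast
  qed (use meas im in auto)
  also have "\<dots> = chart_volume V \<psi> E"
    unfolding chart_volume_def S_def[symmetric]
  proof (intro nn_integral_cong)
    fix u
    show "?h (\<tau> u) * ennreal \<bar>?d u\<bar> * indicator S u = ennreal (volume_density \<psi> u) * indicator S u"
    proof (cases "u \<in> S")
      case True
      then have W: "u \<in> V \<inter> \<psi> -` (\<psi>' ` V')" and "\<tau> u \<in> S'" using SW im by auto
      then show ?thesis using volume_density_pos[OF c(2) T(4)[OF W]] T(7)[OF W]
        by (simp add: ennreal_mult'' mult.commute)
    qed simp
  qed
  finally show ?thesis by simp
qed

text \<open>Finitely many balls whose closures stay inside the chart domains: on these closures the volume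
  densities are bounded, and they carry the bump functions of a partition of unity.\<close>

lemma finite_ball_cover:
  obtains N :: nat and V \<psi> and a :: "nat \<Rightarrow> real^'n" and r
  where "\<And>i. i < N \<Longrightarrow> (V i, \<psi> i) \<in> A" "\<And>i. i < N \<Longrightarrow> r i > 0"
    "\<And>i. i < N \<Longrightarrow> cball (a i) (r i) \<subseteq> V i" "M = (\<Union>i<N. \<psi> i ` ball (a i) (r i))"
proof -
  define C where "C = {\<psi> ` ball u r | V \<psi> u r. (V, \<psi>) \<in> A \<and> r > 0 \<and> cball u r \<subseteq> V}"
  have op: "\<forall>c\<in>C. openin (top_of_set M) c"
    unfolding C_def using chart_open_map ball_subset_cball by (auto intro!: chart_open_map)
  moreover have "M \<subseteq> \<Union>C"
  proof
    fix x assume "x \<in> M"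
    then obtain V \<psi> u where c: "(V, \<psi>) \<in> A" "u \<in> V" "\<psi> u = x" using charts_cover by blast
    then obtain r where "r > 0" "cball u r \<subseteq> V" using chart_open open_contains_cball by metis
    then have "\<psi> ` ball u r \<in> C" "x \<in> \<psi> ` ball u r" using c by (auto simp: C_def)
    then show "x \<in> \<Union>C" by blast
  qed
  ultimately obtain D where D: "D \<subseteq> C" "finite D" "M \<subseteq> \<Union>D"
    using compact_M unfolding compact_eq_openin_cover by metis
  obtain N :: nat and g where g: "D = g ` {i. i < N}" using D(2) finite_conv_nat_seg_image by metis
  have "\<exists>V \<psi> u r. g i = \<psi> ` ball u r \<and> (V, \<psi>) \<in> A \<and> r > 0 \<and> cball u r \<subseteq> V" if "i < N" for i
    using g D(1) that unfolding C_def by blast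
  then obtain V \<psi> u r where *: "\<And>i. i < N \<Longrightarrow> g i = \<psi> i ` ball (u i) (r i) \<and> (V i, \<psi> i) \<in> A \<and> r i > 0 \<and> cball (u i) (r i) \<subseteq> V i"
    by metis
  have "\<Union>D \<subseteq> M" using D(1) op openin_imp_subset by blast
  then have "M = (\<Union>i<N. g i)" using D(3) g by auto
  then have "M = (\<Union>i<N. \<psi> i ` ball (u i) (r i))" using * by auto
  then show ?thesis using * that by blast
qed

text \<open>Disjoint Borel pieces, each inside one chart domain; they reduce measures on \<open>M\<close> to charts.\<close>

lemma finite_chart_partition:
  obtains N :: nat and V \<psi> D
  where "\<And>i. i < N \<Longrightarrow> (V i, \<psi> i) \<in> A" "\<And>i. i < N \<Longrightarrow> D i \<in> sets borel_M"
    "\<And>i. i < N \<Longrightarrow> D i \<subseteq> \<psi> i ` V i" "disjoint_family_on D {..<N}" "M = (\<Union>i<N. D i)"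
proof -
  obtain N :: nat and V \<psi> and a :: "nat \<Rightarrow> real^'n" and r
    where C: "\<And>i. i < N \<Longrightarrow> (V i, \<psi> i) \<in> A" "\<And>i. i < N \<Longrightarrow> r i > 0"
      "\<And>i. i < N \<Longrightarrow> cball (a i) (r i) \<subseteq> V i"
      "M = (\<Union>i<N. \<psi> i ` ball (a i) (r i))" by (rule finite_ball_cover) (rule that)
  define B where "B i = \<psi> i ` ball (a i) (r i)" for i
  have B: "B i \<in> sets borel_M" "B i \<subseteq> \<psi> i ` V i" if "i < N" for i
  proof -
    have sub: "ball (a i) (r i) \<subseteq> V i" using C(3)[OF that] ball_subset_cball by blast
    then show "B i \<in> sets borel_M" "B i \<subseteq> \<psi> i ` V i"
      unfolding B_def by (auto intro!: openin_sets chart_open_map[OF C(1)[OF that]])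
  qed
  define D where "D i = B i - (\<Union>j<i. B j)" for i
  show ?thesis
  proof
    show "(V i, \<psi> i) \<in> A" if "i < N" for i using C that by blast
    show "D i \<in> sets borel_M" if "i < N" for i
      unfolding D_def using B that by (intro sets.Diff sets.finite_UN) auto
    show "D i \<subseteq> \<psi> i ` V i" if "i < N" for i using B[OF that] by (auto simp: D_def)
    show "disjoint_family_on D {..<N}"
      unfolding disjoint_family_on_def D_def by (metis (no_types, lifting) Diff_disjoint Diff_iff Int_emptyI UN_I lessThan_iff linorder_neqE_nat)
    have "(\<Union>i<N. D i) = (\<Union>i<N. B i)"
    proof (intro equalityI subsetI)
      fix x assume "x \<in> (\<Union>i<N. B i)"
      then obtain i where "i < N" "x \<in> B i" by blast
      then have "(LEAST i. x \<in> B i) < N" "x \<in> D (LEAST i. x \<in> B i)"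
        unfolding D_def by (auto intro: LeastI dest: not_less_Least Least_le[of "\<lambda>i. x \<in> B i"] le_less_trans)
      then show "x \<in> (\<Union>i<N. D i)" by blast
    qed (auto simp: D_def)
    then show "M = (\<Union>i<N. D i)" using C(4) by (simp add: B_def)
  qed
qed

definition is_volume :: "'a measure \<Rightarrow> bool"
  where "is_volume \<mu> \<longleftrightarrow> sets \<mu> = sets borel_M \<and>
    (\<forall>(V, \<psi>)\<in>A. \<forall>B\<in>sets \<mu>. B \<subseteq> \<psi> ` V \<longrightarrow> emeasure \<mu> B = chart_volume V \<psi> B)"

text \<open>A Borel set is the disjoint union of its parts in the pieces of a chart partition, and on each
  part the measure is prescribed.\<close>

lemma is_volume_unique:
  assumes "is_volume \<mu>" "is_volume \<nu>" shows "\<mu> = \<nu>"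
proof (rule measure_eqI)
  show st: "sets \<mu> = sets \<nu>" using assms by (simp add: is_volume_def)
  obtain N :: nat and V \<psi> D
    where C: "\<And>i. i < N \<Longrightarrow> (V i, \<psi> i) \<in> A" "\<And>i. i < N \<Longrightarrow> D i \<in> sets borel_M"
    "\<And>i. i < N \<Longrightarrow> D i \<subseteq> \<psi> i ` V i" "disjoint_family_on D {..<N}" "M = (\<Union>i<N. D i)"
    by (rule finite_chart_partition) (rule that)
  fix E assume E: "E \<in> sets \<mu>"
  have EM: "E \<subseteq> M" using E assms(1) sets.sets_into_space[of E borel_M] by (simp add: is_volume_def)
  have EU: "E = (\<Union>i<N. E \<inter> D i)" using EM C(5) by blast
  have "emeasure \<rho> E = (\<Sum>i<N. chart_volume (V i) (\<psi> i) (E \<inter> D i))" if r: "is_volume \<rho>" for \<rho>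
  proof -
    have s: "sets \<rho> = sets borel_M" using r by (simp add: is_volume_def)
    have ED: "E \<inter> D i \<in> sets \<rho>" if "i < N" for i
      using E C(2)[OF that] s assms(1) unfolding is_volume_def by (metis sets.Int)
    have "emeasure \<rho> E = emeasure \<rho> (\<Union>i\<in>{..<N}. E \<inter> D i)" using EU by simp
    also have "\<dots> = (\<Sum>i<N. emeasure \<rho> (E \<inter> D i))"
      by (rule sum_emeasure[symmetric]) (use ED C(4) in \<open>auto simp: disjoint_family_on_def\<close>)
    also have "\<dots> = (\<Sum>i<N. chart_volume (V i) (\<psi> i) (E \<inter> D i))"
      using r ED C(1,3) unfolding is_volume_def by (intro sum.cong) fastforce+
    finally show ?thesis .
  qed
  then show "emeasure \<mu> E = emeasure \<nu> E" using assms by simp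
qed

lemma chart_volume_sum:
  assumes c: "(V, \<psi>) \<in> A" and E: "\<And>i. i \<in> I \<Longrightarrow> E i \<in> sets borel_M" "disjoint_family_on E I" "finite I"
  shows "chart_volume V \<psi> (\<Union>i\<in>I. E i) = (\<Sum>i\<in>I. chart_volume V \<psi> (E i))"
proof -
  have "(\<Sum>i\<in>I. chart_volume V \<psi> (E i)) =
      (\<integral>\<^sup>+u. (\<Sum>i\<in>I. ennreal (volume_density \<psi> u) * indicator (V \<inter> \<psi> -` E i) u) \<partial>lborel)"
    unfolding chart_volume_def
    by (rule nn_integral_sum[symmetric])
       (use volume_density_measurable[OF c] chart_vimage_sets[OF c] E(1) in auto)
  also have "\<dots> = chart_volume V \<psi> (\<Union>i\<in>I. E i)"
    unfolding chart_volume_def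
  proof (intro nn_integral_cong)
    fix u
    have "disjoint_family_on (\<lambda>i. V \<inter> \<psi> -` E i) I" using E(2) by (auto simp: disjoint_family_on_def)
    then have "(\<Sum>i\<in>I. indicator (V \<inter> \<psi> -` E i) u) = (indicator (\<Union>i\<in>I. V \<inter> \<psi> -` E i) u :: ennreal)"
      by (rule indicator_UN_disjoint[OF E(3), symmetric])
    moreover have "(\<Union>i\<in>I. V \<inter> \<psi> -` E i) = V \<inter> \<psi> -` (\<Union>i\<in>I. E i)" by blast
    ultimately show "(\<Sum>i\<in>I. ennreal (volume_density \<psi> u) * indicator (V \<inter> \<psi> -` E i) u) =
        ennreal (volume_density \<psi> u) * indicator (V \<inter> \<psi> -` (\<Union>i\<in>I. E i)) u"
      by (simp only: sum_distrib_left[symmetric])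
  qed
  finally show ?thesis by simp
qed

definition chart_measure :: "(real^'n) set \<Rightarrow> (real^'n \<Rightarrow> 'a) \<Rightarrow> 'a measure"
  where "chart_measure V \<psi> = distr (density (restrict_space lborel V) (\<lambda>u. ennreal (volume_density \<psi> u))) borel_M \<psi>"

lemma chart_density_measurable:
  "(V, \<psi>) \<in> A \<Longrightarrow> (\<lambda>u. ennreal (volume_density \<psi> u)) \<in> borel_measurable (restrict_space lborel V)"
  using borel_measurable_continuous_on_restrict[OF C1_on_continuous[OF volume_density_C1]]
  by (simp cong: measurable_cong_sets add: measurable_restrict_space1 sets_restrict_space)

lemma chart_measurable_density:
  "(V, \<psi>) \<in> A \<Longrightarrow> \<psi> \<in> density (restrict_space lborel V) (\<lambda>u. ennreal (volume_density \<psi> u)) \<rightarrow>\<^sub>M borel_M"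
  using chart_measurable by (simp add: measurable_def space_restrict_space sets_restrict_space)

lemma emeasure_chart_measure:
  assumes c: "(V, \<psi>) \<in> A" and E: "E \<in> sets borel_M"
  shows "emeasure (chart_measure V \<psi>) E = chart_volume V \<psi> E"
proof -
  have S: "V \<inter> \<psi> -` E \<in> sets borel" by (rule chart_vimage_sets[OF c E])
  have "emeasure (chart_measure V \<psi>) E =
     emeasure (density (restrict_space lborel V) (\<lambda>u. ennreal (volume_density \<psi> u))) (V \<inter> \<psi> -` E)"
    unfolding chart_measure_def
    by (subst emeasure_distr[OF chart_measurable_density[OF c] E]) (simp add: space_restrict_space Int_commute)
  also have "\<dots> = (\<integral>\<^sup>+u. ennreal (volume_density \<psi> u) * indicator (V \<inter> \<psi> -` E) u \<partial>restrict_space lborel V)"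
    by (rule emeasure_density[OF chart_density_measurable[OF c]])
       (use S chart_open[OF c] in \<open>simp add: sets_restrict_space_iff\<close>)
  also have "\<dots> = chart_volume V \<psi> E"
    unfolding chart_volume_def
    by (subst nn_integral_restrict_space) (use chart_open[OF c] in \<open>auto intro!: nn_integral_cong simp: indicator_def\<close>)
  finally show ?thesis .
qed

text \<open>The sum of the chart measures, each restricted to its piece of a finite chart partition.\<close>

lemma is_volume_exists: "\<exists>\<mu>. is_volume \<mu>"
proof -
  obtain N :: nat and V \<psi> D
    where C: "\<And>i. i < N \<Longrightarrow> (V i, \<psi> i) \<in> A" "\<And>i. i < N \<Longrightarrow> D i \<in> sets borel_M"
    "\<And>i. i < N \<Longrightarrow> D i \<subseteq> \<psi> i ` V i" "disjoint_family_on D {..<N}" "M = (\<Union>i<N. D i)"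
    by (rule finite_chart_partition) (rule that)
  define m where "m E = (\<Sum>i<N. emeasure (chart_measure (V i) (\<psi> i)) (E \<inter> D i))" for E
  define \<mu> where "\<mu> = measure_of M (sets borel_M) m"
  have sc: "sets (chart_measure (V i) (\<psi> i)) = sets borel_M" for i by (simp add: chart_measure_def)
  have sets: "sets \<mu> = sets borel_M"
    unfolding \<mu>_def by (metis sets.sigma_sets_eq sets.space_closed sets_measure_of space_borel_M)
  have em: "emeasure \<mu> E = m E" if "E \<in> sets borel_M" for E
    unfolding \<mu>_def
  proof (rule emeasure_measure_of_sigma)
    show "sigma_algebra M (sets borel_M)" using sets.sigma_algebra_axioms[of borel_M] by simp
    show "positive (sets borel_M) m" by (simp add: positive_def m_def)
    show "countably_additive (sets borel_M) m"
    proof (rule countably_additiveI)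
      fix F :: "nat \<Rightarrow> 'a set"
      assume F: "range F \<subseteq> sets borel_M" "disjoint_family F"
      have FD: "(\<Sum>n. emeasure (chart_measure (V i) (\<psi> i)) (F n \<inter> D i)) =
          emeasure (chart_measure (V i) (\<psi> i)) ((\<Union>n. F n) \<inter> D i)" if "i < N" for i
      proof -
        have "(\<Union>n. F n) \<inter> D i = (\<Union>n. F n \<inter> D i)" by blast
        moreover have "range (\<lambda>n. F n \<inter> D i) \<subseteq> sets (chart_measure (V i) (\<psi> i))"
          unfolding sc using F(1) C(2)[OF that] by auto
        moreover have "disjoint_family (\<lambda>n. F n \<inter> D i)" using F(2) by (auto simp: disjoint_family_on_def)
        ultimately show ?thesis using suminf_emeasure by metis
      qed
      have "(\<Sum>n. m (F n)) = (\<Sum>i<N. \<Sum>n. emeasure (chart_measure (V i) (\<psi> i)) (F n \<inter> D i))"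
        unfolding m_def by (rule suminf_sum) simp
      also have "\<dots> = m (\<Union>n. F n)" unfolding m_def by (intro sum.cong refl FD) simp
      finally show "(\<Sum>n. m (F n)) = m (\<Union>n. F n)" .
    qed
  qed (rule that)
  have "emeasure \<mu> B = chart_volume V' \<psi>' B"
    if c: "(V', \<psi>') \<in> A" and B: "B \<in> sets borel_M" "B \<subseteq> \<psi>' ` V'" for V' \<psi>' B
  proof -
    have BD: "B \<inter> D i \<in> sets borel_M" if "i < N" for i using B C(2)[OF that] by auto
    have "emeasure \<mu> B = (\<Sum>i<N. chart_volume (V i) (\<psi> i) (B \<inter> D i))"
      unfolding em[OF B(1)] m_def using BD C(1) by (intro sum.cong) (auto simp: emeasure_chart_measure)
    also have "\<dots> = (\<Sum>i<N. chart_volume V' \<psi>' (B \<inter> D i))"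
    proof (intro sum.cong refl)
      fix i assume "i \<in> {..<N}"
      then have i: "i < N" by simp
      show "chart_volume (V i) (\<psi> i) (B \<inter> D i) = chart_volume V' \<psi>' (B \<inter> D i)"
        by (rule chart_volume_unique[OF C(1)[OF i] c BD[OF i]]) (use C(3)[OF i] B(2) in auto)
    qed
    also have "\<dots> = chart_volume V' \<psi>' (\<Union>i\<in>{..<N}. B \<inter> D i)"
      by (rule chart_volume_sum[symmetric, OF c]) (use BD C(4) in \<open>auto simp: disjoint_family_on_def\<close>)
    also have "(\<Union>i\<in>{..<N}. B \<inter> D i) = B"
    proof -
      have "B \<subseteq> M" using sets.sets_into_space[OF B(1)] by simp
      then show ?thesis using C(5) by blast
    qed
    finally show ?thesis .
  qed
  then have "is_volume \<mu>" unfolding is_volume_def using sets by auto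
  then show ?thesis by blast
qed

abbreviation "vol \<equiv> volume_measure M A f"

lemma is_volume_vol: "is_volume vol"
proof -
  have "vol = (THE \<mu>. is_volume \<mu>)"
    unfolding volume_measure_def is_volume_def chart_volume_def volume_density_def ..
  then show ?thesis using is_volume_exists is_volume_unique by (metis the_equality)
qed

lemma sets_vol [simp]: "sets vol = sets borel_M"
  using is_volume_vol by (simp add: is_volume_def)

lemma space_vol [simp]: "space vol = M"
  using sets_eq_imp_space_eq[OF sets_vol] by simp

lemma emeasure_vol_chart:
  assumes "(V, \<psi>) \<in> A" "B \<in> sets borel_M" "B \<subseteq> \<psi> ` V"
  shows "emeasure vol B = chart_volume V \<psi> B"
  using is_volume_vol assms unfolding is_volume_def by fastforce

lemma indicator_measurable_vol: "S \<in> sets borel_M \<Longrightarrow> indicator S \<in> borel_measurable vol"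
  by (rule borel_measurable_indicator) simp

text \<open>On a chart domain the volume measure is the image of \<open>\<surd>(det g) du\<close>; integrals over \<open>M\<close> of functions
  supported there become Lebesgue integrals in the following two lemmas.\<close>

lemma density_vol_chart:
  assumes c: "(V, \<psi>) \<in> A"
  shows "density vol (indicator (\<psi> ` V)) = chart_measure V \<psi>"
proof (rule measure_eqI)
  show "sets (density vol (indicator (\<psi> ` V))) = sets (chart_measure V \<psi>)"
    by (simp add: chart_measure_def)
  have im: "\<psi> ` V \<in> sets borel_M" by (rule openin_sets[OF chart_image_openin[OF c]])
  fix E assume "E \<in> sets (density vol (indicator (\<psi> ` V)))"
  then have E: "E \<in> sets borel_M" by simp
  have "emeasure (density vol (indicator (\<psi> ` V))) E = emeasure vol (\<psi> ` V \<inter> E)"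
    using E im by (subst emeasure_density) (auto simp flip: indicator_inter_arith intro!: indicator_measurable_vol)
  also have "\<dots> = chart_volume V \<psi> (\<psi> ` V \<inter> E)"
    by (rule emeasure_vol_chart[OF c]) (use E im in auto)
  also have "V \<inter> \<psi> -` (\<psi> ` V \<inter> E) = V \<inter> \<psi> -` E" by auto
  then have "chart_volume V \<psi> (\<psi> ` V \<inter> E) = chart_volume V \<psi> E" unfolding chart_volume_def by simp
  finally show "emeasure (density vol (indicator (\<psi> ` V))) E = emeasure (chart_measure V \<psi>) E"
    by (simp add: emeasure_chart_measure[OF c E])
qed

lemma nn_integral_vol_chart:
  assumes c: "(V, \<psi>) \<in> A" and h: "h \<in> borel_measurable borel_M"
  shows "(\<integral>\<^sup>+x\<in>\<psi> ` V. h x \<partial>vol) = (\<integral>\<^sup>+u\<in>V. ennreal (volume_density \<psi> u) * h (\<psi> u) \<partial>lborel)"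
proof -
  have im: "\<psi> ` V \<in> sets vol" using openin_sets[OF chart_image_openin[OF c]] by simp
  have hv: "h \<in> borel_measurable vol" using h by (simp cong: measurable_cong_sets)
  have hc: "(\<lambda>u. h (\<psi> u)) \<in> borel_measurable (density (restrict_space lborel V) (\<lambda>u. ennreal (volume_density \<psi> u)))"
    by (rule measurable_compose[OF chart_measurable_density[OF c] h])
  have "(\<integral>\<^sup>+x\<in>\<psi> ` V. h x \<partial>vol) = (\<integral>\<^sup>+x. h x \<partial>density vol (indicator (\<psi> ` V)))"
    using im hv by (subst nn_integral_density) (auto simp: mult.commute intro!: indicator_measurable_vol)
  also have "\<dots> = (\<integral>\<^sup>+u. h (\<psi> u) \<partial>density (restrict_space lborel V) (\<lambda>u. ennreal (volume_density \<psi> u)))"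
    unfolding density_vol_chart[OF c] chart_measure_def
    by (rule nn_integral_distr[OF chart_measurable_density[OF c]]) (use h in simp)
  also have "\<dots> = (\<integral>\<^sup>+u. ennreal (volume_density \<psi> u) * h (\<psi> u) \<partial>restrict_space lborel V)"
    using hc by (intro nn_integral_density[OF chart_density_measurable[OF c]]) simp
  also have "\<dots> = (\<integral>\<^sup>+u\<in>V. ennreal (volume_density \<psi> u) * h (\<psi> u) \<partial>lborel)"
    by (rule nn_integral_restrict_space) (use chart_open[OF c] in auto)
  finally show ?thesis .
qed

lemma integral_vol_chart:
  fixes h :: "'a \<Rightarrow> real"
  assumes c: "(V, \<psi>) \<in> A" and h: "h \<in> borel_measurable borel_M" and z: "\<And>x. x \<in> M - \<psi> ` V \<Longrightarrow> h x = 0"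
  shows "(\<integral>x. h x \<partial>vol) = (\<integral>u. indicator V u * (volume_density \<psi> u * h (\<psi> u)) \<partial>lborel)"
proof -
  have im: "\<psi> ` V \<in> sets vol" using openin_sets[OF chart_image_openin[OF c]] by simp
  have hv: "h \<in> borel_measurable vol" using h by (simp cong: measurable_cong_sets)
  have hc: "(\<lambda>u. h (\<psi> u)) \<in> borel_measurable (density (restrict_space lborel V) (\<lambda>u. ennreal (volume_density \<psi> u)))"
    by (rule measurable_compose[OF chart_measurable_density[OF c] h])
  have "(\<integral>x. h x \<partial>vol) = (\<integral>x. indicator (\<psi> ` V) x *\<^sub>R h x \<partial>vol)"
    by (intro Bochner_Integration.integral_cong) (auto simp: indicator_def z)
  also have "\<dots> = (\<integral>x. h x \<partial>density vol (\<lambda>x. ennreal (indicator (\<psi> ` V) x)))"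
    using im hv by (intro integral_density[symmetric]) (auto intro!: indicator_measurable_vol)
  also have "(\<lambda>x. ennreal (indicator (\<psi> ` V) x)) = indicator (\<psi> ` V)" by (auto simp: indicator_def)
  also have "(\<integral>x. h x \<partial>density vol (indicator (\<psi> ` V))) = (\<integral>u. h (\<psi> u) \<partial>density (restrict_space lborel V) (\<lambda>u. ennreal (volume_density \<psi> u)))"
    unfolding density_vol_chart[OF c] chart_measure_def
    by (rule integral_distr[OF chart_measurable_density[OF c] h])
  also have "\<dots> = (\<integral>u. volume_density \<psi> u *\<^sub>R h (\<psi> u) \<partial>restrict_space lborel V)"
  proof (rule integral_density)
    show "(\<lambda>u. h (\<psi> u)) \<in> borel_measurable (restrict_space lborel V)" using hc by simp
    show "volume_density \<psi> \<in> borel_measurable (restrict_space lborel V)"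
      using borel_measurable_continuous_on_restrict[OF C1_on_continuous[OF volume_density_C1[OF c]]]
      by (simp add: measurable_def space_restrict_space sets_restrict_space)
    show "AE u in restrict_space lborel V. 0 \<le> volume_density \<psi> u"
      using volume_density_pos[OF c] by (intro AE_I2) (auto simp: space_restrict_space less_imp_le)
  qed
  also have "\<dots> = (\<integral>u. indicator V u *\<^sub>R (volume_density \<psi> u *\<^sub>R h (\<psi> u)) \<partial>lborel)"
    by (rule integral_restrict_space) (use chart_open[OF c] in auto)
  finally show ?thesis by simp
qed

lemma finite_vol: "emeasure vol M < \<infinity>"
proof -
  obtain N :: nat and V \<psi> and a :: "nat \<Rightarrow> real^'n" and r
    where C: "\<And>i. i < N \<Longrightarrow> (V i, \<psi> i) \<in> A" "\<And>i. i < N \<Longrightarrow> r i > 0"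
      "\<And>i. i < N \<Longrightarrow> cball (a i) (r i) \<subseteq> V i"
      "M = (\<Union>i<N. \<psi> i ` ball (a i) (r i))" by (rule finite_ball_cover) (rule that)
  have fin: "emeasure vol (\<psi> i ` ball (a i) (r i)) < \<infinity>" and st: "\<psi> i ` ball (a i) (r i) \<in> sets vol"
    if i: "i < N" for i
  proof -
    have sub: "ball (a i) (r i) \<subseteq> V i" using C(3)[OF i] ball_subset_cball by blast
    have st': "\<psi> i ` ball (a i) (r i) \<in> sets borel_M"
      by (intro openin_sets chart_open_map[OF C(1)[OF i]] sub) auto
    then show "\<psi> i ` ball (a i) (r i) \<in> sets vol" by simp
    have "compact (volume_density (\<psi> i) ` cball (a i) (r i))"
      using C1_on_continuous[OF volume_density_C1[OF C(1)[OF i]]] C(3)[OF i]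
      by (intro compact_continuous_image) (auto intro: continuous_on_subset)
    then obtain K where K: "\<And>u. u \<in> cball (a i) (r i) \<Longrightarrow> \<bar>volume_density (\<psi> i) u\<bar> \<le> K"
      using compact_imp_bounded by (force simp: bounded_iff)
    have "emeasure vol (\<psi> i ` ball (a i) (r i)) = chart_volume (V i) (\<psi> i) (\<psi> i ` ball (a i) (r i))"
      by (rule emeasure_vol_chart[OF C(1)[OF i] st']) (use sub in auto)
    also have "\<dots> \<le> (\<integral>\<^sup>+u. ennreal K * indicator (cball (a i) (r i)) u \<partial>lborel)"
      unfolding chart_volume_def
    proof (rule nn_integral_mono)
      fix u
      have "u \<in> ball (a i) (r i)" if "u \<in> V i" "\<psi> i u \<in> \<psi> i ` ball (a i) (r i)"
        using that sub chart_inj[OF C(1)[OF i]] by (meson inj_on_image_mem_iff)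
      then show "ennreal (volume_density (\<psi> i) u) * indicator (V i \<inter> \<psi> i -` \<psi> i ` ball (a i) (r i)) u
        \<le> ennreal K * indicator (cball (a i) (r i)) u"
        using K[of u] by (auto simp: indicator_def intro!: ennreal_leI)
    qed
    also have "\<dots> = ennreal K * emeasure lborel (cball (a i) (r i))"
      by (simp add: nn_integral_cmult_indicator)
    also have "\<dots> < \<infinity>" using emeasure_lborel_cball_finite[of "a i" "r i"] by (simp add: ennreal_mult_less_top)
    finally show "emeasure vol (\<psi> i ` ball (a i) (r i)) < \<infinity>" .
  qed
  have "emeasure vol M = emeasure vol (\<Union>i<N. \<psi> i ` ball (a i) (r i))" by (rule arg_cong[OF C(4)])
  also have "\<dots> \<le> (\<Sum>i<N. emeasure vol (\<psi> i ` ball (a i) (r i)))"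
    by (rule emeasure_subadditive_finite) (use st in blast)+
  also have "\<dots> < \<infinity>" using fin by (simp add: ennreal_sum_less_top)
  finally show ?thesis .
qed

sublocale vol: finite_measure vol
  by standard (use finite_vol in \<open>simp add: less_top\<close>)

end

context immersed_manifold
begin

lemma continuous_measurable: "continuous_on M h \<Longrightarrow> h \<in> borel_measurable vol"
  using borel_measurable_continuous_on_restrict[of M h] by (simp cong: measurable_cong_sets)

lemma continuous_integrable:
  fixes h :: "'a \<Rightarrow> real"
  assumes "continuous_on M h" shows "integrable vol h"
proof -
  obtain K where K: "\<And>x. x \<in> M \<Longrightarrow> \<bar>h x\<bar> \<le> K"
    using compact_imp_bounded[OF compact_continuous_image[OF assms compact_M]]
    by (force simp: bounded_iff)
  show ?thesis
    by (rule vol.integrable_const_bound[where B = K]) (use K continuous_measurable[OF assms] in auto)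
qed

section \<open>Tangent and normal spaces\<close>

lemma transition_derivative_bij:
  assumes c: "(V, \<psi>) \<in> A" "(V', \<psi>') \<in> A"
    and u: "u \<in> V \<inter> \<psi> -` (\<psi>' ` V')"
  defines "\<tau> \<equiv> inv_into V' \<psi>' \<circ> \<psi>"
  shows "bij (fderiv \<tau> u)"
proof -
  note T = transition[OF c, folded \<tau>_def]
  have lin: "linear (fderiv \<tau> u)" by (rule C1_on_linear[OF T(2) u])
  have "inj (fderiv \<tau> u)"
    using chart_DF_inj[OF c(1), of u] u unfolding T(6)[OF u] by (auto intro: inj_on_imageI2)
  then show ?thesis using linear_injective_imp_surjective[OF lin] by (simp add: bij_def)
qed

text \<open>The derivative of a transition map is bijective, so all charts around a point contribute the same
  image to the union that defines the tangent space.\<close>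

lemma tangent_space_chart:
  assumes c: "(V, \<psi>) \<in> A" "u \<in> V"
  shows "tangent_space A f (\<psi> u) = range (DF \<psi> u)"
proof -
  have ranges: "range (DF \<psi>' u') = range (DF \<psi> u)" if c': "(V', \<psi>') \<in> A" "u' \<in> V'" "\<psi>' u' = \<psi> u" for V' \<psi>' u'
  proof -
    have W: "u' \<in> V' \<inter> \<psi>' -` (\<psi> ` V)" using c c' by auto
    have tu: "(inv_into V \<psi> \<circ> \<psi>') u' = u"
      using c c' chart_inj[OF c(1)] by (simp add: inv_into_f_f)
    show ?thesis
      using bij_is_surj[OF transition_derivative_bij[OF c'(1) c(1) W]]
      unfolding transition(6)[OF c'(1) c(1) W] tu image_comp[symmetric] by simp
  qed
  have "y \<in> range (DF \<psi> u)" if y: "y \<in> tangent_space A f (\<psi> u)" for y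
  proof -
    obtain V' \<psi>' u' where "(V', \<psi>') \<in> A" "u' \<in> V'" "\<psi>' u' = \<psi> u" "y \<in> range (DF \<psi>' u')"
      using y unfolding tangent_space_def by auto
    then show ?thesis using ranges by blast
  qed
  moreover have "y \<in> tangent_space A f (\<psi> u)" if y: "y \<in> range (DF \<psi> u)" for y
    unfolding tangent_space_def using y c(2) by (intro UN_I[OF c(1)]) auto
  ultimately show ?thesis by blast
qed

lemma f_norm: "x \<in> M \<Longrightarrow> norm (f x) = 1"
  using immersion by (auto simp: immersion_into_sphere_def)

lemma f_orthogonal_tangent:
  assumes c: "(V, \<psi>) \<in> A" "u \<in> V"
  shows "f (\<psi> u) \<bullet> DF \<psi> u v = 0"
proof -
  have "((\<lambda>u. (f \<circ> \<psi>) u \<bullet> (f \<circ> \<psi>) u) has_derivative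
      (\<lambda>h. (f \<circ> \<psi>) u \<bullet> DF \<psi> u h + DF \<psi> u h \<bullet> (f \<circ> \<psi>) u)) (at u)"
    by (intro has_derivative_inner C1_on_has_derivative[OF chart_C1[OF c(1)] c(2)])
  moreover have "((\<lambda>u. (f \<circ> \<psi>) u \<bullet> (f \<circ> \<psi>) u) has_derivative (\<lambda>h. 0)) (at u)"
  proof (rule has_derivative_transform_within_open[OF _ chart_open[OF c(1)] c(2)])
    show "((\<lambda>u. 1) has_derivative (\<lambda>h. 0)) (at u)" by (rule has_derivative_const)
    show "1 = (f \<circ> \<psi>) y \<bullet> (f \<circ> \<psi>) y" if "y \<in> V" for y
      using f_norm[OF chart_in[OF c(1) that]] by (simp add: norm_eq_sqrt_inner)
  qed
  ultimately have "(\<lambda>h. (f \<circ> \<psi>) u \<bullet> DF \<psi> u h + DF \<psi> u h \<bullet> (f \<circ> \<psi>) u) = (\<lambda>h. 0)"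
    by (rule has_derivative_unique)
  from fun_cong[OF this, of v] show ?thesis by (simp add: inner_commute)
qed

lemma subspace_normal_space: "subspace (normal_space A f x)"
  unfolding normal_space_def by (rule subspace_orthogonal_comp)

lemma orthogonal_projection_eqI:
  assumes W: "subspace W" and w: "w \<in> W" "v - w \<in> orthogonal_comp W"
  shows "orthogonal_projection W v = w"
  unfolding orthogonal_projection_def
proof (rule the_equality)
  fix z assume z: "z \<in> W \<and> v - z \<in> orthogonal_comp W"
  have "z - w \<in> W" using W z w by (simp add: subspace_diff)
  moreover have "(v - w) - (v - z) \<in> orthogonal_comp W"
    using subspace_diff[OF subspace_orthogonal_comp, of "v - w" W "v - z"] z w by blast
  ultimately have "orthogonal (z - w) (z - w)" by (simp add: orthogonal_comp_def)
  then show "z = w" by (simp add: orthogonal_self)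
qed (use w in simp)

lemma inner_orthogonal_projection:
  assumes W: "subspace W" and w: "w \<in> W"
  shows "w \<bullet> orthogonal_projection W v = w \<bullet> v"
proof -
  obtain y z where yz: "y \<in> span W" "\<And>w. w \<in> span W \<Longrightarrow> orthogonal z w" "v = y + z"
    using orthogonal_subspace_decomp_exists[of W v] by blast
  have sp: "span W = W" using W by (simp add: span_eq_iff)
  have "orthogonal_projection W v = y"
    by (rule orthogonal_projection_eqI[OF W]) (use yz sp in \<open>auto simp: orthogonal_comp_def orthogonal_commute\<close>)
  then show ?thesis using yz w sp by (auto simp: inner_add_right orthogonal_def inner_commute)
qed

end

section \<open>The divergence theorem for height functions\<close>

locale minimal_immersion = immersed_manifold M A f
  for M :: "'a::t2_space set" and A :: "('n::finite, 'a) atlas" and f :: "'a \<Rightarrow> 'e::euclidean_space" +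
  fixes p :: 'e
  assumes minimal: "minimal A f" and norm_p: "norm p = 1"
begin

definition height :: "'a \<Rightarrow> real" where "height x = f x \<bullet> p"

definition normal_sq :: "'a \<Rightarrow> real" where "normal_sq x = (norm (normal_part A f x p))\<^sup>2"

text \<open>The coordinates of the gradient of the height function, written with Cramer's rule so that
  their smoothness is visible.\<close>

definition grad :: "(real^'n \<Rightarrow> 'a) \<Rightarrow> real^'n \<Rightarrow> real^'n"
  where "grad \<psi> u = (\<chi> k. det (\<chi> i j. if j = k then DF \<psi> u (axis i 1) \<bullet> p
      else metric_matrix (f \<circ> \<psi>) u $ i $ j) / det (metric_matrix (f \<circ> \<psi>) u))"

definition tangent_part :: "(real^'n \<Rightarrow> 'a) \<Rightarrow> real^'n \<Rightarrow> 'e"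
  where "tangent_part \<psi> u = DF \<psi> u (grad \<psi> u)"

lemma metric_mult_grad:
  assumes c: "(V, \<psi>) \<in> A" "u \<in> V"
  shows "metric_matrix (f \<circ> \<psi>) u *v grad \<psi> u = (\<chi> i. DF \<psi> u (axis i 1) \<bullet> p)"
  using det_metric_pos[OF c] by (subst cramer) (auto simp: grad_def cong: if_cong)

lemma inner_tangent_part:
  assumes c: "(V, \<psi>) \<in> A" "u \<in> V"
  shows "DF \<psi> u v \<bullet> tangent_part \<psi> u = DF \<psi> u v \<bullet> p"
proof -
  note lin = chart_DF_linear[OF c]
  have ax: "DF \<psi> u (axis i 1) \<bullet> tangent_part \<psi> u = DF \<psi> u (axis i 1) \<bullet> p" for i
  proof -
    have "DF \<psi> u (axis i 1) \<bullet> tangent_part \<psi> u = (metric_matrix (f \<circ> \<psi>) u *v grad \<psi> u) $ i"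
      unfolding metric_matrix_gram tangent_part_def gram_mult_vec[OF lin] ..
    then show ?thesis by (simp add: metric_mult_grad[OF c])
  qed
  show ?thesis
    unfolding linear_expand_axis[OF lin, of v] inner_sum_left inner_scaleR_left ax ..
qed

text \<open>The gradient is characterized by \<open>g(v, grad) = \<langle>df v, p\<rangle>\<close>; this makes its transformation under
  changes of charts immediate.\<close>

lemma grad_unique:
  assumes c: "(V, \<psi>) \<in> A" "u \<in> V" and w: "\<And>v. DF \<psi> u v \<bullet> DF \<psi> u w = DF \<psi> u v \<bullet> p"
  shows "w = grad \<psi> u"
proof -
  have "DF \<psi> u (w - grad \<psi> u) \<bullet> DF \<psi> u (w - grad \<psi> u) = 0"
    using w inner_tangent_part[OF c] unfolding tangent_part_def
    by (subst (2) linear_diff[OF chart_DF_linear[OF c]]) (simp add: inner_diff_right)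
  then have "DF \<psi> u (w - grad \<psi> u) = 0" by simp
  then show ?thesis
    using linear_injective_0[OF chart_DF_linear[OF c]] chart_DF_inj[OF c] by force
qed

lemma grad_transition:
  assumes c: "(V, \<psi>) \<in> A" "(V', \<psi>') \<in> A" and u: "u \<in> V \<inter> \<psi> -` (\<psi>' ` V')"
  defines "\<tau> \<equiv> inv_into V' \<psi>' \<circ> \<psi>"
  shows "grad \<psi>' (\<tau> u) = fderiv \<tau> u (grad \<psi> u)"
proof -
  note T = transition[OF c, folded \<tau>_def]
  have "DF \<psi>' (\<tau> u) v \<bullet> DF \<psi>' (\<tau> u) (fderiv \<tau> u (grad \<psi> u)) = DF \<psi>' (\<tau> u) v \<bullet> p" for v
  proof -
    obtain v' where v: "v = fderiv \<tau> u v'"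
      using transition_derivative_bij[OF c u, folded \<tau>_def] by (metis bij_pointE)
    show ?thesis
      using inner_tangent_part[OF c(1), of u v'] u unfolding v tangent_part_def T(6)[OF u] by simp
  qed
  then show ?thesis using grad_unique[OF c(2) T(4)[OF u]] by metis
qed

text \<open>The decomposition \<open>p = \<phi> f + T + p\<^sup>\<bottom>\<close>: what remains after removing the first two terms is
  orthogonal to \<open>f\<close> and to the tangent space, and what was removed is orthogonal to the normal space.\<close>

lemma normal_part_chart:
  assumes c: "(V, \<psi>) \<in> A" "u \<in> V"
  defines "w \<equiv> p - height (\<psi> u) *\<^sub>R f (\<psi> u) - tangent_part \<psi> u"
  shows "normal_part A f (\<psi> u) p = w" and "w \<in> normal_space A f (\<psi> u)"
proof -
  have ff: "f (\<psi> u) \<bullet> f (\<psi> u) = 1"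
    using f_norm[OF chart_in[OF c]] by (simp add: norm_eq_sqrt_inner)
  have "orthogonal (f (\<psi> u)) w"
    using ff f_orthogonal_tangent[OF c]
    by (simp add: w_def orthogonal_def inner_diff_right height_def tangent_part_def)
  moreover have "orthogonal (DF \<psi> u v) w" for v
    using inner_tangent_part[OF c] f_orthogonal_tangent[OF c]
    by (simp add: w_def orthogonal_def inner_diff_right inner_commute[of "DF \<psi> u v" "f (\<psi> u)"])
  ultimately show w: "w \<in> normal_space A f (\<psi> u)"
    unfolding normal_space_def tangent_space_chart[OF c] orthogonal_comp_def by auto
  have "p - w \<in> orthogonal_comp (normal_space A f (\<psi> u))"
  proof -
    have "orthogonal y (height (\<psi> u) *\<^sub>R f (\<psi> u) + tangent_part \<psi> u)" if "y \<in> normal_space A f (\<psi> u)" for y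
      using that unfolding normal_space_def tangent_space_chart[OF c] orthogonal_comp_def tangent_part_def
      by (auto simp: orthogonal_def inner_add_right inner_commute)
    then show ?thesis by (simp add: w_def orthogonal_comp_def add.commute)
  qed
  then show "normal_part A f (\<psi> u) p = w"
    unfolding normal_part_def by (intro orthogonal_projection_eqI subspace_normal_space w)
qed

text \<open>Pythagoras for \<open>p = \<phi> f + T + p\<^sup>\<bottom>\<close>, where the left side is \<open>|T|\<^sup>2\<close>.\<close>

lemma normal_sq_chart:
  assumes c: "(V, \<psi>) \<in> A" "u \<in> V"
  shows "DF \<psi> u (grad \<psi> u) \<bullet> p = 1 - (height (\<psi> u))\<^sup>2 - normal_sq (\<psi> u)"
proof -
  let ?T = "tangent_part \<psi> u" and ?F = "f (\<psi> u)"
  have "?F \<bullet> ?F = 1" "p \<bullet> p = 1"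
    using f_norm[OF chart_in[OF c]] norm_p by (simp_all add: norm_eq_sqrt_inner)
  moreover have "?F \<bullet> ?T = 0" using f_orthogonal_tangent[OF c] by (simp add: tangent_part_def)
  moreover have "?T \<bullet> ?T = ?T \<bullet> p" using inner_tangent_part[OF c] by (simp add: tangent_part_def)
  moreover have "?F \<bullet> p = height (\<psi> u)" by (simp add: height_def)
  ultimately have "normal_sq (\<psi> u) = 1 - (height (\<psi> u))\<^sup>2 - ?T \<bullet> p"
    unfolding normal_sq_def normal_part_chart(1)[OF c] power2_norm_eq_inner
    by (simp add: inner_diff_left inner_diff_right inner_commute power2_eq_square algebra_simps)
  then show ?thesis by (simp add: tangent_part_def)
qed

lemma grad_C1:
  assumes c: "(V, \<psi>) \<in> A"
  shows "C1_on V (\<lambda>u. grad \<psi> u $ k)"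
proof -
  have "C1_on V (\<lambda>u. (\<chi> i j. if j = k then DF \<psi> u (axis i 1) \<bullet> p
      else metric_matrix (f \<circ> \<psi>) u $ i $ j) $ i $ j)" for i j
    by (cases "j = k") (simp_all del: Ck_on.simps add: metric_matrix_C1[OF c] C1_on_inner[OF chart_C2[OF c] C1_on_const])
  then have "C1_on V (\<lambda>u. det (\<chi> i j. if j = k then DF \<psi> u (axis i 1) \<bullet> p
      else metric_matrix (f \<circ> \<psi>) u $ i $ j) / det (metric_matrix (f \<circ> \<psi>) u))"
    using det_metric_pos[OF c] by (intro C1_on_divide C1_on_det metric_matrix_C1[OF c]) fastforce+
  then show ?thesis by (simp add: grad_def del: Ck_on.simps)
qed

text \<open>In coordinates, \<open>\<Delta>\<phi> = - n \<phi>\<close>.  Writing the divergence of the gradient as the metric trace of the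
  derivative of the tangential part \<open>T\<close> of \<open>p\<close> avoids Christoffel symbols: it is enough to differentiate
  \<open>T \<bullet> \<partial>\<^sub>l F = p \<bullet> \<partial>\<^sub>l F\<close> and \<open>F \<bullet> \<partial>\<^sub>l F = 0\<close>, and minimality removes the normal part of the result.\<close>

lemma divergence_grad:
  assumes c: "(V, \<psi>) \<in> A" "u \<in> V"
  shows "(\<Sum>i\<in>UNIV. fderiv (\<lambda>u. volume_density \<psi> u * grad \<psi> u $ i) u (axis i 1))
    = - real CARD('n) * height (\<psi> u) * volume_density \<psi> u"
proof -
  define e where "e i = (axis i 1 :: real^'n)" for i
  define g where "g = metric_matrix (f \<circ> \<psi>)"
  define G where "G = matrix_inv (g u)"
  define F1 where "F1 i u = DF \<psi> u (e i)" for i u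
  define F2 where "F2 i j = fderiv (F1 j) u (e i)" for i j
  define DX where "DX k i = fderiv (\<lambda>u. grad \<psi> u $ i) u (e k)" for k i
  define X where "X i = grad \<psi> u $ i" for i
  let ?T = "tangent_part \<psi> u" and ?F = "f (\<psi> u)" and ?d = "volume_density \<psi> u"
  note op = chart_open[OF c(1)]
  have F1_C1: "C1_on V (F1 i)" for i unfolding F1_def by (rule chart_C2[OF c(1)])
  have dF1: "(F1 i has_derivative fderiv (F1 i) u) (at u)" for i
    by (rule C1_on_has_derivative[OF F1_C1 c(2)])
  have dF: "((f \<circ> \<psi>) has_derivative DF \<psi> u) (at u)"
    by (rule C1_on_has_derivative[OF chart_C1[OF c(1)] c(2)])
  have dX: "((\<lambda>u. grad \<psi> u $ i) has_derivative fderiv (\<lambda>u. grad \<psi> u $ i) u) (at u)" for i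
    by (rule C1_on_has_derivative[OF grad_C1[OF c(1)] c(2)])
  have sym: "F2 i j = F2 j i" for i j
    unfolding F2_def F1_def by (rule second_derivative_symmetric[OF op c(2) chart_C1[OF c(1)] chart_C2[OF c(1)]])
  have g_entry: "g y $ i $ j = F1 i y \<bullet> F1 j y" for y i j
    by (simp add: g_def metric_matrix_def partial_def F1_def e_def)
  have gsym: "g u $ i $ j = g u $ j $ i" for i j by (simp add: g_entry inner_commute)
  have detg: "det (g u) > 0" unfolding g_def by (rule det_metric_pos[OF c])
  have Gg: "G ** g u = mat 1" "g u ** G = mat 1" using matrix_inv_left_right[of "g u"] detg by (auto simp: G_def)
  have GT: "transpose G = G"
  proof -
    have "transpose (g u) = g u" using gsym by (simp add: transpose_def vec_eq_iff)
    then have "transpose G ** g u = mat 1"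
      using Gg(2) matrix_transpose_mul[of "g u" G] by (simp add: transpose_mat)
    then show ?thesis using Gg by (metis matrix_mul_assoc matrix_mul_lid matrix_mul_rid)
  qed
  then have Gsym: "G $ k $ l = G $ l $ k" for k l by (simp add: transpose_def vec_eq_iff)
  have Gdelta: "(\<Sum>l\<in>UNIV. G $ k $ l * g u $ l $ i) = (if k = i then 1 else 0)" for k i
    using arg_cong[OF Gg(1), of "\<lambda>m. m $ k $ i"] by (simp add: matrix_matrix_mult_def mat_def)
  \<comment> \<open>Jacobi's formula; the two derivatives of the metric coefficients contribute equally to the trace\<close>
  have dens: "fderiv (volume_density \<psi>) u (e i) = ?d * (\<Sum>k\<in>UNIV. \<Sum>l\<in>UNIV. G $ k $ l * (F2 i k \<bullet> F1 l u))" for i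
  proof -
    have "((\<lambda>y. g y $ k $ l) has_derivative (\<lambda>h. F1 k u \<bullet> fderiv (F1 l) u h
        + fderiv (F1 k) u h \<bullet> F1 l u)) (at u)" for k l
      unfolding g_entry by (intro has_derivative_inner dF1)
    note has_derivative_det[of g _ u, OF this]
    then have "((\<lambda>y. det (g y)) has_derivative (\<lambda>h. det (g u) * (\<Sum>k\<in>UNIV. \<Sum>l\<in>UNIV. G $ k $ l *
        (F1 l u \<bullet> fderiv (F1 k) u h + fderiv (F1 l) u h \<bullet> F1 k u)))) (at u)"
      using detg by (simp add: G_def)
    then have "((\<lambda>y. sqrt (det (g y))) has_derivative (\<lambda>h. (det (g u) * (\<Sum>k\<in>UNIV. \<Sum>l\<in>UNIV. G $ k $ l *
        (F1 l u \<bullet> fderiv (F1 k) u h + fderiv (F1 l) u h \<bullet> F1 k u))) *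
          (inverse (sqrt (det (g u))) / 2))) (at u)"
      by (rule has_derivative_real_sqrt[where g = "\<lambda>y. det (g y)", OF detg])
    moreover have "(\<lambda>y. sqrt (det (g y))) = volume_density \<psi>" by (simp add: volume_density_def g_def fun_eq_iff)
    ultimately have "fderiv (volume_density \<psi>) u = (\<lambda>h. (det (g u) * (\<Sum>k\<in>UNIV. \<Sum>l\<in>UNIV. G $ k $ l *
        (F1 l u \<bullet> fderiv (F1 k) u h + fderiv (F1 l) u h \<bullet> F1 k u))) *
          (inverse (sqrt (det (g u))) / 2))"
      by (simp add: frechet_derivative_at[symmetric])
    then have "fderiv (volume_density \<psi>) u (e i) =
       (det (g u) * inverse (sqrt (det (g u))) / 2) * (\<Sum>k\<in>UNIV. \<Sum>l\<in>UNIV. G $ k $ l *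
        (F1 l u \<bullet> F2 i k + F2 i l \<bullet> F1 k u))" by (simp add: F2_def)
    also have "det (g u) * inverse (sqrt (det (g u))) / 2 = ?d / 2"
      using detg by (simp add: volume_density_def g_def[symmetric] field_simps)
    also have "(\<Sum>k\<in>UNIV. \<Sum>l\<in>UNIV. G $ k $ l * (F1 l u \<bullet> F2 i k + F2 i l \<bullet> F1 k u)) =
       (\<Sum>k\<in>UNIV. \<Sum>l\<in>UNIV. G $ k $ l * (F2 i k \<bullet> F1 l u)) + (\<Sum>k\<in>UNIV. \<Sum>l\<in>UNIV. G $ k $ l * (F2 i l \<bullet> F1 k u))"
      by (simp add: distrib_left sum.distrib inner_commute)
    also have "(\<Sum>k\<in>UNIV. \<Sum>l\<in>UNIV. G $ k $ l * (F2 i l \<bullet> F1 k u)) = (\<Sum>k\<in>UNIV. \<Sum>l\<in>UNIV. G $ k $ l * (F2 i k \<bullet> F1 l u))"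
      by (subst sum.swap) (simp add: Gsym)
    finally show ?thesis by simp
  qed
  have lhs: "fderiv (\<lambda>u. volume_density \<psi> u * grad \<psi> u $ i) u (axis i 1)
      = ?d * (DX i i + X i * (\<Sum>k\<in>UNIV. \<Sum>l\<in>UNIV. G $ k $ l * (F2 i k \<bullet> F1 l u)))" for i
  proof -
    have "((\<lambda>u. volume_density \<psi> u * grad \<psi> u $ i) has_derivative
       (\<lambda>h. ?d * fderiv (\<lambda>u. grad \<psi> u $ i) u h
          + fderiv (volume_density \<psi>) u h * grad \<psi> u $ i)) (at u)"
      by (intro has_derivative_mult dX C1_on_has_derivative[OF volume_density_C1[OF c(1)] c(2)])
    then have "fderiv (\<lambda>u. volume_density \<psi> u * grad \<psi> u $ i) u =
       (\<lambda>h. ?d * fderiv (\<lambda>u. grad \<psi> u $ i) u h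
          + fderiv (volume_density \<psi>) u h * grad \<psi> u $ i)"
      by (simp add: frechet_derivative_at[symmetric])
    then have "fderiv (\<lambda>u. volume_density \<psi> u * grad \<psi> u $ i) u (e i) =
       ?d * DX i i + fderiv (volume_density \<psi>) u (e i) * X i"
      by (simp add: DX_def X_def)
    then show ?thesis unfolding dens by (simp add: e_def[symmetric] algebra_simps)
  qed
  define DT where "DT k = (\<Sum>i\<in>UNIV. X i *\<^sub>R F2 k i + DX k i *\<^sub>R F1 i u)" for k
  have Texp: "tangent_part \<psi> y = (\<Sum>i\<in>UNIV. grad \<psi> y $ i *\<^sub>R F1 i y)" if "y \<in> V" for y
    unfolding tangent_part_def F1_def e_def by (rule linear_expand_axis[OF chart_DF_linear[OF c(1) that]])
  have dT: "((\<lambda>y. \<Sum>i\<in>UNIV. grad \<psi> y $ i *\<^sub>R F1 i y) has_derivative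
     (\<lambda>h. \<Sum>i\<in>UNIV. grad \<psi> u $ i *\<^sub>R fderiv (F1 i) u h
        + fderiv (\<lambda>u. grad \<psi> u $ i) u h *\<^sub>R F1 i u)) (at u)"
    by (intro has_derivative_sum has_derivative_scaleR dX dF1)
  have DTF: "DT k \<bullet> F1 l u = (p - ?T) \<bullet> F2 k l" for k l
  proof -
    have "((\<lambda>y. (\<Sum>i\<in>UNIV. grad \<psi> y $ i *\<^sub>R F1 i y) \<bullet> F1 l y) has_derivative
       (\<lambda>h. (\<Sum>i\<in>UNIV. grad \<psi> u $ i *\<^sub>R F1 i u) \<bullet> fderiv (F1 l) u h +
         (\<Sum>i\<in>UNIV. grad \<psi> u $ i *\<^sub>R fderiv (F1 i) u h
        + fderiv (\<lambda>u. grad \<psi> u $ i) u h *\<^sub>R F1 i u) \<bullet> F1 l u)) (at u)"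
      by (rule has_derivative_inner[OF dT dF1])
    moreover have "((\<lambda>y. (\<Sum>i\<in>UNIV. grad \<psi> y $ i *\<^sub>R F1 i y) \<bullet> F1 l y) has_derivative
       (\<lambda>h. fderiv (F1 l) u h \<bullet> p)) (at u)"
    proof (rule has_derivative_transform_within_open[OF _ op c(2)])
      show "((\<lambda>y. F1 l y \<bullet> p) has_derivative (\<lambda>h. fderiv (F1 l) u h \<bullet> p)) (at u)"
        by (rule has_derivative_inner_left[OF dF1])
      show "F1 l y \<bullet> p = (\<Sum>i\<in>UNIV. grad \<psi> y $ i *\<^sub>R F1 i y) \<bullet> F1 l y" if "y \<in> V" for y
        using inner_tangent_part[OF c(1) that, of "e l"] unfolding Texp[OF that, symmetric]
        by (simp add: F1_def inner_commute)
    qed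
    ultimately have "(\<lambda>h. (\<Sum>i\<in>UNIV. grad \<psi> u $ i *\<^sub>R F1 i u) \<bullet> fderiv (F1 l) u h +
         (\<Sum>i\<in>UNIV. grad \<psi> u $ i *\<^sub>R fderiv (F1 i) u h
        + fderiv (\<lambda>u. grad \<psi> u $ i) u h *\<^sub>R F1 i u) \<bullet> F1 l u) =
       (\<lambda>h. fderiv (F1 l) u h \<bullet> p)" by (rule has_derivative_unique)
    from fun_cong[OF this, of "e k"] have "?T \<bullet> F2 k l + DT k \<bullet> F1 l u = F2 k l \<bullet> p"
      by (simp only: Texp[OF c(2)] F2_def DT_def DX_def X_def)
    then show ?thesis by (simp add: inner_diff_left inner_diff_right inner_commute)
  qed
  have FF: "?F \<bullet> F2 k l = - g u $ k $ l" for k l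
  proof -
    have "((\<lambda>y. (f \<circ> \<psi>) y \<bullet> F1 l y) has_derivative
       (\<lambda>h. (f \<circ> \<psi>) u \<bullet> fderiv (F1 l) u h + DF \<psi> u h \<bullet> F1 l u)) (at u)"
      by (rule has_derivative_inner[OF dF dF1])
    moreover have "((\<lambda>y. (f \<circ> \<psi>) y \<bullet> F1 l y) has_derivative (\<lambda>h. 0)) (at u)"
      by (rule has_derivative_transform_within_open[OF has_derivative_const op c(2)])
         (use f_orthogonal_tangent[OF c(1)] in \<open>simp add: F1_def\<close>)
    ultimately have "(\<lambda>h. (f \<circ> \<psi>) u \<bullet> fderiv (F1 l) u h + DF \<psi> u h \<bullet> F1 l u) = (\<lambda>h. 0)"
      by (rule has_derivative_unique)
    from fun_cong[OF this, of "e k"] show ?thesis by (simp add: g_entry F2_def F1_def)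
  qed
  let ?N = "normal_part A f (\<psi> u) p"
  have NH: "(\<Sum>k\<in>UNIV. \<Sum>l\<in>UNIV. G $ k $ l * (?N \<bullet> F2 k l)) = 0"
  proof -
    have "mean_curvature_vector A f \<psi> u = 0" using minimal c unfolding minimal_def by blast
    then have "0 = ?N \<bullet> mean_curvature_vector A f \<psi> u" by simp
    also have "\<dots> = (\<Sum>k\<in>UNIV. \<Sum>l\<in>UNIV. G $ k $ l * (?N \<bullet> normal_part A f (\<psi> u) (F2 k l)))"
      unfolding mean_curvature_vector_def second_fundamental_form_def partial_def
      by (simp add: inner_sum_right G_def g_def F2_def F1_def[abs_def] e_def)
    also have "\<dots> = (\<Sum>k\<in>UNIV. \<Sum>l\<in>UNIV. G $ k $ l * (?N \<bullet> F2 k l))"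
    proof -
      have "?N \<bullet> normal_part A f (\<psi> u) v = ?N \<bullet> v" for v
        unfolding normal_part_def[of _ _ _ v] 
        by (rule inner_orthogonal_projection[OF subspace_normal_space])
           (use normal_part_chart[OF c] in simp)
      then show ?thesis by simp
    qed
    finally show ?thesis by simp
  qed
  \<comment> \<open>the trace of \<open>DT\<close> against the inverse metric, computed in two ways\<close>
  have decomp: "p - ?T = ?N + height (\<psi> u) *\<^sub>R ?F" by (simp add: normal_part_chart(1)[OF c])
  have "(\<Sum>k\<in>UNIV. \<Sum>l\<in>UNIV. G $ k $ l * (DT k \<bullet> F1 l u)) =
      (\<Sum>k\<in>UNIV. \<Sum>l\<in>UNIV. G $ k $ l * (?N \<bullet> F2 k l)) - height (\<psi> u) * (\<Sum>k\<in>UNIV. \<Sum>l\<in>UNIV. G $ k $ l * g u $ k $ l)"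
    unfolding DTF decomp
    by (simp add: inner_add_left FF right_diff_distrib sum_subtractf sum_distrib_left mult_ac)
  also have "(\<Sum>k\<in>UNIV. \<Sum>l\<in>UNIV. G $ k $ l * g u $ k $ l) = real CARD('n)"
    using Gdelta gsym by simp
  finally have A1: "(\<Sum>k\<in>UNIV. \<Sum>l\<in>UNIV. G $ k $ l * (DT k \<bullet> F1 l u)) = - real CARD('n) * height (\<psi> u)"
    using NH by simp
  have "(\<Sum>k\<in>UNIV. \<Sum>l\<in>UNIV. G $ k $ l * (DT k \<bullet> F1 l u)) =
     (\<Sum>k\<in>UNIV. \<Sum>l\<in>UNIV. \<Sum>i\<in>UNIV. X i * (G $ k $ l * (F2 k i \<bullet> F1 l u)))
     + (\<Sum>k\<in>UNIV. \<Sum>l\<in>UNIV. \<Sum>i\<in>UNIV. DX k i * (G $ k $ l * g u $ l $ i))"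
    by (simp add: DT_def inner_sum_left inner_add_left distrib_left sum.distrib sum_distrib_left g_entry
        inner_commute[of "F1 _ u" "F1 _ u"] mult_ac)
  also have "(\<Sum>k\<in>UNIV. \<Sum>l\<in>UNIV. \<Sum>i\<in>UNIV. DX k i * (G $ k $ l * g u $ l $ i)) = (\<Sum>k\<in>UNIV. DX k k)"
  proof (rule sum.cong[OF refl])
    fix k
    have "(\<Sum>l\<in>UNIV. \<Sum>i\<in>UNIV. DX k i * (G $ k $ l * g u $ l $ i)) = (\<Sum>i\<in>UNIV. DX k i * (\<Sum>l\<in>UNIV. G $ k $ l * g u $ l $ i))"
      by (subst sum.swap) (simp add: sum_distrib_left)
    then show "(\<Sum>l\<in>UNIV. \<Sum>i\<in>UNIV. DX k i * (G $ k $ l * g u $ l $ i)) = DX k k"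
      by (simp add: Gdelta if_distrib cong: if_cong)
  qed
  also have "(\<Sum>k\<in>UNIV. \<Sum>l\<in>UNIV. \<Sum>i\<in>UNIV. X i * (G $ k $ l * (F2 k i \<bullet> F1 l u)))
     = (\<Sum>i\<in>UNIV. X i * (\<Sum>k\<in>UNIV. \<Sum>l\<in>UNIV. G $ k $ l * (F2 i k \<bullet> F1 l u)))"
  proof -
    have "(\<Sum>k\<in>UNIV. \<Sum>l\<in>UNIV. \<Sum>i\<in>UNIV. X i * (G $ k $ l * (F2 k i \<bullet> F1 l u))) =
      (\<Sum>k\<in>UNIV. \<Sum>i\<in>UNIV. \<Sum>l\<in>UNIV. X i * (G $ k $ l * (F2 k i \<bullet> F1 l u)))"
      by (rule sum.cong[OF refl]) (rule sum.swap)
    also have "\<dots> = (\<Sum>i\<in>UNIV. \<Sum>k\<in>UNIV. \<Sum>l\<in>UNIV. X i * (G $ k $ l * (F2 k i \<bullet> F1 l u)))"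
      by (rule sum.swap)
    finally show ?thesis using sym by (simp add: sum_distrib_left)
  qed
  finally have A2: "(\<Sum>i\<in>UNIV. DX i i + X i * (\<Sum>k\<in>UNIV. \<Sum>l\<in>UNIV. G $ k $ l * (F2 i k \<bullet> F1 l u)))
      = - real CARD('n) * height (\<psi> u)"
    using A1 by (simp add: sum.distrib add.commute)
  show ?thesis unfolding lhs sum_distrib_left[symmetric] A2 by simp
qed


definition C1_M :: "('a \<Rightarrow> real) \<Rightarrow> bool"
  where "C1_M \<rho> \<longleftrightarrow> (\<forall>(V, \<psi>)\<in>A. C1_on V (\<rho> \<circ> \<psi>))"

text \<open>\<open>\<langle>\<nabla>\<rho>, \<nabla>\<phi>\<rangle>\<close>, evaluated in an arbitrarily chosen chart around the point; for \<open>C\<^sup>1\<close> functions the choice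
  does not matter (\<open>grad_deriv_transition\<close>).\<close>

definition grad_deriv :: "('a \<Rightarrow> real) \<Rightarrow> 'a \<Rightarrow> real"
  where "grad_deriv \<rho> x = (let (V, \<psi>, u) = SOME (V, \<psi>, u). (V, \<psi>) \<in> A \<and> u \<in> V \<and> \<psi> u = x
    in fderiv (\<rho> \<circ> \<psi>) u (grad \<psi> u))"

lemma C1_M_chart: "C1_M \<rho> \<Longrightarrow> (V, \<psi>) \<in> A \<Longrightarrow> C1_on V (\<rho> \<circ> \<psi>)"
  unfolding C1_M_def by blast

lemma grad_deriv_transition:
  assumes \<rho>: "C1_M \<rho>" and c: "(V, \<psi>) \<in> A" "(V', \<psi>') \<in> A" and u: "u \<in> V" "u' \<in> V'" "\<psi> u = \<psi>' u'"
  shows "fderiv (\<rho> \<circ> \<psi>) u (grad \<psi> u) = fderiv (\<rho> \<circ> \<psi>') u' (grad \<psi>' u')"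
proof -
  define \<tau> where "\<tau> = inv_into V' \<psi>' \<circ> \<psi>"
  note T = transition[OF c, folded \<tau>_def]
  have W: "u \<in> V \<inter> \<psi> -` (\<psi>' ` V')" using u by auto
  have tu: "\<tau> u = u'" using u chart_inj[OF c(2)] by (simp add: \<tau>_def inv_into_f_f)
  have "((\<lambda>u. (\<rho> \<circ> \<psi>') (\<tau> u)) has_derivative
      (\<lambda>v. fderiv (\<rho> \<circ> \<psi>') (\<tau> u) (fderiv \<tau> u v))) (at u)"
    by (rule has_derivative_compose[OF C1_on_has_derivative[OF T(2) W]
          C1_on_has_derivative[OF C1_M_chart[OF \<rho> c(2)] T(4)[OF W]]])
  moreover have "fderiv (\<rho> \<circ> \<psi>) u = fderiv (\<lambda>u. (\<rho> \<circ> \<psi>') (\<tau> u)) u"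
    by (rule frechet_derivative_eq_on_open[OF T(1) W]) (simp add: T(5))
  ultimately show ?thesis
    using grad_transition[OF c W, folded \<tau>_def] by (simp add: frechet_derivative_at[symmetric] tu)
qed

lemma grad_deriv_chart:
  assumes \<rho>: "C1_M \<rho>" and c: "(V, \<psi>) \<in> A" "u \<in> V"
  shows "grad_deriv \<rho> (\<psi> u) = fderiv (\<rho> \<circ> \<psi>) u (grad \<psi> u)"
proof -
  let ?P = "\<lambda>(V', \<psi>', u'). (V', \<psi>') \<in> A \<and> u' \<in> V' \<and> \<psi>' u' = \<psi> u"
  obtain V' \<psi>' u' where eq: "(SOME t. ?P t) = (V', \<psi>', u')"
    by (rule prod_cases3[of "SOME t. ?P t"])
  have "?P (V, \<psi>, u)" using c by simp
  then have "?P (SOME t. ?P t)" by (rule someI)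
  then have P: "(V', \<psi>') \<in> A" "u' \<in> V'" "\<psi>' u' = \<psi> u" unfolding eq by auto
  have "grad_deriv \<rho> (\<psi> u) = fderiv (\<rho> \<circ> \<psi>') u' (grad \<psi>' u')"
    unfolding grad_deriv_def eq by simp
  also have "\<dots> = fderiv (\<rho> \<circ> \<psi>) u (grad \<psi> u)"
    using grad_deriv_transition[OF \<rho> P(1) c(1) P(2) c(2) P(3)] .
  finally show ?thesis .
qed

lemma C1_M_continuous: "C1_M \<rho> \<Longrightarrow> continuous_on M \<rho>"
  by (rule continuous_on_M) (rule C1_on_continuous[OF C1_M_chart])

lemma grad_deriv_continuous:
  assumes \<rho>: "C1_M \<rho>" shows "continuous_on M (grad_deriv \<rho>)"
proof (rule continuous_on_M)
  fix V \<psi> assume c: "(V, \<psi>) \<in> A"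
  have "continuous_on V (\<lambda>u. \<Sum>i\<in>UNIV. grad \<psi> u $ i *\<^sub>R fderiv (\<rho> \<circ> \<psi>) u (axis i 1))"
    by (intro continuous_on_sum continuous_on_scaleR C1_on_continuous[OF grad_C1[OF c]]
        C1_on_continuous_derivative[OF C1_M_chart[OF \<rho> c]])
  then show "continuous_on V (grad_deriv \<rho> \<circ> \<psi>)"
    by (rule continuous_on_eq)
       (simp only: o_apply grad_deriv_chart[OF \<rho> c] linear_expand_axis[OF C1_on_linear[OF C1_M_chart[OF \<rho> c]], symmetric])
qed

lemma grad_deriv_cong:
  assumes "C1_M \<rho>" "C1_M \<sigma>" "\<And>x. x \<in> M \<Longrightarrow> \<rho> x = \<sigma> x" "x \<in> M"
  shows "grad_deriv \<rho> x = grad_deriv \<sigma> x"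
proof -
  obtain V \<psi> u where c: "(V, \<psi>) \<in> A" "u \<in> V" "\<psi> u = x" using charts_cover assms(4) by blast
  have "fderiv (\<rho> \<circ> \<psi>) u = fderiv (\<sigma> \<circ> \<psi>) u"
    by (rule frechet_derivative_eq_on_open[OF chart_open[OF c(1)] c(2)])
       (use assms(3) chart_in[OF c(1)] in simp)
  then show ?thesis
    using grad_deriv_chart[OF assms(1) c(1,2)] grad_deriv_chart[OF assms(2) c(1,2)] c(3) by simp
qed

lemma C1_M_sum:
  assumes "\<And>i. i \<in> I \<Longrightarrow> C1_M (\<rho> i)" shows "C1_M (\<lambda>x. \<Sum>i\<in>I. \<rho> i x)"
  unfolding C1_M_def using assms C1_M_chart
  by (auto simp: o_def simp del: Ck_on.simps intro!: C1_on_sum)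

lemma C1_M_mult: "C1_M \<rho> \<Longrightarrow> C1_M \<sigma> \<Longrightarrow> C1_M (\<lambda>x. \<rho> x * \<sigma> x)"
  unfolding C1_M_def using C1_on_mult by (fastforce simp: o_def simp del: Ck_on.simps)

lemma C1_M_divide: "C1_M \<rho> \<Longrightarrow> C1_M \<sigma> \<Longrightarrow> (\<And>x. x \<in> M \<Longrightarrow> \<sigma> x \<noteq> 0) \<Longrightarrow> C1_M (\<lambda>x. \<rho> x / \<sigma> x)"
  unfolding C1_M_def using C1_on_divide chart_in by (fastforce simp: o_def simp del: Ck_on.simps)

lemma grad_deriv_sum:
  assumes "\<And>i. i \<in> I \<Longrightarrow> C1_M (\<rho> i)" "x \<in> M"
  shows "grad_deriv (\<lambda>x. \<Sum>i\<in>I. \<rho> i x) x = (\<Sum>i\<in>I. grad_deriv (\<rho> i) x)"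
proof -
  obtain V \<psi> u where c: "(V, \<psi>) \<in> A" "u \<in> V" "\<psi> u = x" using charts_cover assms(2) by blast
  have "((\<lambda>u. \<Sum>i\<in>I. (\<rho> i \<circ> \<psi>) u) has_derivative (\<lambda>h. \<Sum>i\<in>I. fderiv (\<rho> i \<circ> \<psi>) u h)) (at u)"
    by (intro has_derivative_sum C1_on_has_derivative[OF C1_M_chart[OF assms(1) c(1)] c(2)])
  then have "fderiv ((\<lambda>x. \<Sum>i\<in>I. \<rho> i x) \<circ> \<psi>) u = (\<lambda>h. \<Sum>i\<in>I. fderiv (\<rho> i \<circ> \<psi>) u h)"
    by (simp add: frechet_derivative_at[symmetric] o_def)
  then show ?thesis
    using grad_deriv_chart[OF C1_M_sum c(1,2), of I \<rho>] grad_deriv_chart[OF assms(1) c(1,2)] assms(1) c(3) by simp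
qed

text \<open>In the chart the integrand times the volume density is the Euclidean divergence of the compactly
  supported field \<open>\<rho> \<surd>(det g) grad\<close>.\<close>

lemma integral_grad_deriv_chart:
  assumes \<rho>: "C1_M \<rho>" and c: "(V, \<psi>) \<in> A" and K: "compact K" "K \<subseteq> V"
    and z: "\<And>x. x \<in> M - \<psi> ` K \<Longrightarrow> \<rho> x = 0"
  shows "(\<integral>x. grad_deriv \<rho> x - real CARD('n) * height x * \<rho> x \<partial>vol) = 0"
proof -
  let ?R = "\<rho> \<circ> \<psi>"
  define w where "w i u = ?R u * (volume_density \<psi> u * grad \<psi> u $ i)" for i u
  define w' where "w' i u = (if u \<in> V then w i u else 0)" for i u
  note op = chart_open[OF c]
  have Rz: "?R u = 0" if "u \<in> V - K" for u
    using that z[of "\<psi> u"] chart_in[OF c] chart_inj[OF c] K(2) by (auto simp: inj_on_def)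
  have Y: "C1_on V (\<lambda>u. volume_density \<psi> u * grad \<psi> u $ i)" for i
    by (intro C1_on_mult volume_density_C1[OF c] grad_C1[OF c])
  have w: "C1_on V (w i)" for i
    unfolding w_def by (intro C1_on_mult Y C1_M_chart[OF \<rho> c])
  have w': "C1_on UNIV (w' i)" for i
    unfolding w'_def
    by (rule C1_on_extend_by_zero[OF op w compact_imp_closed[OF K(1)] K(2)]) (simp add: w_def Rz[unfolded o_def])
  have w'z: "w' i u = 0" if "u \<notin> K" for i u using that Rz[of u] by (auto simp: w'_def w_def)
  have I: "integrable lborel (\<lambda>x. fderiv (w' i) x v)"
      "(\<integral>x. fderiv (w' i) x v \<partial>lborel) = 0" for i v
    by (rule integral_derivative_compact_support[OF w' K(1) w'z]; assumption)+
  have pt: "indicator V u * (volume_density \<psi> u * (grad_deriv \<rho> (\<psi> u) - real CARD('n) * height (\<psi> u) * \<rho> (\<psi> u)))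
      = (\<Sum>i\<in>UNIV. fderiv (w' i) u (axis i 1))" for u
  proof (cases "u \<in> V")
    case True
    have dw: "fderiv (w' i) u h =
        ?R u * fderiv (\<lambda>u. volume_density \<psi> u * grad \<psi> u $ i) u h
        + fderiv ?R u h * (volume_density \<psi> u * grad \<psi> u $ i)" for i h
    proof -
      have "fderiv (w' i) u = fderiv (w i) u"
        by (rule frechet_derivative_eq_on_open[OF op True]) (simp add: w'_def)
      moreover have "(w i has_derivative (\<lambda>h. ?R u * fderiv (\<lambda>u. volume_density \<psi> u * grad \<psi> u $ i) u h
        + fderiv ?R u h * (volume_density \<psi> u * grad \<psi> u $ i))) (at u)"
        unfolding w_def
        by (intro has_derivative_mult C1_on_has_derivative[OF Y True] C1_on_has_derivative[OF C1_M_chart[OF \<rho> c] True])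
      ultimately show ?thesis by (simp add: frechet_derivative_at[symmetric])
    qed
    have "(\<Sum>i\<in>UNIV. fderiv (w' i) u (axis i 1)) =
       ?R u * (\<Sum>i\<in>UNIV. fderiv (\<lambda>u. volume_density \<psi> u * grad \<psi> u $ i) u (axis i 1))
       + volume_density \<psi> u * (\<Sum>i\<in>UNIV. grad \<psi> u $ i *\<^sub>R fderiv ?R u (axis i 1))"
      by (simp add: dw sum.distrib sum_distrib_left mult_ac)
    also have "(\<Sum>i\<in>UNIV. grad \<psi> u $ i *\<^sub>R fderiv ?R u (axis i 1)) = grad_deriv \<rho> (\<psi> u)"
      unfolding grad_deriv_chart[OF \<rho> c True]
      by (rule linear_expand_axis[OF C1_on_linear[OF C1_M_chart[OF \<rho> c] True], symmetric])
    finally show ?thesis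
      unfolding divergence_grad[OF c True] using True by (simp add: algebra_simps)
  next
    case False
    then have "fderiv (w' i) u v = 0" for i v
      using frechet_derivative_outside_support[OF compact_imp_closed[OF K(1)], of "w' i" u v] w'z K(2) by blast
    then show ?thesis using False by simp
  qed
  have cont: "continuous_on M (\<lambda>x. grad_deriv \<rho> x - real CARD('n) * height x * \<rho> x)"
    unfolding height_def
    by (intro continuous_on_diff continuous_on_mult continuous_on_const continuous_on_inner
        grad_deriv_continuous[OF \<rho>] f_continuous C1_M_continuous[OF \<rho>])
  have zz: "grad_deriv \<rho> x - real CARD('n) * height x * \<rho> x = 0" if x: "x \<in> M - \<psi> ` V" for x
  proof -
    have "compact (\<psi> ` K)"
      using compact_continuous_image[OF continuous_on_subset[OF chart_continuous[OF c] K(2)] K(1)] .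
    then have "closed (\<psi> ` K)" by (rule compact_imp_closed)
    then have "openin (top_of_set M) (M - \<psi> ` K)"
      by (auto simp: openin_open Diff_eq intro!: exI[of _ "- \<psi> ` K"])
    moreover have xK: "x \<in> M - \<psi> ` K" using x K(2) by blast
    obtain V' \<psi>' u where c': "(V', \<psi>') \<in> A" "u \<in> V'" "\<psi>' u = x"
      using charts_cover[of x] xK by auto
    ultimately have op': "open (V' \<inter> \<psi>' -` (M - \<psi> ` K))" using chart_vimage_open[OF c'(1)] by simp
    have "fderiv (\<rho> \<circ> \<psi>') u = fderiv (\<lambda>u. 0) u"
      by (rule frechet_derivative_eq_on_open[OF op']) (use c' xK z in auto)
    then have "grad_deriv \<rho> x = 0" using grad_deriv_chart[OF \<rho> c'(1,2)] c'(3) by simp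
    then show ?thesis using z[OF xK] by simp
  qed
  have "(\<integral>x. grad_deriv \<rho> x - real CARD('n) * height x * \<rho> x \<partial>vol) =
    (\<integral>u. (\<Sum>i\<in>UNIV. fderiv (w' i) u (axis i 1)) \<partial>lborel)"
    unfolding pt[symmetric]
    by (rule integral_vol_chart[OF c _ zz])
       (use continuous_measurable[OF cont] in \<open>simp cong: measurable_cong_sets\<close>)
  also have "\<dots> = (\<Sum>i\<in>UNIV. \<integral>u. fderiv (w' i) u (axis i 1) \<partial>lborel)"
    by (rule Bochner_Integration.integral_sum) (rule I(1))
  also have "\<dots> = 0" by (simp only: I(2) sum.neutral_const)
  finally show ?thesis .
qed

text \<open>Away from the chart the function vanishes on the complement of a compact set, which is open in \<open>M\<close>
  because \<open>M\<close> is Hausdorff; this gives the regularity in all other charts.\<close>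

lemma chart_bump:
  assumes c: "(V, \<psi>) \<in> A" and r: "cball a r \<subseteq> V" "r > 0"
  obtains b where "C1_M b" "\<And>x. b x \<ge> 0" "\<And>x. x \<in> \<psi> ` ball a r \<Longrightarrow> b x > 0" "\<And>x. x \<notin> \<psi> ` cball a r \<Longrightarrow> b x = 0"
proof -
  define \<beta> where "\<beta> u = (max 0 (r\<^sup>2 - (u - a) \<bullet> (u - a)))\<^sup>2" for u :: "real^'n"
  define b where "b x = (if x \<in> \<psi> ` V then \<beta> (inv_into V \<psi> x) else 0)" for x
  have \<beta>C1: "C1_on UNIV \<beta>"
    unfolding \<beta>_def[abs_def]
  proof (rule C1_on_compose_real[where U = UNIV and h = "\<lambda>t. (max 0 t)\<^sup>2" and h' = "\<lambda>t. 2 * max 0 t"])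
    show "C1_on UNIV (\<lambda>u. r\<^sup>2 - (u - a) \<bullet> (u - a))"
      by (intro C1_on_diff C1_on_const C1_on_inner C1_on_linear_map bounded_linear_ident)
    show "((\<lambda>t. (max 0 t)\<^sup>2) has_real_derivative 2 * max 0 t) (at t)" for t :: real by (rule DERIV_max0_square)
    show "continuous_on UNIV (\<lambda>t::real. 2 * max 0 t)" by (intro continuous_intros)
  qed auto
  have \<beta>out: "\<beta> u = 0" if "u \<notin> cball a r" for u
  proof -
    have "r \<le> norm (u - a)" using that by (simp add: dist_norm norm_minus_commute)
    then have "r\<^sup>2 \<le> (norm (u - a))\<^sup>2" using r by (intro power_mono) auto
    then show ?thesis by (simp add: \<beta>_def power2_norm_eq_inner)
  qed
  have \<beta>in: "\<beta> u > 0" if "u \<in> ball a r" for u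
  proof -
    have "norm (u - a) < r" using that by (simp add: dist_norm norm_minus_commute)
    then have "(norm (u - a))\<^sup>2 < r\<^sup>2" using r by (intro power_strict_mono) auto
    then show ?thesis by (simp add: \<beta>_def power2_norm_eq_inner)
  qed
  have bchart: "b (\<psi> u) = \<beta> u" if "u \<in> V" for u
    using that chart_inj[OF c] by (simp add: b_def inv_into_f_f)
  have bout: "b x = 0" if "x \<notin> \<psi> ` cball a r" for x
  proof (cases "x \<in> \<psi> ` V")
    case True
    then obtain u where u: "u \<in> V" "x = \<psi> u" by blast
    then have "u \<notin> cball a r" using that by blast
    then show ?thesis using u bchart \<beta>out by metis
  qed (simp add: b_def)
  have "C1_M b"
    unfolding C1_M_def
  proof (intro ballI, clarify, rule C1_on_local)
    fix V' \<psi>' u assume c': "(V', \<psi>') \<in> A" and u: "u \<in> V'"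
    show "\<exists>U. open U \<and> u \<in> U \<and> C1_on U (b \<circ> \<psi>')"
    proof (cases "\<psi>' u \<in> \<psi> ` V")
      case True
      define W where "W = V' \<inter> \<psi>' -` (\<psi> ` V)"
      note T = transition[OF c' c, folded W_def]
      have "C1_on W (\<lambda>u. \<beta> ((inv_into V \<psi> \<circ> \<psi>') u))"
        by (rule C1_on_compose[OF T(2) _ \<beta>C1]) simp
      then have "C1_on W (b \<circ> \<psi>')"
        by (rule Ck_on_cong_open[OF T(1), rotated]) (simp add: W_def b_def)
      then show ?thesis using T(1) u True by (intro exI[of _ W]) (auto simp: W_def)
    next
      case False
      have "compact (\<psi> ` cball a r)"
        by (rule compact_continuous_image[OF continuous_on_subset[OF chart_continuous[OF c] r(1)] compact_cball])
      then have "closed (\<psi> ` cball a r)" by (rule compact_imp_closed)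
      then have "openin (top_of_set M) (M - \<psi> ` cball a r)"
        by (auto simp: openin_open Diff_eq intro!: exI[of _ "- \<psi> ` cball a r"])
      then have op: "open (V' \<inter> \<psi>' -` (M - \<psi> ` cball a r))" by (rule chart_vimage_open[OF c'])
      have "C1_on (V' \<inter> \<psi>' -` (M - \<psi> ` cball a r)) (b \<circ> \<psi>')"
        by (rule Ck_on_cong_open[OF op _ C1_on_const[of _ 0]]) (auto simp: bout)
      then show ?thesis using op u False r(1) chart_in[OF c'] by (intro exI[of _ "V' \<inter> \<psi>' -` (M - \<psi> ` cball a r)"]) auto
    qed
  qed
  moreover have "b x \<ge> 0" for x by (simp add: b_def \<beta>_def)
  moreover have "b x > 0" if x: "x \<in> \<psi> ` ball a r" for x
  proof -
    obtain u where u: "u \<in> ball a r" "x = \<psi> u" using x by blast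
    then have "u \<in> V" using r(1) ball_subset_cball by blast
    then show ?thesis using u bchart \<beta>in by simp
  qed
  ultimately show ?thesis using that bout by blast
qed

text \<open>The divergence theorem for \<open>\<rho> \<nabla>\<phi>\<close>, with \<open>\<Delta>\<phi> = - n \<phi>\<close>.  A partition of unity splits \<open>\<rho>\<close> into functions
  supported in charts.\<close>

theorem integral_grad_deriv:
  assumes \<rho>: "C1_M \<rho>"
  shows "(\<integral>x. grad_deriv \<rho> x - real CARD('n) * height x * \<rho> x \<partial>vol) = 0"
proof -
  obtain N :: nat and V \<psi> and a :: "nat \<Rightarrow> real^'n" and r
    where C: "\<And>i. i < N \<Longrightarrow> (V i, \<psi> i) \<in> A" "\<And>i. i < N \<Longrightarrow> r i > 0"
      "\<And>i. i < N \<Longrightarrow> cball (a i) (r i) \<subseteq> V i"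
      "M = (\<Union>i<N. \<psi> i ` ball (a i) (r i))" by (rule finite_ball_cover) (rule that)
  have "\<exists>b. C1_M b \<and> (\<forall>x. b x \<ge> 0) \<and> (\<forall>x\<in>\<psi> i ` ball (a i) (r i). b x > 0) \<and> (\<forall>x. x \<notin> \<psi> i ` cball (a i) (r i) \<longrightarrow> b x = 0)"
    if "i < N" for i
    using chart_bump[OF C(1)[OF that] C(3)[OF that] C(2)[OF that]] by metis
  then obtain b where b: "\<And>i. i < N \<Longrightarrow> C1_M (b i)" "\<And>i x. i < N \<Longrightarrow> b i x \<ge> 0"
    "\<And>i x. i < N \<Longrightarrow> x \<in> \<psi> i ` ball (a i) (r i) \<Longrightarrow> b i x > 0"
    "\<And>i x. i < N \<Longrightarrow> x \<notin> \<psi> i ` cball (a i) (r i) \<Longrightarrow> b i x = 0" by metis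
  define B where "B x = (\<Sum>i<N. b i x)" for x
  have Bpos: "B x > 0" if "x \<in> M" for x
  proof -
    obtain i where i: "i < N" "x \<in> \<psi> i ` ball (a i) (r i)" using \<open>x \<in> M\<close> C(4) by blast
    show ?thesis unfolding B_def by (rule sum_pos2[of _ i]) (use i b in auto)
  qed
  have BC1: "C1_M B" unfolding B_def[abs_def] by (intro C1_M_sum b) simp
  define \<sigma> where "\<sigma> i x = b i x * (\<rho> x / B x)" for i x
  have \<sigma>C1: "C1_M (\<sigma> i)" if "i < N" for i
    unfolding \<sigma>_def[abs_def] using Bpos by (intro C1_M_mult C1_M_divide b(1) that \<rho> BC1) force
  have sum\<sigma>: "(\<Sum>i<N. \<sigma> i x) = \<rho> x" if "x \<in> M" for x
  proof -
    have "(\<Sum>i<N. \<sigma> i x) = B x * (\<rho> x / B x)" unfolding \<sigma>_def sum_distrib_right[symmetric] by (simp only: B_def)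
    then show ?thesis using Bpos[OF that] by simp
  qed
  have cont: "continuous_on M (\<lambda>x. grad_deriv \<rho> x - real CARD('n) * height x * \<rho> x)" if "C1_M \<rho>" for \<rho>
    unfolding height_def
    by (intro continuous_on_diff continuous_on_mult continuous_on_const continuous_on_inner
        grad_deriv_continuous[OF that] f_continuous C1_M_continuous[OF that])
  have "(\<integral>x. grad_deriv \<rho> x - real CARD('n) * height x * \<rho> x \<partial>vol) =
     (\<integral>x. (\<Sum>i<N. grad_deriv (\<sigma> i) x - real CARD('n) * height x * \<sigma> i x) \<partial>vol)"
  proof (rule Bochner_Integration.integral_cong[OF refl])
    fix x assume "x \<in> space vol"
    then have x: "x \<in> M" by simp
    have "grad_deriv \<rho> x = grad_deriv (\<lambda>x. \<Sum>i<N. \<sigma> i x) x"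
      by (rule grad_deriv_cong[OF \<rho> C1_M_sum _ x]) (use \<sigma>C1 sum\<sigma> in auto)
    also have "\<dots> = (\<Sum>i<N. grad_deriv (\<sigma> i) x)" by (rule grad_deriv_sum[OF _ x]) (use \<sigma>C1 in auto)
    finally show "grad_deriv \<rho> x - real CARD('n) * height x * \<rho> x =
      (\<Sum>i<N. grad_deriv (\<sigma> i) x - real CARD('n) * height x * \<sigma> i x)"
      by (simp add: sum_subtractf sum_distrib_left[symmetric] sum\<sigma>[OF x])
  qed
  also have "\<dots> = (\<Sum>i<N. \<integral>x. grad_deriv (\<sigma> i) x - real CARD('n) * height x * \<sigma> i x \<partial>vol)"
    by (rule Bochner_Integration.integral_sum) (use continuous_integrable cont \<sigma>C1 in blast)
  also have "\<dots> = 0"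
  proof (rule sum.neutral, rule ballI)
    fix i assume "i \<in> {..<N}"
    then have i: "i < N" by simp
    show "(\<integral>x. grad_deriv (\<sigma> i) x - real CARD('n) * height x * \<sigma> i x \<partial>vol) = 0"
      by (rule integral_grad_deriv_chart[OF \<sigma>C1[OF i] C(1)[OF i] compact_cball C(3)[OF i]])
         (simp add: \<sigma>_def b(4)[OF i])
  qed
  finally show ?thesis .
qed

lemma height_bounds:
  assumes "x \<in> M" shows "height x \<in> {-1..1}"
proof -
  have "\<bar>height x\<bar> \<le> norm (f x) * norm p" unfolding height_def by (rule Cauchy_Schwarz_ineq2)
  then show ?thesis using f_norm[OF assms] norm_p by auto
qed

lemma height_continuous: "continuous_on M height"
  unfolding height_def by (intro continuous_intros f_continuous)

lemma normal_sq_continuous: "continuous_on M normal_sq"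
proof (rule continuous_on_M)
  fix V \<psi> assume c: "(V, \<psi>) \<in> A"
  have "continuous_on V (\<lambda>u. 1 - (height (\<psi> u))\<^sup>2 - (\<Sum>i\<in>UNIV. grad \<psi> u $ i *\<^sub>R DF \<psi> u (axis i 1)) \<bullet> p)"
    by (intro continuous_intros C1_on_continuous[OF grad_C1[OF c]] C1_on_continuous[OF chart_C2[OF c]]
        continuous_on_compose2[OF height_continuous chart_continuous[OF c] chart_image_subset[OF c]])
  then show "continuous_on V (normal_sq \<circ> \<psi>)"
    by (rule continuous_on_eq)
       (simp add: linear_expand_axis[OF chart_DF_linear[OF c], symmetric] normal_sq_chart[OF c])
qed

lemma normal_sq_bounds:
  assumes "x \<in> M" shows "0 \<le> normal_sq x" "normal_sq x \<le> 1 - (height x)\<^sup>2"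
proof -
  obtain V \<psi> u where c: "(V, \<psi>) \<in> A" "u \<in> V" "\<psi> u = x" using charts_cover assms by blast
  show "0 \<le> normal_sq x" by (simp add: normal_sq_def)
  have "0 \<le> tangent_part \<psi> u \<bullet> tangent_part \<psi> u" by simp
  also have "\<dots> = tangent_part \<psi> u \<bullet> p"
    using inner_tangent_part[OF c(1,2), of "grad \<psi> u"] by (simp add: tangent_part_def)
  also have "\<dots> = 1 - (height x)\<^sup>2 - normal_sq x"
    using normal_sq_chart[OF c(1,2)] c(3) by (simp add: tangent_part_def)
  finally show "normal_sq x \<le> 1 - (height x)\<^sup>2" by simp
qed

text \<open>The weighted identities from which all estimates are read off, one for each profile \<open>h\<close>.\<close>

theorem integral_profile:
  assumes U: "{-1..1} \<subseteq> U" and h: "\<And>t. t \<in> U \<Longrightarrow> (h has_real_derivative h' t) (at t)"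
    and h': "continuous_on U h'"
  shows "(\<integral>x. h' (height x) * (1 - (height x)\<^sup>2 - normal_sq x)
    - real CARD('n) * height x * h (height x) \<partial>vol) = 0"
proof -
  have hc: "C1_on V (\<lambda>u. (f \<circ> \<psi>) u \<bullet> p)" if "(V, \<psi>) \<in> A" for V \<psi>
    by (rule C1_on_inner[OF chart_C1[OF that] C1_on_const])
  have C1: "C1_M (\<lambda>x. h (height x))"
    unfolding C1_M_def
  proof (intro ballI, clarify)
    fix V \<psi> assume c: "(V, \<psi>) \<in> A"
    have "C1_on V (\<lambda>u. h ((f \<circ> \<psi>) u \<bullet> p))"
      by (rule C1_on_compose_real[OF hc[OF c] _ h h'])
         (use height_bounds[OF chart_in[OF c]] U in \<open>auto simp: height_def\<close>)
    then show "C1_on V ((\<lambda>x. h (height x)) \<circ> \<psi>)" by (simp add: o_def height_def del: Ck_on.simps)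
  qed
  have "grad_deriv (\<lambda>x. h (height x)) x = h' (height x) * (1 - (height x)\<^sup>2 - normal_sq x)" if x: "x \<in> M" for x
  proof -
    obtain V \<psi> u where c: "(V, \<psi>) \<in> A" "u \<in> V" "\<psi> u = x" using charts_cover x by blast
    have "((\<lambda>u. (f \<circ> \<psi>) u \<bullet> p) has_derivative (\<lambda>v. DF \<psi> u v \<bullet> p)) (at u)"
      by (intro has_derivative_inner_left C1_on_has_derivative[OF chart_C1[OF c(1)] c(2)])
    moreover have "(h has_derivative (*) (h' (height x))) (at ((f \<circ> \<psi>) u \<bullet> p))"
      using h[of "height x"] height_bounds[OF x] U c(3) by (auto simp: has_field_derivative_def height_def)
    ultimately have "((\<lambda>u. h ((f \<circ> \<psi>) u \<bullet> p)) has_derivative (\<lambda>v. h' (height x) * (DF \<psi> u v \<bullet> p))) (at u)"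
      by (rule has_derivative_compose)
    then have "fderiv ((\<lambda>x. h (height x)) \<circ> \<psi>) u = (\<lambda>v. h' (height x) * (DF \<psi> u v \<bullet> p))"
      by (simp add: frechet_derivative_at[symmetric] o_def height_def)
    then show ?thesis
      using grad_deriv_chart[OF C1 c(1,2)] normal_sq_chart[OF c(1,2)] c(3) by simp
  qed
  then have "(\<integral>x. h' (height x) * (1 - (height x)\<^sup>2 - normal_sq x)
    - real CARD('n) * height x * h (height x) \<partial>vol) =
    (\<integral>x. grad_deriv (\<lambda>x. h (height x)) x - real CARD('n) * height x * h (height x) \<partial>vol)"
    by (intro Bochner_Integration.integral_cong) auto
  then show ?thesis using integral_grad_deriv[OF C1] by simp
qed

end

section \<open>The radial profiles\<close>

text \<open>The recursion is the reduction formula for the primitive of \<open>cos\<^sup>k\<close> that vanishes at \<open>0\<close>.\<close>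

fun cos_power_integral :: "nat \<Rightarrow> real \<Rightarrow> real" where
  "cos_power_integral 0 x = x"
| "cos_power_integral (Suc 0) x = sin x"
| "cos_power_integral (Suc (Suc k)) x =
    (cos x ^ Suc k * sin x + real (Suc k) * cos_power_integral k x) / real (Suc (Suc k))"

lemma DERIV_cos_power_integral:
  "((cos_power_integral k) has_real_derivative cos x ^ k) (at x)"
proof (induction k arbitrary: x rule: induct_nat_012)
  case 0
  have "cos_power_integral 0 = (\<lambda>x. x)" by (simp add: fun_eq_iff)
  then show ?case by simp
next
  case 1
  have "cos_power_integral (Suc 0) = sin" by (simp add: fun_eq_iff)
  then show ?case by simp
next
  case (ge2 k)
  have eq: "cos_power_integral (Suc (Suc k)) =
      (\<lambda>x. (cos x ^ Suc k * sin x + real (Suc k) * cos_power_integral k x) / real (Suc (Suc k)))"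
    by (simp add: fun_eq_iff)
  have "((\<lambda>x. cos x ^ Suc k) has_real_derivative real (Suc k) * cos x ^ k * (- sin x)) (at x)"
    using DERIV_power[OF DERIV_cos[of x], of "Suc k"] by (simp add: mult_ac)
  from DERIV_cdivide[OF DERIV_add[OF DERIV_mult[OF this DERIV_sin] DERIV_cmult[OF ge2(1), of "real (Suc k)"]], of "real (Suc (Suc k))"]
  have "(cos_power_integral (Suc (Suc k)) has_real_derivative
      ((real (Suc k) * cos x ^ k * (- sin x)) * sin x + cos x * cos x ^ Suc k + real (Suc k) * cos x ^ k) / real (Suc (Suc k))) (at x)"
    unfolding eq .
  moreover have "(real (Suc k) * cos x ^ k * (- sin x)) * sin x + cos x * cos x ^ Suc k + real (Suc k) * cos x ^ k
      = real (Suc (Suc k)) * cos x ^ Suc (Suc k)"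
  proof -
    have "(K * C * (- b)) * b + a * (a * C) + K * C = (K + 1) * (a * (a * C))"
      if "b * b = 1 - a * a" for K C a b :: real
    proof -
      have 1: "(K * C * (- b)) * b + a * (a * C) + K * C = K * C * (1 - b * b) + a * (a * C)"
        by (simp add: algebra_simps)
      have 2: "1 - b * b = a * a" using that by simp
      show ?thesis unfolding 1 2 by (simp add: algebra_simps)
    qed
    from this[of "sin x" "cos x" "real (Suc k)" "cos x ^ k"] sin_cos_squared_add3[of x]
    show ?thesis by (simp add: add.commute)
  qed
  ultimately have "(cos_power_integral (Suc (Suc k)) has_real_derivative
      (real (Suc (Suc k)) * cos x ^ Suc (Suc k)) / real (Suc (Suc k))) (at x)" by (simp only:)
  then show ?case by (simp del: cos_power_integral.simps power_Suc of_nat_Suc)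
qed

lemma cos_power_integral_minus: "cos_power_integral k (- x) = - cos_power_integral k x"
  by (induction k x rule: cos_power_integral.induct) (auto simp: field_simps)

lemma cos_power_integral_0 [simp]: "cos_power_integral k 0 = 0"
  using cos_power_integral_minus[of k 0] by simp

lemma DERIV_inverse_sqrt_power:
  assumes "s > 0"
  shows "((\<lambda>s. 1 / sqrt s ^ n) has_real_derivative - (real n / 2) / sqrt s ^ (n + 2)) (at s)"
proof (cases n)
  case (Suc k)
  have "((\<lambda>s. 1 / sqrt s ^ n) has_real_derivative
      - (real n * sqrt s ^ (n - 1) * (inverse (sqrt s) / 2)) / (sqrt s ^ n * sqrt s ^ n)) (at s)"
    using assms by (auto intro!: derivative_eq_intros simp: field_simps)
  also have "- (real n * sqrt s ^ (n - 1) * (inverse (sqrt s) / 2)) / (sqrt s ^ n * sqrt s ^ n)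
      = - (real n / 2) / sqrt s ^ (n + 2)"
    using assms unfolding Suc by (simp add: field_simps)
  finally show ?thesis .
qed simp

text \<open>\<open>(1 - t\<^sup>2)\<^bsup>-n/2\<^esup> - 1\<close> for \<open>t > 0\<close>; its derivative vanishes at \<open>0\<close>, so the extension by \<open>0\<close> to negative
  arguments remains continuously differentiable.\<close>

definition L_profile :: "nat \<Rightarrow> real \<Rightarrow> real"
  where "L_profile n t = 1 / sqrt (1 - (max 0 t)\<^sup>2) ^ n - 1"

definition L_profile' :: "nat \<Rightarrow> real \<Rightarrow> real"
  where "L_profile' n t = real n * max 0 t / sqrt (1 - (max 0 t)\<^sup>2) ^ (n + 2)"

lemma max0_sq_less: "(t::real) \<in> {-1<..<1} \<Longrightarrow> (max 0 t)\<^sup>2 < 1"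
  by (auto simp: max_def abs_square_less_1)

lemma DERIV_L_profile:
  assumes "t \<in> {-1<..<1}"
  shows "(L_profile n has_real_derivative L_profile' n t) (at t)"
proof -
  have u: "((\<lambda>t. 1 - (max 0 t)\<^sup>2) has_real_derivative - (2 * max 0 t)) (at t)"
    using DERIV_diff[OF DERIV_const[of 1] DERIV_max0_square[of t]] by simp
  have "((\<lambda>t. 1 / sqrt (1 - (max 0 t)\<^sup>2) ^ n) has_real_derivative
      (- (real n / 2) / sqrt (1 - (max 0 t)\<^sup>2) ^ (n + 2)) * (- (2 * max 0 t))) (at t)"
    by (rule DERIV_chain2[OF DERIV_inverse_sqrt_power u]) (use max0_sq_less[OF assms] in simp)
  from DERIV_diff[OF this DERIV_const[of 1]] show ?thesis
    unfolding L_profile_def[abs_def] L_profile'_def by (simp add: mult_ac)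
qed

lemma continuous_L_profile': "continuous_on {-1<..<1} (L_profile' n)"
  unfolding L_profile'_def
  by (intro continuous_intros) (use max0_sq_less in force)

text \<open>The homogeneous equation \<open>h' (1 - t\<^sup>2) = n t h\<close> is solved by \<open>(1 - t\<^sup>2)\<^bsup>-n/2\<^esup>\<close>, and subtracting
  \<open>1\<close> produces the inhomogeneity \<open>n t\<close>.\<close>

lemma L_profile_eq:
  assumes "t \<in> {-1<..<1}"
  shows "L_profile' n t * (1 - t\<^sup>2) - real n * t * L_profile n t = real n * max 0 t"
proof (cases "t > 0")
  case True
  have "t\<^sup>2 < 1" using assms by (auto simp: abs_square_less_1)
  define w where "w = sqrt (1 - t\<^sup>2)"
  have w0: "w > 0" "1 - t\<^sup>2 = w\<^sup>2" using \<open>t\<^sup>2 < 1\<close> by (simp_all add: w_def)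
  have "L_profile' n t = real n * t / (w ^ n * w\<^sup>2)" "L_profile n t = 1 / w ^ n - 1"
    unfolding L_profile'_def L_profile_def max_absorb2[OF less_imp_le[OF True]] w_def[symmetric] power_add
    by (rule refl)+
  then show ?thesis using True w0(1) unfolding w0(2) by (simp add: right_diff_distrib max_def)
next
  case False
  then show ?thesis by (simp add: L_profile'_def L_profile_def max_def)
qed

text \<open>The odd solution of \<open>h' (1 - t\<^sup>2) - n t h = 1\<close>, by variation of constants; the numerator is
  \<open>\<integral>\<^sub>0\<^sup>t (1 - s\<^sup>2)\<^bsup>n/2-1\<^esup> ds\<close>, written through the substitution \<open>s = sin \<theta>\<close> to avoid half-integral powers.\<close>

definition A_profile :: "nat \<Rightarrow> real \<Rightarrow> real"
  where "A_profile n t = cos_power_integral (n - 1) (arcsin t) / sqrt (1 - t\<^sup>2) ^ n"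

definition A_profile' :: "nat \<Rightarrow> real \<Rightarrow> real"
  where "A_profile' n t = (1 + real n * t * A_profile n t) / (1 - t\<^sup>2)"

lemma DERIV_cos_power_integral_arcsin:
  assumes "t \<in> {-1<..<1}" "n \<ge> 2"
  shows "((\<lambda>t. cos_power_integral (n - 1) (arcsin t)) has_real_derivative sqrt (1 - t\<^sup>2) ^ (n - 2)) (at t)"
proof -
  have "t\<^sup>2 < 1" using assms by (auto simp: abs_square_less_1)
  then have w: "sqrt (1 - t\<^sup>2) > 0" by simp
  have "((\<lambda>t. cos_power_integral (n - 1) (arcsin t)) has_real_derivative
      cos (arcsin t) ^ (n - 1) * inverse (sqrt (1 - t\<^sup>2))) (at t)"
    by (rule DERIV_chain2[OF DERIV_cos_power_integral DERIV_arcsin]) (use assms in auto)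
  also have "cos (arcsin t) ^ (n - 1) * inverse (sqrt (1 - t\<^sup>2)) = sqrt (1 - t\<^sup>2) ^ (n - 2)"
  proof -
    have "n - 1 = Suc (n - 2)" using assms by simp
    then show ?thesis using assms w by (simp add: cos_arcsin)
  qed
  finally show ?thesis .
qed

lemma DERIV_A_profile:
  assumes t: "t \<in> {-1<..<1}" and n: "n \<ge> 2"
  shows "(A_profile n has_real_derivative A_profile' n t) (at t)"
proof -
  have "t\<^sup>2 < 1" using t by (auto simp: abs_square_less_1)
  then have w: "sqrt (1 - t\<^sup>2) > 0" "sqrt (1 - t\<^sup>2) ^ 2 = 1 - t\<^sup>2" by simp_all
  define w0 where "w0 = sqrt (1 - t\<^sup>2)"
  have u: "((\<lambda>t. 1 - t\<^sup>2) has_real_derivative - (2 * t)) (at t)"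
    by (auto intro!: derivative_eq_intros)
  have V: "((\<lambda>t. 1 / sqrt (1 - t\<^sup>2) ^ n) has_real_derivative (- (real n / 2) / w0 ^ (n + 2)) * (- (2 * t))) (at t)"
    unfolding w0_def by (rule DERIV_chain2[OF DERIV_inverse_sqrt_power u]) (use \<open>t\<^sup>2 < 1\<close> in simp)
  have "((\<lambda>t. cos_power_integral (n - 1) (arcsin t) * (1 / sqrt (1 - t\<^sup>2) ^ n)) has_real_derivative
      w0 ^ (n - 2) * (1 / w0 ^ n) + (- (real n / 2) / w0 ^ (n + 2)) * (- (2 * t)) * cos_power_integral (n - 1) (arcsin t)) (at t)"
    using DERIV_mult[OF DERIV_cos_power_integral_arcsin[OF t n] V] by (simp add: w0_def)
  moreover have "w0 ^ (n - 2) * (1 / w0 ^ n) + (- (real n / 2) / w0 ^ (n + 2)) * (- (2 * t)) * cos_power_integral (n - 1) (arcsin t)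
      = A_profile' n t"
  proof -
    obtain k where k: "n = k + 2" using n by (metis add.commute le_Suc_ex)
    have w0: "w0 > 0" "1 - t\<^sup>2 = w0\<^sup>2" using w by (simp_all add: w0_def)
    have A: "A_profile n t = cos_power_integral (n - 1) (arcsin t) / w0 ^ n" by (simp add: A_profile_def w0_def)
    show ?thesis
      unfolding A_profile'_def A w0(2) using w0(1) by (simp add: k power_add field_simps power2_eq_square)
  qed
  ultimately show ?thesis by (simp add: A_profile_def[abs_def])
qed

text \<open>\<open>\<integral>\<^sub>0\<^sup>1 (1 - s\<^sup>2)\<^bsup>n/2-1\<^esup> ds\<close>\<close>

definition half_integral :: "nat \<Rightarrow> real"
  where "half_integral n = cos_power_integral (n - 1) (pi / 2)"

lemma continuous_cos_power_integral: "continuous_on S (cos_power_integral k)"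
  by (meson DERIV_continuous DERIV_cos_power_integral continuous_at_imp_continuous_on)

text \<open>After division by \<open>t\<close> the two sides agree at \<open>t = 1\<close>, and their difference is monotone because
  \<open>t\<^sup>2 + t\<^sup>-\<^sup>2 \<ge> 2\<close>.\<close>

lemma tail_integral_bound:
  assumes t: "0 < t" "t < 1" and n: "n \<ge> 2"
  shows "real n * real (n + 2) * t * (half_integral n - cos_power_integral (n - 1) (arcsin t))
    \<le> sqrt (1 - t\<^sup>2) ^ n * (real n + 1 + t\<^sup>2)"
proof -
  define D where "D t = sqrt (1 - t\<^sup>2) ^ n * (real n + 1 + t\<^sup>2) / t
      - real n * real (n + 2) * (half_integral n - cos_power_integral (n - 1) (arcsin t))" for t
  have "D 1 \<le> D t"
  proof (rule DERIV_nonpos_imp_decreasing_open[OF less_imp_le[OF t(2)]])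
    show "continuous_on {t..1} D"
      unfolding D_def using t
      by (intro continuous_intros continuous_on_compose2[OF continuous_cos_power_integral[of UNIV]] continuous_on_arcsin') auto
    fix s assume s: "t < s" "s < 1"
    then have s0: "s > 0" "s\<^sup>2 < 1" "s \<in> {-1<..<1}" using t by (auto simp: abs_square_less_1)
    define w where "w = sqrt (1 - s\<^sup>2)"
    have w: "w > 0" "w\<^sup>2 = 1 - s\<^sup>2" using s0 by (simp_all add: w_def)
    obtain k where k: "n = k + 2" using n by (metis add.commute le_Suc_ex)
    have "((\<lambda>s. 1 - s\<^sup>2) has_real_derivative - (2 * s)) (at s)" by (auto intro!: derivative_eq_intros)
    from DERIV_real_sqrt[THEN DERIV_chain2, OF _ this]
    have "((\<lambda>s. sqrt (1 - s\<^sup>2)) has_real_derivative (inverse w / 2) * (- (2 * s))) (at s)"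
      using s0 by (simp add: w_def)
    from DERIV_power[OF this, of n]
    have dw: "((\<lambda>s. sqrt (1 - s\<^sup>2) ^ n) has_real_derivative - real n * s * w ^ k) (at s)"
      using w by (simp add: k w_def[symmetric] field_simps)
    have "((\<lambda>s. (real n + 1 + s\<^sup>2) / s) has_real_derivative 1 - (real n + 1) / s\<^sup>2) (at s)"
      using s0 by (auto intro!: derivative_eq_intros simp: field_simps power2_eq_square)
    from DERIV_mult[OF dw this]
    have d1: "((\<lambda>s. sqrt (1 - s\<^sup>2) ^ n * (real n + 1 + s\<^sup>2) / s) has_real_derivative
       (- real n * s * w ^ k) * ((real n + 1 + s\<^sup>2) / s) + (1 - (real n + 1) / s\<^sup>2) * w ^ n) (at s)"
      by (simp add: w_def)
    have d2: "((\<lambda>s. real n * real (n + 2) * (half_integral n - cos_power_integral (n - 1) (arcsin s))) has_real_derivative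
        - (real n * real (n + 2) * w ^ k)) (at s)"
      using DERIV_cos_power_integral_arcsin[OF s0(3) n] unfolding w_def
      by (auto intro!: derivative_eq_intros simp: k)
    have e1: "(- real n * s * w ^ k) * ((real n + 1 + s\<^sup>2) / s) = - real n * w ^ k * (real n + 1 + s\<^sup>2)"
      using s0(1) by simp
    have e2: "(1 - (real n + 1) / s\<^sup>2) * w ^ n = w ^ k * ((1 - (real n + 1) / s\<^sup>2) * (1 - s\<^sup>2))"
      unfolding k power_add w(2)[symmetric] by (simp only: mult_ac)
    have e3: "(1 - (real n + 1) / s\<^sup>2) * (1 - s\<^sup>2) = 1 - s\<^sup>2 - (real n + 1) * (1 / s\<^sup>2) + (real n + 1)"
      using s0(1) by (simp add: field_simps)
    have "(- real n * s * w ^ k) * ((real n + 1 + s\<^sup>2) / s) + (1 - (real n + 1) / s\<^sup>2) * w ^ n - (- (real n * real (n + 2) * w ^ k))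
        = w ^ k * (real n + 1) * (2 - s\<^sup>2 - 1 / s\<^sup>2)"
      unfolding e1 e2 e3 by (simp add: algebra_simps add_divide_distrib)
    moreover have "2 - s\<^sup>2 - 1 / s\<^sup>2 \<le> 0"
    proof -
      have "2 - s\<^sup>2 - 1 / s\<^sup>2 = - (s - 1 / s)\<^sup>2" using s0(1) by (simp add: power2_eq_square field_simps)
      then show ?thesis by simp
    qed
    then have "w ^ k * (real n + 1) * (2 - s\<^sup>2 - 1 / s\<^sup>2) \<le> 0" using w(1) by (intro mult_nonneg_nonpos) auto
    ultimately show "\<exists>y. (D has_real_derivative y) (at s) \<and> y \<le> 0"
      using DERIV_diff[OF d1 d2] unfolding D_def by (intro exI conjI) auto
  qed
  moreover have "D 1 = 0" using n by (simp add: D_def half_integral_def power_0_left)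
  ultimately have "D t \<ge> 0" by simp
  then show ?thesis using t unfolding D_def by (simp add: field_simps)
qed

text \<open>With this multiple of the even inhomogeneity \<open>|t|\<close> the singularities of \<open>A\<close> and \<open>L\<close> at \<open>t = \<plusminus> 1\<close>
  cancel and \<open>H\<close> stays bounded.\<close>

definition H_profile :: "nat \<Rightarrow> real \<Rightarrow> real"
  where "H_profile n t = A_profile n t - half_integral n * (L_profile n t - L_profile n (- t))"

definition H_profile' :: "nat \<Rightarrow> real \<Rightarrow> real"
  where "H_profile' n t = A_profile' n t - half_integral n * (L_profile' n t + L_profile' n (- t))"

lemma DERIV_H_profile:
  assumes t: "t \<in> {-1<..<1}" and n: "n \<ge> 2"
  shows "(H_profile n has_real_derivative H_profile' n t) (at t)"
proof -
  have "((\<lambda>t. L_profile n (- t)) has_real_derivative L_profile' n (- t) * (- 1)) (at t)"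
    by (rule DERIV_chain2[OF DERIV_L_profile]) (use t in \<open>auto intro!: derivative_eq_intros\<close>)
  from DERIV_diff[OF DERIV_A_profile[OF t n] DERIV_cmult[OF DERIV_diff[OF DERIV_L_profile[OF t] this], of "half_integral n"]]
  show ?thesis unfolding H_profile_def[abs_def] H_profile'_def by simp
qed

lemma continuous_H_profile':
  assumes n: "n \<ge> 2" shows "continuous_on {-1<..<1} (H_profile' n)"
proof -
  have "continuous_on {-1<..<1} (A_profile n)"
    by (meson DERIV_A_profile[OF _ n] DERIV_continuous continuous_at_imp_continuous_on)
  moreover have "continuous_on {-1<..<1} (\<lambda>t. L_profile' n (- t))"
    by (rule continuous_on_compose2[OF continuous_L_profile']) (auto intro!: continuous_intros)
  ultimately show ?thesis
    unfolding H_profile'_def A_profile'_def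
    by (intro continuous_intros continuous_L_profile') (auto simp: abs_square_less_1 power2_eq_1_iff)
qed

lemma H_profile_eq:
  assumes t: "t \<in> {-1<..<1}"
  shows "H_profile' n t * (1 - t\<^sup>2) - real n * t * H_profile n t = 1 - real n * half_integral n * \<bar>t\<bar>"
proof -
  have "t\<^sup>2 < 1" using t by (auto simp: abs_square_less_1)
  then have A: "A_profile' n t * (1 - t\<^sup>2) - real n * t * A_profile n t = 1"
    by (simp add: A_profile'_def)
  have L: "L_profile' n (- t) * (1 - t\<^sup>2) + real n * t * L_profile n (- t) = real n * max 0 (- t)"
    using L_profile_eq[of "- t" n] t by simp
  have "H_profile' n t * (1 - t\<^sup>2) - real n * t * H_profile n t =
      (A_profile' n t * (1 - t\<^sup>2) - real n * t * A_profile n t)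
      - half_integral n * ((L_profile' n t * (1 - t\<^sup>2) - real n * t * L_profile n t)
         + (L_profile' n (- t) * (1 - t\<^sup>2) + real n * t * L_profile n (- t)))"
    unfolding H_profile'_def H_profile_def by (simp add: algebra_simps)
  also have "\<dots> = 1 - half_integral n * (real n * max 0 t + real n * max 0 (- t))"
    unfolding A L L_profile_eq[OF t] ..
  also have "real n * max 0 t + real n * max 0 (- t) = real n * \<bar>t\<bar>" by (simp add: max_def)
  finally show ?thesis by (simp add: mult_ac)
qed

text \<open>The derivative is even, and for \<open>t > 0\<close> it equals \<open>(1 - n t J / w\<^sup>n) / w\<^sup>2\<close> with \<open>w\<^sup>2 = 1 - t\<^sup>2\<close> and the tail
  integral \<open>J\<close>.\<close>

lemma H_profile'_bound:
  assumes t: "t \<in> {-1<..<1}" and n: "n \<ge> 2"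
  shows "H_profile' n t \<ge> 1 / (real n + 2)"
proof -
  have pos: "H_profile' n s \<ge> 1 / (real n + 2)" if s: "0 \<le> s" "s < 1" for s
  proof (cases "s = 0")
    case True
    then show ?thesis using n by (simp add: H_profile'_def A_profile'_def A_profile_def L_profile'_def)
  next
    case False
    then have s': "0 < s" using s by simp
    have s2: "s\<^sup>2 < 1" using s by (auto simp: abs_square_less_1)
    define w where "w = sqrt (1 - s\<^sup>2)"
    have w: "w > 0" "w\<^sup>2 = 1 - s\<^sup>2" using s2 by (simp_all add: w_def)
    define J where "J = half_integral n - cos_power_integral (n - 1) (arcsin s)"
    have "H_profile' n s = (1 - real n * s * J / w ^ n) / w\<^sup>2"
    proof -
      have m: "max 0 s = s" "max 0 (- s) = 0" using s' by simp_all
      have "H_profile' n s = (1 + real n * s * (cos_power_integral (n - 1) (arcsin s) / w ^ n)) / w\<^sup>2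
          - half_integral n * (real n * s / (w ^ n * w\<^sup>2) + 0)"
        unfolding H_profile'_def A_profile'_def A_profile_def L_profile'_def m w_def[symmetric]
        unfolding w(2)[symmetric] power_add by simp
      also have "\<dots> = (1 - real n * s * J / w ^ n) / w\<^sup>2"
        unfolding J_def using w(1) by (simp add: field_simps)
      finally show ?thesis .
    qed
    moreover have "real n * s * J / w ^ n \<le> 1 - w\<^sup>2 / (real n + 2)"
    proof -
      have "real n * (real n + 2) * s * J \<le> w ^ n * (real n + 2 - w\<^sup>2)"
        using tail_integral_bound[OF s' s(2) n] by (simp add: J_def w_def[symmetric] w(2) algebra_simps)
      then show ?thesis using w(1) by (simp add: field_simps)
    qed
    then have "1 - real n * s * J / w ^ n \<ge> w\<^sup>2 / (real n + 2)" by simp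
    then have "(1 - real n * s * J / w ^ n) / w\<^sup>2 \<ge> w\<^sup>2 / (real n + 2) / w\<^sup>2"
      by (rule divide_right_mono) simp
    ultimately show ?thesis using w(1) by simp
  qed
  have "H_profile' n (- s) = H_profile' n s" if "\<bar>s\<bar> < 1" for s
    using that by (simp add: H_profile'_def A_profile'_def A_profile_def arcsin_minus cos_power_integral_minus)
  then have "H_profile' n t = H_profile' n \<bar>t\<bar>" using t by (cases "t \<ge> 0") (auto simp: abs_if)
  then show ?thesis using pos[of "\<bar>t\<bar>"] t by auto
qed

section \<open>Radial integrals\<close>

text \<open>Both measures give \<open>\<beta>\<^sub>n a\<^sup>n\<close> to the half-line up to \<open>a \<ge> 0\<close>.\<close>

lemma distr_norm_lborel:
  assumes n: "CARD('n::finite) \<ge> 2"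
  defines "\<beta> \<equiv> unit_ball_vol (real CARD('n))"
  shows "distr (lborel :: (real^'n) measure) borel norm =
    density lborel (\<lambda>r. ennreal (real CARD('n) * \<beta> * r ^ (CARD('n) - 1)) * indicator {0..} r)"
    (is "?L = ?R")
proof (rule measure_eqI_generator_eq[where E = "range (\<lambda>a. {..a::real})" and \<Omega> = UNIV and A = "\<lambda>i. {..real i}"])
  show "Int_stable (range (\<lambda>a. {..a::real}))" by (auto simp: Int_stable_def)
  have \<beta>: "\<beta> \<ge> 0" by (simp add: \<beta>_def)
  have Leq: "emeasure ?L {..a} = ennreal (\<beta> * max 0 a ^ CARD('n))" for a
  proof -
    have "norm -` {..a} = cball (0::real^'n) a" by auto
    then have "emeasure ?L {..a} = emeasure lborel (cball (0::real^'n) a)" by (simp add: emeasure_distr)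
    also have "\<dots> = ennreal (\<beta> * max 0 a ^ CARD('n))"
      using n by (cases "a \<ge> 0") (auto simp: emeasure_cball \<beta>_def max_def)
    finally show ?thesis .
  qed
  have Req: "emeasure ?R {..a} = ennreal (\<beta> * max 0 a ^ CARD('n))" for a
  proof -
    have "emeasure ?R {..a} = (\<integral>\<^sup>+r. ennreal (real CARD('n) * \<beta> * r ^ (CARD('n) - 1)) * indicator {0..max 0 a} r \<partial>lborel)"
      using n by (subst emeasure_density) (auto intro!: nn_integral_cong simp: indicator_def max_def power_0_left)
    also have "\<dots> = ennreal (\<beta> * max 0 a ^ CARD('n) - \<beta> * 0 ^ CARD('n))"
      using \<beta> n by (intro nn_integral_FTC_Icc)
        (auto intro!: derivative_eq_intros simp: has_real_derivative_iff_has_vector_derivative[symmetric])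
    finally show ?thesis using n by (simp add: power_0_left)
  qed
  show "emeasure ?L X = emeasure ?R X" if "X \<in> range (\<lambda>a. {..a::real})" for X
    using that Leq Req by auto
  show "sets ?L = sigma_sets UNIV (range (\<lambda>a. {..a::real}))" "sets ?R = sigma_sets UNIV (range (\<lambda>a. {..a::real}))"
    using arg_cong[OF borel_eq_atMost, of sets] by simp_all
  show "(\<Union>i. {..real i}) = UNIV" using real_arch_simple by auto
  show "emeasure ?L {..real i} \<noteq> \<infinity>" for i unfolding Leq by simp
qed auto

lemma nn_integral_radial:
  assumes n: "CARD('n::finite) \<ge> 2" and h[measurable]: "h \<in> borel_measurable borel"
  shows "(\<integral>\<^sup>+x. h (norm (x::real^'n)) \<partial>lborel) = (\<integral>\<^sup>+r.
     ennreal (real CARD('n) * unit_ball_vol (real CARD('n)) * r ^ (CARD('n) - 1)) * indicator {0..} r * h r \<partial>lborel)"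
proof -
  have "(\<integral>\<^sup>+x. h (norm (x::real^'n)) \<partial>lborel) = (\<integral>\<^sup>+r. h r \<partial>distr (lborel :: (real^'n) measure) borel norm)"
    by (rule nn_integral_distr[symmetric]) auto
  then show ?thesis unfolding distr_norm_lborel[OF n] by (simp add: nn_integral_density)
qed

text \<open>The radial integrand has the primitive \<open>\<beta>\<^sub>n (r / \<surd>(1 + r\<^sup>2))\<^sup>n\<close>.  This is the mass that concentrates at
  one preimage of \<open>p\<close>.\<close>

lemma nn_integral_bubble:
  assumes n: "CARD('n::finite) \<ge> 2"
  shows "(\<integral>\<^sup>+x. ennreal (1 / sqrt (1 + (norm (x::real^'n))\<^sup>2) ^ (CARD('n) + 2)) \<partial>lborel)
    = ennreal (unit_ball_vol (real CARD('n)))"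
proof -
  let ?n = "CARD('n)" and ?b = "unit_ball_vol (real CARD('n))"
  have q: "1 + r\<^sup>2 > 0" for r :: real by (simp add: add_pos_nonneg)
  have "(\<integral>\<^sup>+x. ennreal (1 / sqrt (1 + (norm (x::real^'n))\<^sup>2) ^ (?n + 2)) \<partial>lborel) =
     (\<integral>\<^sup>+r. ennreal (real ?n * ?b * r ^ (?n - 1)) * indicator {0..} r * ennreal (1 / sqrt (1 + r\<^sup>2) ^ (?n + 2)) \<partial>lborel)"
    by (rule nn_integral_radial[OF n]) measurable
  also have "\<dots> = (\<integral>\<^sup>+r. ennreal (real ?n * ?b * r ^ (?n - 1) / sqrt (1 + r\<^sup>2) ^ (?n + 2)) * indicator {0..} r \<partial>lborel)"
    by (intro nn_integral_cong) (auto simp: indicator_def ennreal_mult'[symmetric])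
  also have "\<dots> = ennreal (?b * 1 ^ ?n - ?b * (0 / sqrt (1 + 0\<^sup>2)) ^ ?n)"
  proof (rule nn_integral_FTC_atLeast)
    fix r :: real assume "0 \<le> r"
    show "0 \<le> real ?n * ?b * r ^ (?n - 1) / sqrt (1 + r\<^sup>2) ^ (?n + 2)" using \<open>0 \<le> r\<close> by simp
    define s where "s = sqrt (1 + r\<^sup>2)"
    have s: "s > 0" "s\<^sup>2 = 1 + r\<^sup>2" using q by (simp_all add: s_def)
    have "((\<lambda>r. r / sqrt (1 + r\<^sup>2)) has_real_derivative (s - r * (inverse s / 2 * (2 * r))) / (s * s)) (at r)"
      using q[of r] s unfolding s_def by (auto intro!: derivative_eq_intros)
    also have "(s - r * (inverse s / 2 * (2 * r))) / (s * s) = 1 / s ^ 3"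
    proof -
      have "(s - r * (inverse s / 2 * (2 * r))) / (s * s) = (s\<^sup>2 - r\<^sup>2) / s ^ 3"
        using s(1) by (simp add: field_simps power2_eq_square power3_eq_cube)
      then show ?thesis using s(2) by simp
    qed
    finally have d: "((\<lambda>r. r / sqrt (1 + r\<^sup>2)) has_real_derivative 1 / s ^ 3) (at r)" .
    have "((\<lambda>r. ?b * (r / sqrt (1 + r\<^sup>2)) ^ ?n) has_real_derivative ?b * (real ?n * (r / s) ^ (?n - 1) * (1 / s ^ 3))) (at r)"
      using DERIV_cmult[OF DERIV_power[OF d, of ?n], of ?b] by (simp add: s_def mult_ac)
    also have "?b * (real ?n * (r / s) ^ (?n - 1) * (1 / s ^ 3)) = real ?n * ?b * r ^ (?n - 1) / s ^ (?n + 2)"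
    proof -
      have "s ^ (?n + 2) = s ^ (?n - 1) * s ^ 3" using n by (simp flip: power_add)
      then show ?thesis by (simp add: power_divide)
    qed
    finally show "((\<lambda>r. ?b * (r / sqrt (1 + r\<^sup>2)) ^ ?n) has_real_derivative real ?n * ?b * r ^ (?n - 1) / sqrt (1 + r\<^sup>2) ^ (?n + 2)) (at r)"
      by (simp add: s_def)
  next
    have "((\<lambda>r::real. 1 / sqrt ((inverse r)\<^sup>2 + 1)) \<longlongrightarrow> 1 / sqrt (0\<^sup>2 + 1)) at_top"
      by (intro tendsto_intros tendsto_inverse_0_at_top filterlim_ident) simp
    moreover have "\<forall>\<^sub>F r::real in at_top. 1 / sqrt ((inverse r)\<^sup>2 + 1) = r / sqrt (1 + r\<^sup>2)"
    proof (rule eventually_mono[OF eventually_gt_at_top[of 0]])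
      fix r :: real assume r: "0 < r"
      have "sqrt (1 + r\<^sup>2) = sqrt (r\<^sup>2 * ((inverse r)\<^sup>2 + 1))" using r by (simp add: field_simps)
      also have "\<dots> = r * sqrt ((inverse r)\<^sup>2 + 1)" using r by (simp add: real_sqrt_mult)
      finally show "1 / sqrt ((inverse r)\<^sup>2 + 1) = r / sqrt (1 + r\<^sup>2)" using r by simp
    qed
    ultimately have "((\<lambda>r::real. r / sqrt (1 + r\<^sup>2)) \<longlongrightarrow> 1) at_top"
      by (auto intro: Lim_transform_eventually)
    then show "((\<lambda>r. ?b * (r / sqrt (1 + r\<^sup>2)) ^ ?n) \<longlongrightarrow> ?b * 1 ^ ?n) at_top"
      by (intro tendsto_intros)
  qed measurable
  finally show ?thesis using n by (simp add: power_0_left)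
qed

text \<open>With \<open>\<alpha> = 2 arctan r\<close> the radial integrand becomes \<open>n \<beta>\<^sub>n sin\<^bsup>n-1\<^esup> \<alpha> d\<alpha>\<close> on \<open>[0, \<pi>]\<close>; the shift by
  \<open>\<pi> / 2\<close> turns the sine into a cosine.\<close>

lemma nn_integral_stereographic_density:
  assumes n: "CARD('n::finite) \<ge> 2"
  shows "(\<integral>\<^sup>+x. ennreal ((2 / (1 + (norm (x::real^'n))\<^sup>2)) ^ CARD('n)) \<partial>lborel)
    = ennreal (2 * real CARD('n) * half_integral CARD('n) * unit_ball_vol (real CARD('n)))"
proof -
  let ?n = "CARD('n)" and ?b = "unit_ball_vol (real CARD('n))"
  have q: "1 + r\<^sup>2 > 0" for r :: real by (simp add: add_pos_nonneg)
  let ?F = "\<lambda>r. - (real ?n * ?b) * cos_power_integral (?n - 1) (pi / 2 - 2 * arctan r)"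
  let ?f = "\<lambda>r. real ?n * ?b * r ^ (?n - 1) * (2 / (1 + r\<^sup>2)) ^ ?n"
  have "(\<integral>\<^sup>+x. ennreal ((2 / (1 + (norm (x::real^'n))\<^sup>2)) ^ ?n) \<partial>lborel) =
     (\<integral>\<^sup>+r. ennreal (real ?n * ?b * r ^ (?n - 1)) * indicator {0..} r * ennreal ((2 / (1 + r\<^sup>2)) ^ ?n) \<partial>lborel)"
    by (rule nn_integral_radial[OF n]) measurable
  also have "\<dots> = (\<integral>\<^sup>+r. ennreal (?f r) * indicator {0..} r \<partial>lborel)"
    by (intro nn_integral_cong) (auto simp: indicator_def ennreal_mult'[symmetric])
  also have "\<dots> = ennreal (- (real ?n * ?b) * cos_power_integral (?n - 1) (pi / 2 - 2 * (pi / 2)) - ?F 0)"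
  proof (rule nn_integral_FTC_atLeast)
    fix r :: real assume r: "0 \<le> r"
    show "0 \<le> ?f r" using r by simp
    have "((\<lambda>r. pi / 2 - 2 * arctan r) has_real_derivative - (2 / (1 + r\<^sup>2))) (at r)"
      by (rule DERIV_cong[OF DERIV_diff[OF DERIV_const DERIV_cmult[OF DERIV_arctan]]]) (simp add: divide_inverse)
    from DERIV_cmult[OF DERIV_chain2[OF DERIV_cos_power_integral this], of "- (real ?n * ?b)" "?n - 1"]
    have "(?F has_real_derivative - (real ?n * ?b) * (cos (pi / 2 - 2 * arctan r) ^ (?n - 1) * (- (2 / (1 + r\<^sup>2))))) (at r)" .
    moreover have "cos (pi / 2 - 2 * arctan r) = r * (2 / (1 + r\<^sup>2))"
    proof -
      have "cos (pi / 2 - 2 * arctan r) = sin (2 * arctan r)" by (simp add: sin_cos_eq)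
      also have "\<dots> = 2 * (r / sqrt (1 + r\<^sup>2)) * (1 / sqrt (1 + r\<^sup>2))"
        by (simp add: sin_double sin_arctan cos_arctan)
      also have "\<dots> = r * (2 / (1 + r\<^sup>2))" using q[of r] by simp
      finally show ?thesis .
    qed
    moreover have "(r * (2 / (1 + r\<^sup>2))) ^ (?n - 1) * (2 / (1 + r\<^sup>2)) = r ^ (?n - 1) * (2 / (1 + r\<^sup>2)) ^ ?n"
    proof -
      have "x ^ ?n = x ^ (?n - 1) * x" for x :: real using n by (metis One_nat_def Suc_pred power_Suc2 zero_less_card_finite)
      then show ?thesis by (simp only: power_mult_distrib mult.assoc)
    qed
    then have "- (real ?n * ?b) * ((r * (2 / (1 + r\<^sup>2))) ^ (?n - 1) * (- (2 / (1 + r\<^sup>2)))) = ?f r"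
      by (metis (no_types, lifting) minus_mult_minus mult.assoc mult_minus_right)
    ultimately show "(?F has_real_derivative ?f r) (at r)" by (simp only:)
  next
    have "((\<lambda>r. pi / 2 - 2 * arctan r) \<longlongrightarrow> pi / 2 - 2 * (pi / 2)) at_top"
      by (intro tendsto_intros tendsto_arctan_at_top)
    moreover have "isCont (cos_power_integral (?n - 1)) x" for x
      using DERIV_cos_power_integral DERIV_isCont by blast
    ultimately have "((\<lambda>r. cos_power_integral (?n - 1) (pi / 2 - 2 * arctan r)) \<longlongrightarrow>
        cos_power_integral (?n - 1) (pi / 2 - 2 * (pi / 2))) at_top"
      using isCont_tendsto_compose by blast
    then show "(?F \<longlongrightarrow> - (real ?n * ?b) * cos_power_integral (?n - 1) (pi / 2 - 2 * (pi / 2))) at_top"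
      by (intro tendsto_intros)
  qed measurable
  also have "pi / 2 - 2 * (pi / 2) = - (pi / 2)" by simp
  finally show ?thesis by (simp add: cos_power_integral_minus half_integral_def mult_ac)
qed

section \<open>Letting the profiles become singular\<close>

lemma liminf_add_ge:
  fixes f g :: "nat \<Rightarrow> ennreal"
  shows "liminf f + liminf g \<le> liminf (\<lambda>k. f k + g k)"
proof -
  have "incseq (\<lambda>n. INF k\<in>{n..}. h k)" for h :: "nat \<Rightarrow> ennreal"
    by (auto simp: incseq_def intro!: INF_superset_mono)
  then have "liminf f + liminf g = (SUP n. (INF k\<in>{n..}. f k) + (INF k\<in>{n..}. g k))"
    unfolding liminf_SUP_INF by (subst ennreal_SUP_add) auto
  also have "\<dots> \<le> (SUP n. INF k\<in>{n..}. f k + g k)"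
    by (intro SUP_mono' INF_greatest add_mono INF_lower) auto
  finally show ?thesis unfolding liminf_SUP_INF .
qed

lemma sum_liminf_le:
  fixes f :: "'i \<Rightarrow> nat \<Rightarrow> ennreal"
  assumes "finite I"
  shows "(\<Sum>i\<in>I. liminf (f i)) \<le> liminf (\<lambda>k. \<Sum>i\<in>I. f i k)"
  using assms
proof (induction I)
  case (insert i I)
  have "(\<Sum>i\<in>insert i I. liminf (f i)) \<le> liminf (f i) + liminf (\<lambda>k. \<Sum>i\<in>I. f i k)"
    using insert by (simp add: add_left_mono)
  also have "\<dots> \<le> liminf (\<lambda>k. f i k + (\<Sum>i\<in>I. f i k))" by (rule liminf_add_ge)
  finally show ?case using insert by simp
qed simp

text \<open>Needed to add up the contributions of the individual preimages of \<open>p\<close>.\<close>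

lemma finite_disjoint_neighbourhoods:
  fixes S :: "'a::t2_space set"
  assumes "finite S"
  obtains T where "\<And>x. x \<in> S \<Longrightarrow> open (T x)" "\<And>x. x \<in> S \<Longrightarrow> x \<in> T x" "disjoint_family_on T S"
proof -
  have "\<exists>U W. open U \<and> open W \<and> x \<in> U \<and> y \<in> W \<and> U \<inter> W = {}" if "x \<noteq> y" for x y :: 'a
    using hausdorff[OF that] by blast
  then obtain U W where UW: "\<And>x y :: 'a. x \<noteq> y \<Longrightarrow> open (U x y) \<and> open (W x y) \<and> x \<in> U x y \<and> y \<in> W x y \<and> U x y \<inter> W x y = {}"
    by metis
  define T where "T x = (\<Inter>y\<in>S - {x}. U x y \<inter> W y x)" for x
  show ?thesis
  proof
    have "open (U x y \<inter> W y x) \<and> x \<in> U x y \<inter> W y x" if "y \<in> S - {x}" for x y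
      using UW[of x y] UW[of y x] that by auto
    then show "open (T x)" "x \<in> T x" if "x \<in> S" for x
      unfolding T_def using assms by (auto intro!: open_INT)
    show "disjoint_family_on T S"
      unfolding disjoint_family_on_def
    proof (intro ballI impI)
      fix x y assume xy: "x \<in> S" "y \<in> S" "x \<noteq> y"
      then have "T x \<subseteq> U x y" "T y \<subseteq> W x y" unfolding T_def by blast+
      then show "T x \<inter> T y = {}" using UW[OF xy(3)] by blast
    qed
  qed
qed

text \<open>A linear change of variables turns the ellipsoidal bubble into the round one.\<close>

lemma nn_integral_bubble_linear:
  fixes L :: "real^'n::finite \<Rightarrow> 'e::euclidean_space"
  assumes L: "linear L" "inj L" and n: "CARD('n) \<ge> 2"
  shows "(\<integral>\<^sup>+y. ennreal (sqrt (det (gram L)) / sqrt (1 + (norm (L y))\<^sup>2) ^ (CARD('n) + 2)) \<partial>lborel)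
    = ennreal (unit_ball_vol (real CARD('n)))"
proof -
  obtain B :: "real^'n^'n" where B: "det B \<noteq> 0" "\<And>x. norm (B *v x) = norm (L x)" "gram L = transpose B ** B"
    using square_matrix_with_same_gram[OF L] by metis
  have det: "sqrt (det (gram L)) = \<bar>det B\<bar>" using B(3) by (simp add: det_mul)
  have inj: "inj ((*v) B)" using B(1) by (subst det_nz_iff_inj[symmetric]) auto
  have surj: "range ((*v) B) = UNIV"
    by (rule linear_injective_imp_surjective[OF matrix_vector_mul_linear inj refl])
  let ?h = "\<lambda>z::real^'n. ennreal (1 / sqrt (1 + (norm z)\<^sup>2) ^ (CARD('n) + 2))"
  have "(\<integral>\<^sup>+z\<in>range ((*v) B). ?h z \<partial>lborel) = (\<integral>\<^sup>+y\<in>UNIV. ?h (B *v y) * ennreal \<bar>det (matrix ((*v) B))\<bar> \<partial>lborel)"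
    by (rule nn_integral_change_of_variables[where g' = "\<lambda>x. (*v) B"])
       (auto simp: inj surj intro!: bounded_linear_imp_has_derivative)
  moreover have "ennreal (sqrt (det (gram L)) / sqrt (1 + (norm (L y))\<^sup>2) ^ (CARD('n) + 2)) =
      ?h (B *v y) * ennreal \<bar>det (matrix ((*v) B))\<bar>" for y
    unfolding det B(2) matrix_of_matrix_vector_mul by (subst ennreal_mult'[symmetric]) auto
  ultimately show ?thesis using nn_integral_bubble[OF n] unfolding surj by simp
qed

context minimal_immersion
begin


text \<open>The profiles of interest are singular at \<open>t = 1\<close>; \<open>h(l t)\<close> with \<open>l < 1\<close> is regular on \<open>[-1, 1]\<close>.  The
  differential operator \<open>h' (1 - t\<^sup>2) - n t h\<close> then reappears at \<open>l t\<close>, up to the term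
  \<open>(1 - l\<^sup>2) h'\<close> that comes from \<open>l\<^sup>2 (1 - t\<^sup>2) = (1 - (l t)\<^sup>2) - (1 - l\<^sup>2)\<close>.\<close>

lemma dilated_profile:
  assumes l: "0 < l" "l < 1" and h: "\<And>t. t \<in> {-1<..<1} \<Longrightarrow> (h has_real_derivative h' t) (at t)"
    and h': "continuous_on {-1<..<1} h'"
  shows "(\<integral>x. (h' (l * height x) * (1 - (l * height x)\<^sup>2) - real CARD('n) * (l * height x) * h (l * height x))
      - h' (l * height x) * ((1 - l\<^sup>2) + l\<^sup>2 * normal_sq x) \<partial>vol) = 0"
proof -
  let ?U = "{-(1/l)<..<1/l}"
  have lU: "l * t \<in> {-1<..<1}" if "t \<in> ?U" for t using that l by (auto simp: field_simps)
  have "(\<integral>x. l * h' (l * height x) * (1 - (height x)\<^sup>2 - normal_sq x)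
    - real CARD('n) * height x * h (l * height x) \<partial>vol) = 0"
  proof (rule integral_profile[where U = ?U and h = "\<lambda>t. h (l * t)" and h' = "\<lambda>t. l * h' (l * t)"])
    have "1 < 1 / l" using l by simp
    then show "{-1..1} \<subseteq> ?U" by auto
    show "((\<lambda>t. h (l * t)) has_real_derivative l * h' (l * t)) (at t)" if "t \<in> ?U" for t
    proof -
      have "((\<lambda>t. l * t) has_real_derivative l) (at t)" by (auto intro!: derivative_eq_intros)
      from DERIV_chain2[where f = h and g = "\<lambda>t. l * t", OF h[OF lU[OF that]] this]
      show ?thesis by (simp add: mult.commute)
    qed
    show "continuous_on ?U (\<lambda>t. l * h' (l * t))"
      by (intro continuous_on_mult continuous_on_const continuous_on_compose2[OF h'] continuous_on_id) (use lU in auto)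
  qed
  then have "(\<integral>x. l * (l * h' (l * height x) * (1 - (height x)\<^sup>2 - normal_sq x)
    - real CARD('n) * height x * h (l * height x)) \<partial>vol) = 0" by simp
  then show ?thesis by (simp add: algebra_simps power2_eq_square)
qed

lemma dilated_height:
  assumes "0 < l" "l < 1" "x \<in> M" shows "l * height x \<in> {-1<..<1}"
proof -
  have "\<bar>l * height x\<bar> \<le> l * 1"
    unfolding abs_mult using assms height_bounds[OF assms(3)] by (intro mult_mono) auto
  then show ?thesis using assms by auto
qed

lemma dilated_continuous:
  assumes "0 < l" "l < 1" "continuous_on {-1<..<1} g"
  shows "continuous_on M (\<lambda>x. g (l * height x))"
  by (rule continuous_on_compose2[OF assms(3)])
     (use dilated_height[OF assms(1,2)] in \<open>auto intro!: continuous_intros height_continuous\<close>)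

lemma integral_height: "(\<integral>x. height x \<partial>vol) = 0"
proof -
  have "(\<integral>x. 0 * (1 - (height x)\<^sup>2 - normal_sq x) - real CARD('n) * height x * 1 \<partial>vol) = 0"
    by (rule integral_profile[where U = UNIV and h = "\<lambda>t. 1"]) auto
  then show ?thesis by simp
qed

definition dilation :: "nat \<Rightarrow> real" where "dilation k = 1 - 1 / real (k + 2)"

lemma dilation: "0 < dilation k" "dilation k < 1"
  by (simp_all add: dilation_def field_simps)

lemma dilation_tendsto: "dilation \<longlonglongrightarrow> 1"
proof -
  have "(\<lambda>k. 1 - inverse (real (Suc (Suc k)))) \<longlonglongrightarrow> 1 - 0"
    by (intro tendsto_diff tendsto_const LIMSEQ_Suc[OF LIMSEQ_inverse_real_of_nat])
  then show ?thesis by (simp add: dilation_def[abs_def] divide_inverse)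
qed

lemma integrable_height_terms:
  "integrable vol height" "integrable vol (\<lambda>x. \<bar>height x\<bar>)" "integrable vol (\<lambda>x. max 0 (height x))"
  "integrable vol normal_sq"
  by (intro continuous_integrable continuous_intros height_continuous normal_sq_continuous)+

text \<open>The profile \<open>H\<close> with its bound \<open>H' \<ge> 1 / (n + 2)\<close>.\<close>

lemma volume_lower_bound:
  assumes n: "CARD('n) \<ge> 2"
  shows "(\<integral>x. normal_sq x \<partial>vol) / (real CARD('n) + 2)
    \<le> measure vol M - real CARD('n) * half_integral CARD('n) * (\<integral>x. \<bar>height x\<bar> \<partial>vol)"
proof -
  define a where "a = measure vol M"
  define b where "b = (\<integral>x. \<bar>height x\<bar> \<partial>vol)"
  define s where "s = (\<integral>x. normal_sq x \<partial>vol)"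
  define c where "c = real CARD('n) * half_integral CARD('n)"
  have "((1 - l\<^sup>2) * a + l\<^sup>2 * s) / (real CARD('n) + 2) \<le> a - c * l * b" if l: "0 < l" "l < 1" for l
  proof -
    let ?W = "\<lambda>x. (1 - l\<^sup>2) + l\<^sup>2 * normal_sq x" and ?D = "\<lambda>x. H_profile' CARD('n) (l * height x)"
    have iD: "integrable vol (\<lambda>x. ?D x * ?W x)"
      by (intro continuous_integrable continuous_intros dilated_continuous[OF l continuous_H_profile'[OF n]] normal_sq_continuous)
    have "(\<integral>x. (?D x * (1 - (l * height x)\<^sup>2) - real CARD('n) * (l * height x) * H_profile CARD('n) (l * height x)) - ?D x * ?W x \<partial>vol) = 0"
      by (rule dilated_profile[OF l DERIV_H_profile continuous_H_profile']) (use n in auto)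
    also have "(\<integral>x. (?D x * (1 - (l * height x)\<^sup>2) - real CARD('n) * (l * height x) * H_profile CARD('n) (l * height x)) - ?D x * ?W x \<partial>vol)
       = (\<integral>x. (1 - c * l * \<bar>height x\<bar>) - ?D x * ?W x \<partial>vol)"
      using l by (intro Bochner_Integration.integral_cong refl)
        (simp add: H_profile_eq[OF dilated_height[OF l]] c_def abs_mult)
    finally have "(\<integral>x. 1 - c * l * \<bar>height x\<bar> \<partial>vol) = (\<integral>x. ?D x * ?W x \<partial>vol)"
      using iD integrable_height_terms by simp
    moreover have "(\<integral>x. 1 - c * l * \<bar>height x\<bar> \<partial>vol) = a - c * l * b"
      using integrable_height_terms by (simp add: a_def b_def)
    moreover have "(\<integral>x. 1 / (real CARD('n) + 2) * ?W x \<partial>vol) \<le> (\<integral>x. ?D x * ?W x \<partial>vol)"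
    proof (rule integral_mono[OF _ iD])
      show "integrable vol (\<lambda>x. 1 / (real CARD('n) + 2) * ?W x)" using integrable_height_terms by simp
      fix x assume "x \<in> space vol"
      then have x: "x \<in> M" by simp
      have "l\<^sup>2 \<le> 1" using l by (simp add: power_le_one)
      then show "1 / (real CARD('n) + 2) * ?W x \<le> ?D x * ?W x"
        using normal_sq_bounds[OF x] H_profile'_bound[OF dilated_height[OF l x] n]
        by (intro mult_right_mono) auto
    qed
    moreover have "(\<integral>x. 1 / (real CARD('n) + 2) * ?W x \<partial>vol) = ((1 - l\<^sup>2) * a + l\<^sup>2 * s) / (real CARD('n) + 2)"
      using integrable_height_terms by (simp add: a_def s_def field_simps)
    ultimately show ?thesis by simp
  qed
  then have "((1 - (dilation k)\<^sup>2) * a + (dilation k)\<^sup>2 * s) / (real CARD('n) + 2) \<le> a - c * dilation k * b" for k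
    using dilation by blast
  moreover have "(\<lambda>k. ((1 - (dilation k)\<^sup>2) * a + (dilation k)\<^sup>2 * s) / (real CARD('n) + 2)) \<longlonglongrightarrow> ((1 - 1\<^sup>2) * a + 1\<^sup>2 * s) / (real CARD('n) + 2)"
    by (intro tendsto_intros dilation_tendsto) simp
  moreover have "(\<lambda>k. a - c * dilation k * b) \<longlonglongrightarrow> a - c * 1 * b"
    by (intro tendsto_intros dilation_tendsto)
  ultimately have "((1 - 1\<^sup>2) * a + 1\<^sup>2 * s) / (real CARD('n) + 2) \<le> a - c * 1 * b"
    by (meson LIMSEQ_le)
  then show ?thesis by (simp add: a_def b_def s_def c_def)
qed

text \<open>The common factor \<open>K\<close> of the densities \<open>(1 - l\<^sup>2) K\<close> and \<open>l\<^sup>2 K |p\<^sup>\<bottom>|\<^sup>2\<close>, whose integrals add up to \<open>\<integral> \<phi>\<^sup>+\<close>.  The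
  first density concentrates at the preimages of \<open>p\<close>, the second one converges to the integrand of \<open>\<R>\<^sub>p\<close>.\<close>

definition kernel :: "nat \<Rightarrow> 'a \<Rightarrow> real"
  where "kernel k x = max 0 (height x) / sqrt (1 - (dilation k * max 0 (height x))\<^sup>2) ^ (CARD('n) + 2)"

lemma kernel_denom: "x \<in> M \<Longrightarrow> 1 - (dilation k * max 0 (height x))\<^sup>2 > 0"
  using dilated_height[OF dilation, of x k] dilation[of k]
  by (auto simp: max_def abs_square_less_1)

lemma kernel_nonneg: "x \<in> M \<Longrightarrow> kernel k x \<ge> 0"
  using kernel_denom[of x k] unfolding kernel_def by (intro divide_nonneg_nonneg) auto

lemma kernel_continuous: "continuous_on M (kernel k)"
proof -
  have "sqrt (1 - (dilation k * max 0 (height x))\<^sup>2) ^ (CARD('n) + 2) \<noteq> 0" if "x \<in> M" for x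
    using kernel_denom[OF that, of k] by simp
  then show ?thesis
    unfolding kernel_def by (intro continuous_intros height_continuous) blast
qed

text \<open>The profile \<open>L\<close>, divided by \<open>n l\<close>.\<close>

lemma nn_integral_kernel:
  assumes n: "CARD('n) \<ge> 2"
  shows "(\<integral>\<^sup>+x. ennreal ((1 - (dilation k)\<^sup>2) * kernel k x) \<partial>vol)
     + (\<integral>\<^sup>+x. ennreal ((dilation k)\<^sup>2 * kernel k x * normal_sq x) \<partial>vol)
    = ennreal (\<integral>x. max 0 (height x) \<partial>vol)"
proof -
  define l where "l = dilation k"
  have l: "0 < l" "l < 1" by (simp_all add: l_def dilation)
  let ?A = "\<lambda>x. (1 - l\<^sup>2) * kernel k x" and ?B = "\<lambda>x. l\<^sup>2 * kernel k x * normal_sq x"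
  have i: "integrable vol ?A" "integrable vol ?B"
    by (intro continuous_integrable continuous_intros kernel_continuous normal_sq_continuous)+
  have "l\<^sup>2 \<le> 1" using l by (simp add: power_le_one)
  then have nn: "0 \<le> ?A x" "0 \<le> ?B x" if "x \<in> M" for x
    using kernel_nonneg[OF that] normal_sq_bounds[OF that] by simp_all
  have "(\<integral>x. (L_profile' CARD('n) (l * height x) * (1 - (l * height x)\<^sup>2) - real CARD('n) * (l * height x) * L_profile CARD('n) (l * height x))
     - L_profile' CARD('n) (l * height x) * ((1 - l\<^sup>2) + l\<^sup>2 * normal_sq x) \<partial>vol) = 0"
    by (rule dilated_profile[OF l DERIV_L_profile continuous_L_profile'])
  also have "(\<integral>x. (L_profile' CARD('n) (l * height x) * (1 - (l * height x)\<^sup>2) - real CARD('n) * (l * height x) * L_profile CARD('n) (l * height x))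
     - L_profile' CARD('n) (l * height x) * ((1 - l\<^sup>2) + l\<^sup>2 * normal_sq x) \<partial>vol)
     = (\<integral>x. real CARD('n) * l * (max 0 (height x) - (?A x + ?B x)) \<partial>vol)"
  proof (intro Bochner_Integration.integral_cong refl)
    fix x assume "x \<in> space vol"
    then have x: "x \<in> M" by simp
    have m: "max 0 (l * height x) = l * max 0 (height x)" using l by (auto simp: max_def mult_le_0_iff zero_le_mult_iff)
    have "L_profile' CARD('n) (l * height x) = real CARD('n) * l * kernel k x"
      unfolding L_profile'_def m kernel_def l_def[symmetric] by simp
    then show "(L_profile' CARD('n) (l * height x) * (1 - (l * height x)\<^sup>2) - real CARD('n) * (l * height x) * L_profile CARD('n) (l * height x))
     - L_profile' CARD('n) (l * height x) * ((1 - l\<^sup>2) + l\<^sup>2 * normal_sq x) = real CARD('n) * l * (max 0 (height x) - (?A x + ?B x))"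
      unfolding L_profile_eq[OF dilated_height[OF l x]] m by (simp add: algebra_simps)
  qed
  finally have "(\<integral>x. max 0 (height x) \<partial>vol) = (\<integral>x. ?A x \<partial>vol) + (\<integral>x. ?B x \<partial>vol)"
    using i integrable_height_terms l by simp
  moreover have "(\<integral>\<^sup>+x. ennreal (?A x) \<partial>vol) = ennreal (\<integral>x. ?A x \<partial>vol)" "(\<integral>\<^sup>+x. ennreal (?B x) \<partial>vol) = ennreal (\<integral>x. ?B x \<partial>vol)"
    by (intro nn_integral_eq_integral i AE_I2; simp add: nn)+
  moreover have "0 \<le> (\<integral>x. ?A x \<partial>vol)" "0 \<le> (\<integral>x. ?B x \<partial>vol)"
    by (intro Bochner_Integration.integral_nonneg; simp add: nn)+
  ultimately show ?thesis by (simp add: l_def)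
qed

text \<open>Blowing up a chart at a preimage of \<open>p\<close> by the factor \<open>1 / \<epsilon>\<close> with \<open>\<epsilon>\<^sup>2 = 1 - l\<^sup>2\<close>.\<close>

lemma kernel_concentration:
  assumes n: "CARD('n) \<ge> 2" and x0: "x0 \<in> M" "f x0 = p" and T: "open T" "x0 \<in> T"
  shows "ennreal (unit_ball_vol (real CARD('n)))
    \<le> liminf (\<lambda>k. \<integral>\<^sup>+x\<in>M \<inter> T. ennreal ((1 - (dilation k)\<^sup>2) * kernel k x) \<partial>vol)"
proof -
  obtain V \<psi> u0 where c: "(V, \<psi>) \<in> A" "u0 \<in> V" "\<psi> u0 = x0" using charts_cover x0 by blast
  define W where "W = V \<inter> \<psi> -` (M \<inter> T)"
  have op: "open W" unfolding W_def by (rule chart_vimage_open[OF c(1)]) (use T in auto)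
  have u0W: "u0 \<in> W" using c T x0 by (simp add: W_def)
  have MT: "M \<inter> T \<in> sets borel_M" by (rule openin_sets) (use T in auto)
  let ?L = "DF \<psi> u0"
  define e where "e k = sqrt (1 - (dilation k)\<^sup>2)" for k
  have e: "e k > 0" "(e k)\<^sup>2 = 1 - (dilation k)\<^sup>2" for k
    using dilation[of k] by (simp_all add: e_def abs_square_less_1 power_le_one)
  have el: "e \<longlonglongrightarrow> 0"
  proof -
    have "(\<lambda>k. sqrt (1 - (dilation k)\<^sup>2)) \<longlonglongrightarrow> sqrt (1 - 1\<^sup>2)"
      by (intro tendsto_intros dilation_tendsto)
    then show ?thesis by (simp add: e_def[abs_def])
  qed
  define g where "g k u = indicator W u * (volume_density \<psi> u * ((1 - (dilation k)\<^sup>2) * kernel k (\<psi> u)))" for k u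
  have gm[measurable]: "g k \<in> borel_measurable borel" for k
  proof -
    have "continuous_on W (\<lambda>u. volume_density \<psi> u * ((1 - (dilation k)\<^sup>2) * kernel k (\<psi> u)))"
    proof (intro continuous_on_mult continuous_on_const)
      show "continuous_on W (volume_density \<psi>)"
        by (rule continuous_on_subset[OF C1_on_continuous[OF volume_density_C1[OF c(1)]]]) (auto simp: W_def)
      show "continuous_on W (\<lambda>u. kernel k (\<psi> u))"
        by (rule continuous_on_compose2[OF kernel_continuous continuous_on_subset[OF chart_continuous[OF c(1)]]])
           (auto simp: W_def)
    qed
    from borel_measurable_continuous_on_indicator[OF _ this] op show ?thesis
      unfolding g_def[abs_def] by simp
  qed
  have chart: "(\<integral>\<^sup>+u. ennreal (g k u) \<partial>lborel) \<le> (\<integral>\<^sup>+x\<in>M \<inter> T. ennreal ((1 - (dilation k)\<^sup>2) * kernel k x) \<partial>vol)" for k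
  proof -
    let ?h = "\<lambda>x. ennreal ((1 - (dilation k)\<^sup>2) * kernel k x) * indicator (M \<inter> T) x"
    have hm: "?h \<in> borel_measurable borel_M"
    proof -
      have "(\<lambda>x. (1 - (dilation k)\<^sup>2) * kernel k x) \<in> borel_measurable borel_M"
        by (rule borel_measurable_continuous_on_restrict) (intro continuous_intros kernel_continuous)
      then show ?thesis using MT by measurable
    qed
    have "(\<integral>\<^sup>+u. ennreal (g k u) \<partial>lborel) = (\<integral>\<^sup>+u\<in>V. ennreal (volume_density \<psi> u) * ?h (\<psi> u) \<partial>lborel)"
    proof (rule nn_integral_cong)
      fix u
      show "ennreal (g k u) = ennreal (volume_density \<psi> u) * ?h (\<psi> u) * indicator V u"
      proof (cases "u \<in> V")
        case True
        then show ?thesis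
          using volume_density_pos[OF c(1) True]
          by (auto simp: g_def W_def indicator_def ennreal_mult' less_imp_le)
      qed (simp add: g_def W_def)
    qed
    also have "\<dots> = (\<integral>\<^sup>+x\<in>\<psi> ` V. ?h x \<partial>vol)" by (rule nn_integral_vol_chart[OF c(1) hm, symmetric])
    also have "\<dots> \<le> (\<integral>\<^sup>+x. ?h x \<partial>vol)" by (intro nn_integral_mono) (auto simp: indicator_def)
    finally show ?thesis .
  qed
  have scale: "(\<integral>\<^sup>+u. ennreal (g k u) \<partial>lborel) = (\<integral>\<^sup>+y. ennreal (e k ^ CARD('n) * g k (u0 + e k *\<^sub>R y)) \<partial>lborel)" for k
  proof -
    have "e k \<noteq> 0" using e(1)[of k] by simp
    from lborel_affine[OF this, of u0]
    have "(\<integral>\<^sup>+u. ennreal (g k u) \<partial>lborel) =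
        (\<integral>\<^sup>+u. ennreal (g k u) \<partial>density (distr lborel borel (\<lambda>y::real^'n. u0 + e k *\<^sub>R y)) (\<lambda>_. \<bar>e k\<bar> ^ DIM(real^'n)))"
      by simp
    also have "\<dots> = (\<integral>\<^sup>+y. ennreal (e k ^ CARD('n)) * ennreal (g k (u0 + e k *\<^sub>R y)) \<partial>lborel)"
      using e(1)[of k] by (simp add: nn_integral_density nn_integral_distr)
    finally show ?thesis using e(1)[of k] by (simp add: ennreal_mult')
  qed
  have lim: "(\<lambda>k. e k ^ CARD('n) * g k (u0 + e k *\<^sub>R y)) \<longlonglongrightarrow>
     volume_density \<psi> u0 / sqrt (1 + (norm (?L y))\<^sup>2) ^ (CARD('n) + 2)" for y
  proof -
    define u where "u k = u0 + e k *\<^sub>R y" for k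
    have ul: "u \<longlonglongrightarrow> u0" 
    proof -
      have "(\<lambda>k. u0 + e k *\<^sub>R y) \<longlonglongrightarrow> u0 + 0 *\<^sub>R y" by (intro tendsto_intros el)
      then show ?thesis by (simp add: u_def[abs_def])
    qed
    have ev: "\<forall>\<^sub>F k in sequentially. u k \<in> W" using topological_tendstoD[OF ul op u0W] .
    have dens: "(\<lambda>k. volume_density \<psi> (u k)) \<longlonglongrightarrow> volume_density \<psi> u0"
      using C1_on_continuous[OF volume_density_C1[OF c(1)]] chart_open[OF c(1)] c(2)
      by (intro isCont_tendsto_compose[OF _ ul]) (simp add: continuous_on_eq_continuous_at)
    have Fl: "(\<lambda>k. (f \<circ> \<psi>) (u k)) \<longlonglongrightarrow> p"
    proof -
      have "isCont (f \<circ> \<psi>) u0"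
        using C1_on_continuous[OF chart_C1[OF c(1)]] c(2)
        unfolding continuous_on_eq_continuous_at[OF chart_open[OF c(1)]] by blast
      from isCont_tendsto_compose[OF this ul] show ?thesis using c(3) x0 by simp
    qed
    have hl: "(\<lambda>k. height (\<psi> (u k))) \<longlonglongrightarrow> 1"
    proof -
      have "(\<lambda>k. (f \<circ> \<psi>) (u k) \<bullet> p) \<longlonglongrightarrow> p \<bullet> p" by (intro tendsto_intros Fl)
      then show ?thesis using norm_p by (simp add: height_def norm_eq_sqrt_inner)
    qed
    have pos: "\<forall>\<^sub>F k in sequentially. height (\<psi> (u k)) > 0" using order_tendstoD(1)[OF hl, of 0] by simp
    have quot: "(\<lambda>k. ((f \<circ> \<psi>) (u k) - p) /\<^sub>R e k) \<longlonglongrightarrow> ?L y"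
    proof -
      have "((\<lambda>s. (f \<circ> \<psi>) (u0 + s *\<^sub>R y)) has_derivative (\<lambda>s. ?L (s *\<^sub>R y))) (at 0)"
        by (rule has_derivative_compose[of "\<lambda>s. u0 + s *\<^sub>R y" "\<lambda>s. s *\<^sub>R y" 0 UNIV "f \<circ> \<psi>" ?L])
           (use C1_on_has_derivative[OF chart_C1[OF c(1)] c(2)] in \<open>auto intro!: derivative_eq_intros\<close>)
      then have "(\<lambda>h. norm ((f \<circ> \<psi>) (u0 + (0 + h) *\<^sub>R y) - (f \<circ> \<psi>) (u0 + 0 *\<^sub>R y) - ?L (h *\<^sub>R y)) / norm h) \<midarrow>0\<rightarrow> 0"
        unfolding has_derivative_at by blast
      then have "(\<lambda>h. norm ((f \<circ> \<psi>) (u0 + h *\<^sub>R y) - p - h *\<^sub>R ?L y) / norm h) \<midarrow>0\<rightarrow> 0"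
        using c(3) x0 linear_scale[OF chart_DF_linear[OF c(1,2)]] by simp
      moreover have "filterlim e (at 0) sequentially" using el e(1) by (auto simp: filterlim_at less_imp_neq[symmetric])
      ultimately have "(\<lambda>k. norm ((f \<circ> \<psi>) (u k) - p - e k *\<^sub>R ?L y) / norm (e k)) \<longlonglongrightarrow> 0"
        unfolding u_def by (rule filterlim_compose)
      moreover have "norm ((f \<circ> \<psi>) (u k) - p - e k *\<^sub>R ?L y) / norm (e k) = norm (((f \<circ> \<psi>) (u k) - p) /\<^sub>R e k - ?L y)" for k
      proof -
        have "((f \<circ> \<psi>) (u k) - p) /\<^sub>R e k - ?L y = ((f \<circ> \<psi>) (u k) - p - e k *\<^sub>R ?L y) /\<^sub>R e k"
          using e(1)[of k] by (simp add: scaleR_diff_right)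
        then show ?thesis by (simp add: divide_inverse mult.commute)
      qed
      ultimately have "(\<lambda>k. norm (((f \<circ> \<psi>) (u k) - p) /\<^sub>R e k - ?L y)) \<longlonglongrightarrow> 0" by (simp only:)
      then show ?thesis by (rule LIM_zero_cancel[OF tendsto_norm_zero_cancel])
    qed
    \<comment> \<open>\<open>d = (1 - (l \<phi>)\<^sup>2) / \<epsilon>\<^sup>2\<close>, rewritten with \<open>1 - \<phi> = |f - p|\<^sup>2 / 2\<close> so that its limit is visible\<close>
    define d where "d k = ((1 + height (\<psi> (u k))) / 2) * (norm (((f \<circ> \<psi>) (u k) - p) /\<^sub>R e k))\<^sup>2 + (height (\<psi> (u k)))\<^sup>2" for k
    have dl: "d \<longlonglongrightarrow> ((1 + 1) / 2) * (norm (?L y))\<^sup>2 + 1\<^sup>2"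
      unfolding d_def by (intro tendsto_intros hl quot) simp
    have "(\<lambda>k. volume_density \<psi> (u k) * height (\<psi> (u k)) / sqrt (d k) ^ (CARD('n) + 2)) \<longlonglongrightarrow>
       volume_density \<psi> u0 * 1 / sqrt (((1 + 1) / 2) * (norm (?L y))\<^sup>2 + 1\<^sup>2) ^ (CARD('n) + 2)"
      by (intro tendsto_intros dens hl dl) (simp add: add_nonneg_eq_0_iff)
    moreover have "\<forall>\<^sub>F k in sequentially. volume_density \<psi> (u k) * height (\<psi> (u k)) / sqrt (d k) ^ (CARD('n) + 2) = e k ^ CARD('n) * g k (u0 + e k *\<^sub>R y)"
      using ev pos
    proof eventually_elim
      case (elim k)
      define t where "t = height (\<psi> (u k))"
      have t: "t > 0" using elim by (simp add: t_def)
      have uM: "\<psi> (u k) \<in> M" using elim by (simp add: W_def)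
      have "(norm (f (\<psi> (u k)) - p))\<^sup>2 = 2 - 2 * t"
        using f_norm[OF uM] norm_p unfolding power2_norm_eq_inner t_def height_def
        by (simp add: inner_diff_left inner_diff_right inner_commute norm_eq_sqrt_inner)
      then have ns: "(norm (((f \<circ> \<psi>) (u k) - p) /\<^sub>R e k))\<^sup>2 = (2 - 2 * t) / (e k)\<^sup>2"
        by (simp add: power_mult_distrib power_inverse divide_inverse mult.commute)
      have "(1 + t) / 2 * ((2 - 2 * t) / (e k)\<^sup>2) = (1 - t\<^sup>2) / (e k)\<^sup>2"
      proof -
        have "(1 + t) / 2 * (2 - 2 * t) = 1 - t\<^sup>2" by (simp add: power2_eq_square field_simps)
        then show ?thesis by (simp only: times_divide_eq_right)
      qed
      then have "d k = (1 - t\<^sup>2) / (e k)\<^sup>2 + t\<^sup>2"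
        unfolding d_def t_def[symmetric] ns by (simp only:)
      also have "\<dots> = (1 - (dilation k * t)\<^sup>2) / (e k)\<^sup>2"
      proof -
        have split: "1 - (dilation k * t)\<^sup>2 = (1 - t\<^sup>2) + (e k)\<^sup>2 * t\<^sup>2" unfolding e(2) by (simp add: power_mult_distrib algebra_simps)
        show ?thesis unfolding split using e(1)[of k] by (simp add: add_divide_distrib)
      qed
      finally have "sqrt (d k) = sqrt (1 - (dilation k * t)\<^sup>2) / e k" using e(1)[of k] by (simp add: real_sqrt_divide)
      then have "volume_density \<psi> (u k) * t / sqrt (d k) ^ (CARD('n) + 2) =
         e k ^ CARD('n) * (volume_density \<psi> (u k) * ((e k)\<^sup>2 * (t / sqrt (1 - (dilation k * t)\<^sup>2) ^ (CARD('n) + 2))))"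
        by (simp add: power_divide power_add power2_eq_square[of "e k"])
      then show ?case
        using elim t unfolding g_def kernel_def u_def[symmetric] e(2) t_def[symmetric] by simp
    qed
    ultimately show ?thesis by (auto intro: Lim_transform_eventually simp: add.commute)
  qed
  have "ennreal (unit_ball_vol (real CARD('n))) =
     (\<integral>\<^sup>+y. ennreal (volume_density \<psi> u0 / sqrt (1 + (norm (?L y))\<^sup>2) ^ (CARD('n) + 2)) \<partial>lborel)"
    unfolding volume_density_def metric_matrix_gram
    by (rule nn_integral_bubble_linear[symmetric, OF chart_DF_linear[OF c(1,2)] chart_DF_inj[OF c(1,2)] n])
  also have "\<dots> = (\<integral>\<^sup>+y. liminf (\<lambda>k. ennreal (e k ^ CARD('n) * g k (u0 + e k *\<^sub>R y))) \<partial>lborel)"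
    by (intro nn_integral_cong lim_imp_Liminf[symmetric] tendsto_ennrealI lim) simp
  also have "\<dots> \<le> liminf (\<lambda>k. \<integral>\<^sup>+y. ennreal (e k ^ CARD('n) * g k (u0 + e k *\<^sub>R y)) \<partial>lborel)"
    by (rule nn_integral_liminf) measurable
  also have "\<dots> \<le> liminf (\<lambda>k. \<integral>\<^sup>+x\<in>M \<inter> T. ennreal ((1 - (dilation k)\<^sup>2) * kernel k x) \<partial>vol)"
    by (intro Liminf_mono always_eventually allI) (use chart scale in simp)
  finally show ?thesis .
qed

text \<open>At points where \<open>\<phi> = \<plusminus> 1\<close> both sides vanish, because there \<open>p\<^sup>\<bottom> = 0\<close>.\<close>

lemma R_integrand_eq:
  assumes "x \<in> M"
  shows "R_integrand A f p x = height x * normal_sq x / sqrt (1 - (height x)\<^sup>2) ^ (CARD('n) + 2)"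
proof (cases "(height x)\<^sup>2 < 1")
  case True
  have "(1 - (height x)\<^sup>2) powr (real CARD('n) / 2 + 1) = ((1 - (height x)\<^sup>2) powr (1 / 2)) powr (real (CARD('n) + 2))"
    by (simp add: powr_powr add_divide_distrib add.commute)
  also have "\<dots> = sqrt (1 - (height x)\<^sup>2) ^ (CARD('n) + 2)"
    using True by (subst powr_realpow) (auto simp: powr_half_sqrt)
  finally show ?thesis by (simp add: R_integrand_def height_def normal_sq_def)
next
  case False
  then have "normal_sq x = 0" using normal_sq_bounds[OF assms] by linarith
  then show ?thesis by (simp add: R_integrand_def normal_sq_def)
qed

lemma set_R_integrand_measurable:
  "(\<lambda>x. indicator {x \<in> M. height x > 0} x *\<^sub>R R_integrand A f p x) \<in> borel_measurable vol"
proof -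
  have [measurable]: "height \<in> borel_measurable vol" "normal_sq \<in> borel_measurable vol"
    by (intro continuous_measurable height_continuous normal_sq_continuous)+
  have "{x \<in> M. height x > 0} = {x \<in> space vol. height x > 0}" by simp
  also have "\<dots> \<in> sets vol" by measurable
  finally have S[measurable]: "{x \<in> M. height x > 0} \<in> sets vol" .
  have "(\<lambda>x. indicator {x \<in> M. height x > 0} x *\<^sub>R (height x * normal_sq x / sqrt (1 - (height x)\<^sup>2) ^ (CARD('n) + 2))) \<in> borel_measurable vol"
    by measurable
  then show ?thesis by (rule measurable_cong[THEN iffD1, rotated]) (simp add: R_integrand_eq)
qed

text \<open>The monotonicity formula as an inequality: Fatou's lemma for each of the two densities.\<close>

theorem positive_part_bound:
  assumes n: "CARD('n) \<ge> 2" and F: "finite F" "F \<subseteq> {x \<in> M. f x = p}"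
  shows "of_nat (card F) * ennreal (unit_ball_vol (real CARD('n)))
      + (\<integral>\<^sup>+x. ennreal (indicator {x \<in> M. height x > 0} x *\<^sub>R R_integrand A f p x) \<partial>vol)
    \<le> ennreal (\<integral>x. max 0 (height x) \<partial>vol)"
proof -
  let ?a = "\<lambda>k x. ennreal ((1 - (dilation k)\<^sup>2) * kernel k x)"
  let ?b = "\<lambda>k x. ennreal ((dilation k)\<^sup>2 * kernel k x * normal_sq x)"
  have am: "?a k \<in> borel_measurable vol" for k
  proof -
    have "(\<lambda>x. (1 - (dilation k)\<^sup>2) * kernel k x) \<in> borel_measurable vol"
      by (intro continuous_measurable continuous_intros kernel_continuous)
    then show ?thesis by simp
  qed
  have bm: "?b k \<in> borel_measurable vol" for k
  proof -
    have "(\<lambda>x. (dilation k)\<^sup>2 * kernel k x * normal_sq x) \<in> borel_measurable vol"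
      by (intro continuous_measurable continuous_intros kernel_continuous normal_sq_continuous)
    then show ?thesis by simp
  qed
  obtain T where T: "\<And>x. x \<in> F \<Longrightarrow> open (T x)" "\<And>x. x \<in> F \<Longrightarrow> x \<in> T x" "disjoint_family_on T F"
    using finite_disjoint_neighbourhoods[OF F(1)] by metis
  have "of_nat (card F) * ennreal (unit_ball_vol (real CARD('n))) = (\<Sum>x\<in>F. ennreal (unit_ball_vol (real CARD('n))))" by simp
  also have "\<dots> \<le> (\<Sum>x\<in>F. liminf (\<lambda>k. \<integral>\<^sup>+y\<in>M \<inter> T x. ?a k y \<partial>vol))"
    by (rule sum_mono, rule kernel_concentration[OF n]) (use F T in auto)
  also have "\<dots> \<le> liminf (\<lambda>k. \<Sum>x\<in>F. \<integral>\<^sup>+y\<in>M \<inter> T x. ?a k y \<partial>vol)"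
    by (rule sum_liminf_le[OF F(1)])
  also have "\<dots> \<le> liminf (\<lambda>k. \<integral>\<^sup>+y. ?a k y \<partial>vol)"
  proof (intro Liminf_mono always_eventually allI)
    fix k
    have MT: "M \<inter> T x \<in> sets vol" if "x \<in> F" for x using openin_sets[of "M \<inter> T x"] T(1)[OF that] by auto
    have "(\<Sum>x\<in>F. \<integral>\<^sup>+y\<in>M \<inter> T x. ?a k y \<partial>vol) = (\<integral>\<^sup>+y. (\<Sum>x\<in>F. ?a k y * indicator (M \<inter> T x) y) \<partial>vol)"
      by (rule nn_integral_sum[symmetric]) (use am MT in \<open>auto intro!: borel_measurable_times_ennreal borel_measurable_indicator simp del: sets_vol\<close>)
    also have "\<dots> \<le> (\<integral>\<^sup>+y. ?a k y \<partial>vol)"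
    proof (rule nn_integral_mono)
      fix y
      have "(\<Sum>x\<in>F. indicator (M \<inter> T x) y) = (indicator (\<Union>x\<in>F. M \<inter> T x) y :: ennreal)"
        by (rule indicator_UN_disjoint[OF F(1), symmetric]) (use T(3) in \<open>auto simp: disjoint_family_on_def\<close>)
      then show "(\<Sum>x\<in>F. ?a k y * indicator (M \<inter> T x) y) \<le> ?a k y"
        unfolding sum_distrib_left[symmetric] by (simp add: indicator_def)
    qed
    finally show "(\<Sum>x\<in>F. \<integral>\<^sup>+y\<in>M \<inter> T x. ?a k y \<partial>vol) \<le> (\<integral>\<^sup>+y. ?a k y \<partial>vol)" .
  qed
  finally have 1: "of_nat (card F) * ennreal (unit_ball_vol (real CARD('n))) \<le> liminf (\<lambda>k. \<integral>\<^sup>+y. ?a k y \<partial>vol)" .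
  have "(\<integral>\<^sup>+x. ennreal (indicator {x \<in> M. height x > 0} x *\<^sub>R R_integrand A f p x) \<partial>vol) = (\<integral>\<^sup>+x. liminf (\<lambda>k. ?b k x) \<partial>vol)"
  proof (rule nn_integral_cong)
    fix x assume "x \<in> space vol"
    then have x: "x \<in> M" by simp
    define t where "t = max 0 (height x)"
    have lim: "(\<lambda>k. (dilation k)\<^sup>2 * kernel k x * normal_sq x) \<longlonglongrightarrow> indicator {x \<in> M. height x > 0} x *\<^sub>R R_integrand A f p x"
    proof (cases "normal_sq x = 0")
      case True
      then show ?thesis by (simp add: R_integrand_eq[OF x])
    next
      case False
      then have "(height x)\<^sup>2 < 1" using normal_sq_bounds[OF x] by simp
      then have t1: "t\<^sup>2 < 1" by (auto simp: t_def max_def)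
      have "(\<lambda>k. (dilation k)\<^sup>2 * (t / sqrt (1 - (dilation k * t)\<^sup>2) ^ (CARD('n) + 2)) * normal_sq x)
          \<longlonglongrightarrow> 1\<^sup>2 * (t / sqrt (1 - (1 * t)\<^sup>2) ^ (CARD('n) + 2)) * normal_sq x"
        by (intro tendsto_intros dilation_tendsto) (use t1 in auto)
      moreover have "1\<^sup>2 * (t / sqrt (1 - (1 * t)\<^sup>2) ^ (CARD('n) + 2)) * normal_sq x = indicator {x \<in> M. height x > 0} x *\<^sub>R R_integrand A f p x"
        using x by (auto simp: R_integrand_eq t_def max_def indicator_def)
      ultimately show ?thesis by (simp add: kernel_def t_def)
    qed
    show "ennreal (indicator {x \<in> M. height x > 0} x *\<^sub>R R_integrand A f p x) = liminf (\<lambda>k. ?b k x)"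
      by (rule lim_imp_Liminf[symmetric, OF _ tendsto_ennrealI[OF lim]]) simp
  qed
  also have "\<dots> \<le> liminf (\<lambda>k. \<integral>\<^sup>+x. ?b k x \<partial>vol)" by (rule nn_integral_liminf[OF bm])
  finally have 2: "(\<integral>\<^sup>+x. ennreal (indicator {x \<in> M. height x > 0} x *\<^sub>R R_integrand A f p x) \<partial>vol) \<le> liminf (\<lambda>k. \<integral>\<^sup>+x. ?b k x \<partial>vol)" .
  have "of_nat (card F) * ennreal (unit_ball_vol (real CARD('n)))
      + (\<integral>\<^sup>+x. ennreal (indicator {x \<in> M. height x > 0} x *\<^sub>R R_integrand A f p x) \<partial>vol)
     \<le> liminf (\<lambda>k. \<integral>\<^sup>+y. ?a k y \<partial>vol) + liminf (\<lambda>k. \<integral>\<^sup>+x. ?b k x \<partial>vol)"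
    by (rule add_mono[OF 1 2])
  also have "\<dots> \<le> liminf (\<lambda>k. (\<integral>\<^sup>+y. ?a k y \<partial>vol) + (\<integral>\<^sup>+x. ?b k x \<partial>vol))" by (rule liminf_add_ge)
  also have "\<dots> = ennreal (\<integral>x. max 0 (height x) \<partial>vol)" unfolding nn_integral_kernel[OF n] by (simp add: Liminf_const)
  finally show ?thesis .
qed

end

section \<open>The volume of the unit sphere\<close>

text \<open>Smoothness of the stereographic charts and of their transition maps needs derivatives of all
  orders; on an open set the differentiation rules close up under induction.\<close>

lemma Ck_on_lower: "Ck_on (Suc k) S f \<Longrightarrow> Ck_on k S f"
proof (induction k arbitrary: f)
  case 0
  then show ?case using C1_on_continuous[of S f] by simp
next
  case (Suc k)
  then show ?case by (metis Ck_on.simps(2))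
qed

lemma Ck_on_SucI:
  assumes S: "open S" and D: "\<And>x. x \<in> S \<Longrightarrow> (f has_derivative D x) (at x)"
    and Ck: "\<And>v. Ck_on k S (\<lambda>x. D x v)"
  shows "Ck_on (Suc k) S f"
proof -
  have "Ck_on k S (\<lambda>x. fderiv f x v)" for v
    by (rule Ck_on_cong_open[OF S _ Ck[of v]]) (simp add: frechet_derivative_at[OF D, symmetric])
  then show ?thesis using D by (auto simp: differentiable_def)
qed

lemma Ck_on_has_derivative:
  "Ck_on (Suc k) S f \<Longrightarrow> x \<in> S \<Longrightarrow> (f has_derivative fderiv f x) (at x)"
  by (simp add: frechet_derivative_works)

lemma Ck_on_const: "open S \<Longrightarrow> Ck_on k S (\<lambda>x. c)"
proof (induction k arbitrary: c)
  case (Suc k)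
  show ?case by (rule Ck_on_SucI[OF Suc.prems has_derivative_const Suc.IH[OF Suc.prems]])
qed simp

lemma Ck_on_linear_map:
  assumes "open S" "bounded_linear f" shows "Ck_on k S f"
proof (cases k)
  case 0
  then show ?thesis using linear_continuous_on[OF assms(2)] by simp
next
  case (Suc j)
  show ?thesis unfolding Suc
    by (rule Ck_on_SucI[OF assms(1) bounded_linear_imp_has_derivative[OF assms(2)] Ck_on_const[OF assms(1)]])
qed

lemma Ck_on_add:
  assumes "open S" shows "Ck_on k S f \<Longrightarrow> Ck_on k S g \<Longrightarrow> Ck_on k S (\<lambda>x. f x + g x)"
proof (induction k arbitrary: f g)
  case (Suc k)
  show ?case
    by (rule Ck_on_SucI[OF assms has_derivative_add[OF Ck_on_has_derivative[OF Suc.prems(1)] Ck_on_has_derivative[OF Suc.prems(2)]]])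
       (use Suc in auto)
qed (simp add: continuous_on_add)

lemma Ck_on_bilinear:
  assumes "open S" and b: "bounded_bilinear b"
  shows "Ck_on k S f \<Longrightarrow> Ck_on k S g \<Longrightarrow> Ck_on k S (\<lambda>x. b (f x) (g x))"
proof (induction k arbitrary: f g)
  case 0
  then show ?case by (simp add: bounded_bilinear.continuous_on[OF b])
next
  case (Suc k)
  show ?case
  proof (rule Ck_on_SucI[OF assms(1)])
    show "((\<lambda>x. b (f x) (g x)) has_derivative
      (\<lambda>h. b (f x) (fderiv g x h) + b (fderiv f x h) (g x))) (at x)" if "x \<in> S" for x
      by (rule bounded_bilinear.FDERIV[OF b Ck_on_has_derivative[OF Suc.prems(1) that] Ck_on_has_derivative[OF Suc.prems(2) that]])
    show "Ck_on k S (\<lambda>x. b (f x) (fderiv g x v) + b (fderiv f x v) (g x))" for v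
      by (intro Ck_on_add[OF assms(1)] Suc.IH Ck_on_lower[OF Suc.prems(1)] Ck_on_lower[OF Suc.prems(2)])
         (use Suc.prems in auto)
  qed
qed

lemma Ck_on_inverse:
  fixes f :: "'a::real_normed_vector \<Rightarrow> real"
  assumes "open S" and nz: "\<And>x. x \<in> S \<Longrightarrow> f x \<noteq> 0"
  shows "Ck_on k S f \<Longrightarrow> Ck_on k S (\<lambda>x. inverse (f x))"
proof (induction k)
  case 0
  then show ?case using nz by (auto intro: continuous_on_inverse)
next
  case (Suc k)
  have I: "Ck_on k S (\<lambda>x. inverse (f x))" by (rule Suc.IH[OF Ck_on_lower[OF Suc.prems]])
  show ?case
  proof (rule Ck_on_SucI[OF assms(1)])
    show "((\<lambda>x. inverse (f x)) has_derivative
        (\<lambda>h. (- 1) * (inverse (f x) * (fderiv f x h * inverse (f x))))) (at x)" if "x \<in> S" for x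
      using Deriv.has_derivative_inverse[OF nz[OF that] Ck_on_has_derivative[OF Suc.prems that]] by (simp add: mult.assoc)
    show "Ck_on k S (\<lambda>x. (- 1) * (inverse (f x) * (fderiv f x v * inverse (f x))))" for v
      by (intro Ck_on_bilinear[OF assms(1) bounded_bilinear_mult] Ck_on_const assms(1) I) (use Suc.prems in auto)
  qed
qed

lemma Ck_on_Pair:
  assumes "open S" shows "Ck_on k S f \<Longrightarrow> Ck_on k S g \<Longrightarrow> Ck_on k S (\<lambda>x. (f x, g x))"
proof (induction k arbitrary: f g)
  case (Suc k)
  show ?case
    by (rule Ck_on_SucI[OF assms has_derivative_Pair[OF Ck_on_has_derivative[OF Suc.prems(1)] Ck_on_has_derivative[OF Suc.prems(2)]]])
       (use Suc in auto)
qed (simp add: continuous_on_Pair)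

lemma one_plus_inner_pos: "1 + u \<bullet> u > (0::real)" for u :: "'a::real_inner"
  by (simp add: add_pos_nonneg)

lemma stereographic_inner:
  "stereographic s u = ((2 * inverse (1 + u \<bullet> u)) *\<^sub>R u, s * ((1 - u \<bullet> u) * inverse (1 + u \<bullet> u)))"
  by (simp add: stereographic_def power2_norm_eq_inner divide_inverse mult.assoc)

lemma smooth_stereographic: "smooth_on UNIV (stereographic s)"
  unfolding smooth_on_def
proof
  fix k
  have id: "Ck_on k UNIV (\<lambda>u::real^'n. u)" by (rule Ck_on_linear_map) (auto simp: bounded_linear_ident)
  have in': "Ck_on k UNIV (\<lambda>u::real^'n. u \<bullet> u)"
    by (rule Ck_on_bilinear[OF open_UNIV bounded_bilinear_inner id id])
  have q: "Ck_on k UNIV (\<lambda>u::real^'n. inverse (1 + u \<bullet> u))"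
    by (intro Ck_on_inverse Ck_on_add Ck_on_const in' open_UNIV) (use one_plus_inner_pos in \<open>metis less_irrefl\<close>)
  have p: "Ck_on k UNIV (\<lambda>u::real^'n. 1 - u \<bullet> u)"
    using Ck_on_add[OF open_UNIV Ck_on_const[OF open_UNIV, of k 1]
        Ck_on_bilinear[OF open_UNIV bounded_bilinear_mult Ck_on_const[OF open_UNIV, of k "- 1"] in']] by simp
  show "Ck_on k UNIV (stereographic s :: real^'n \<Rightarrow> _)"
    unfolding stereographic_inner[abs_def]
    by (intro Ck_on_Pair Ck_on_bilinear[OF open_UNIV bounded_bilinear_mult]
        Ck_on_bilinear[OF open_UNIV bounded_bilinear_scaleR] Ck_on_const open_UNIV id p q)
qed

lemma stereographic_sphere:
  assumes "s\<^sup>2 = 1" shows "stereographic s u \<in> sphere 0 1"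
proof -
  define r where "r = u \<bullet> u"
  define i where "i = inverse (1 + r)"
  have i: "i * (1 + r) = 1" using one_plus_inner_pos[of u] by (simp add: i_def r_def)
  have "stereographic s u \<bullet> stereographic s u = i\<^sup>2 * (4 * r + s\<^sup>2 * (1 - r)\<^sup>2)"
    unfolding stereographic_inner inner_prod_def fst_conv snd_conv inner_scaleR_left inner_scaleR_right
      r_def[symmetric] i_def[symmetric]
    by (simp add: power2_eq_square algebra_simps)
  also have "\<dots> = (i * (1 + r))\<^sup>2" unfolding assms by (simp add: power2_eq_square algebra_simps)
  finally show ?thesis unfolding i by (simp add: norm_eq_sqrt_inner)
qed

definition stereographic_inverse :: "real \<Rightarrow> (real^'n) \<times> real \<Rightarrow> real^'n::finite"
  where "stereographic_inverse s x = inverse (1 + s * snd x) *\<^sub>R fst x"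

lemma stereographic_snd:
  assumes "s\<^sup>2 = 1" shows "1 + s * snd (stereographic s u) = 2 * inverse (1 + u \<bullet> u)"
proof -
  define i where "i = inverse (1 + u \<bullet> u)"
  have i: "i * (1 + u \<bullet> u) = 1" using one_plus_inner_pos[of u] by (simp add: i_def)
  have "1 + s * snd (stereographic s u) = 1 + s\<^sup>2 * ((1 - u \<bullet> u) * i)"
    by (simp add: stereographic_inner i_def power2_eq_square)
  also have "\<dots> = i * (1 + u \<bullet> u) + (1 - u \<bullet> u) * i" unfolding assms i by simp
  also have "\<dots> = 2 * i" by (simp add: algebra_simps)
  finally show ?thesis by (simp add: i_def)
qed

lemma stereographic_inverse_left:
  assumes "s\<^sup>2 = 1" shows "stereographic_inverse s (stereographic s u) = u"
  using one_plus_inner_pos[of u] unfolding stereographic_inverse_def stereographic_snd[OF assms]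
  by (simp add: stereographic_inner)

lemma stereographic_inverse_right:
  assumes s: "s\<^sup>2 = 1" and x: "x \<in> sphere 0 1" "1 + s * snd x \<noteq> 0"
  shows "stereographic s (stereographic_inverse s x) = x"
proof -
  obtain y t where xy: "x = (y, t)" by (cases x)
  have "x \<bullet> x = 1" using x(1) by (simp add: norm_eq_sqrt_inner)
  then have yy: "y \<bullet> y = 1 - t\<^sup>2" by (simp add: xy inner_prod_def power2_eq_square)
  define a where "a = 1 + s * t"
  have a: "a \<noteq> 0" using x(2) by (simp add: a_def xy)
  have ss: "s * s = 1" using s by (simp add: power2_eq_square)
  have st: "s * (a - 1) = t" by (simp add: a_def mult.assoc[symmetric] ss)
  have "1 - t\<^sup>2 = a * (2 - a)"
  proof -
    have "a * (2 - a) = 1 - (s * s) * t\<^sup>2" by (simp add: a_def power2_eq_square algebra_simps)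
    then show ?thesis by (simp add: ss)
  qed
  then have uu: "(inverse a *\<^sub>R y) \<bullet> (inverse a *\<^sub>R y) = (2 - a) / a" using a yy by (simp add: field_simps)
  have q: "1 + (2 - a) / a = 2 / a" "1 - (2 - a) / a = 2 * (a - 1) / a" using a by (simp_all add: field_simps)
  show ?thesis
    unfolding stereographic_inner xy stereographic_inverse_def snd_conv fst_conv a_def[symmetric] uu q
    using a st by (simp add: algebra_simps)
qed

lemma range_stereographic:
  assumes s: "s\<^sup>2 = 1"
  shows "range (stereographic s :: real^'n::finite \<Rightarrow> _) = sphere 0 1 \<inter> {x. 1 + s * snd x \<noteq> 0}"
proof
  show "range (stereographic s :: real^'n \<Rightarrow> _) \<subseteq> sphere 0 1 \<inter> {x. 1 + s * snd x \<noteq> 0}"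
  proof
    fix x assume "x \<in> range (stereographic s :: real^'n \<Rightarrow> _)"
    then obtain u :: "real^'n" where "x = stereographic s u" by blast
    then show "x \<in> sphere 0 1 \<inter> {x. 1 + s * snd x \<noteq> 0}"
      using stereographic_sphere[OF s, of u] stereographic_snd[OF s, of u] one_plus_inner_pos[of u] by auto
  qed
  show "sphere 0 1 \<inter> {x. 1 + s * snd x \<noteq> 0} \<subseteq> range (stereographic s :: real^'n \<Rightarrow> _)"
  proof
    fix x :: "(real^'n) \<times> real" assume "x \<in> sphere 0 1 \<inter> {x. 1 + s * snd x \<noteq> 0}"
    then have "x = stereographic s (stereographic_inverse s x)"
      using stereographic_inverse_right[OF s, of x] by simp
    then show "x \<in> range (stereographic s :: real^'n \<Rightarrow> _)" by (rule range_eqI)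
  qed
qed

lemma stereographic_homeomorphism:
  assumes s: "s\<^sup>2 = 1"
  shows "homeomorphism UNIV (range (stereographic s)) (stereographic s) (stereographic_inverse s)"
proof (rule homeomorphismI)
  show "continuous_on UNIV (stereographic s)"
    using smooth_stereographic[of s] unfolding smooth_on_def by (metis Ck_on.simps(1))
  show "continuous_on (range (stereographic s)) (stereographic_inverse s)"
    unfolding range_stereographic[OF s] stereographic_inverse_def by (intro continuous_intros) auto
  show "stereographic_inverse s (stereographic s u) = u" for u by (rule stereographic_inverse_left[OF s])
  show "stereographic s (stereographic_inverse s x) = x" if "x \<in> range (stereographic s)" for x
    using that by (auto simp: stereographic_inverse_left[OF s])
qed auto

lemma stereographic_derivative:
  fixes u :: "real^'n::finite"
  defines "q \<equiv> 1 + u \<bullet> u"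
  shows "(stereographic s has_derivative (\<lambda>v. ((2 / q) *\<^sub>R v - (4 * (u \<bullet> v) / q\<^sup>2) *\<^sub>R u, - (s * (4 * (u \<bullet> v) / q\<^sup>2))))) (at u)"
proof -
  have q: "q \<noteq> 0" using one_plus_inner_pos[of u] by (simp add: q_def)
  have dq: "((\<lambda>u. 1 + u \<bullet> u) has_derivative (\<lambda>v. 2 * (u \<bullet> v))) (at u)"
    by (auto intro!: derivative_eq_intros simp: inner_commute)
  have di: "((\<lambda>u. inverse (1 + u \<bullet> u)) has_derivative (\<lambda>v. - (2 * (u \<bullet> v) / q\<^sup>2))) (at u)"
    using Deriv.has_derivative_inverse[OF q[unfolded q_def] dq] by (simp add: q_def power2_eq_square divide_inverse mult_ac)
  have "((\<lambda>u. (2 * inverse (1 + u \<bullet> u)) *\<^sub>R u) has_derivative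
     (\<lambda>v. (2 * inverse q) *\<^sub>R v + (2 * - (2 * (u \<bullet> v) / q\<^sup>2)) *\<^sub>R u)) (at u)"
    unfolding q_def by (intro has_derivative_scaleR has_derivative_mult_right di[unfolded q_def] has_derivative_ident)
  then have 1: "((\<lambda>u. (2 * inverse (1 + u \<bullet> u)) *\<^sub>R u) has_derivative
     (\<lambda>v. (2 / q) *\<^sub>R v - (4 * (u \<bullet> v) / q\<^sup>2) *\<^sub>R u)) (at u)"
    by (simp add: divide_inverse mult.assoc)
  have dp: "((\<lambda>u. 1 - u \<bullet> u) has_derivative (\<lambda>v. - (2 * (u \<bullet> v)))) (at u)"
    by (auto intro!: derivative_eq_intros simp: inner_commute)
  have "((\<lambda>u. s * ((1 - u \<bullet> u) * inverse (1 + u \<bullet> u))) has_derivative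
     (\<lambda>v. s * ((1 - u \<bullet> u) * (- (2 * (u \<bullet> v) / q\<^sup>2)) + - (2 * (u \<bullet> v)) * inverse q))) (at u)"
    unfolding q_def by (intro has_derivative_mult_right has_derivative_mult dp di[unfolded q_def])
  moreover have "(1 - u \<bullet> u) * (- (2 * (u \<bullet> v) / q\<^sup>2)) + - (2 * (u \<bullet> v)) * inverse q = - (4 * (u \<bullet> v) / q\<^sup>2)" for v
  proof -
    have "inverse q = q / q\<^sup>2" using q by (simp add: power2_eq_square field_simps)
    then have "(1 - u \<bullet> u) * (- (2 * (u \<bullet> v) / q\<^sup>2)) + - (2 * (u \<bullet> v)) * inverse q
      = - (2 * (u \<bullet> v)) * ((1 - u \<bullet> u) + q) / q\<^sup>2" by (simp add: algebra_simps add_divide_distrib diff_divide_distrib)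
    then show ?thesis by (simp add: q_def)
  qed
  ultimately have 2: "((\<lambda>u. s * ((1 - u \<bullet> u) * inverse (1 + u \<bullet> u))) has_derivative
     (\<lambda>v. - (s * (4 * (u \<bullet> v) / q\<^sup>2)))) (at u)" by simp
  show ?thesis
    unfolding stereographic_inner[abs_def] using has_derivative_Pair[OF 1 2] .
qed

text \<open>Stereographic projection is conformal, so its volume density is a power of the conformal factor.\<close>

lemma stereographic_conformal:
  fixes u :: "real^'n::finite"
  assumes s: "s\<^sup>2 = 1"
  shows "fderiv (stereographic s) u v \<bullet> fderiv (stereographic s) u w
    = (2 / (1 + u \<bullet> u))\<^sup>2 * (v \<bullet> w)"
proof -
  define q where "q = 1 + u \<bullet> u"
  have q: "q \<noteq> 0" using one_plus_inner_pos[of u] by (simp add: q_def)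
  define a where "a = 2 / q"
  have aq: "a\<^sup>2 * (u \<bullet> u) + a\<^sup>2 = 2 * a"
  proof -
    have "a\<^sup>2 * (u \<bullet> u) + a\<^sup>2 = a * (a * q)" by (simp add: q_def power2_eq_square algebra_simps)
    then show ?thesis using q by (simp add: a_def)
  qed
  have b: "4 * z / q\<^sup>2 = a\<^sup>2 * z" for z by (simp add: a_def power_divide)
  have D: "fderiv (stereographic s) u = (\<lambda>v. (a *\<^sub>R v - (a\<^sup>2 * (u \<bullet> v)) *\<^sub>R u, - (s * (a\<^sup>2 * (u \<bullet> v)))))"
    using frechet_derivative_at[OF stereographic_derivative[of s u], folded q_def]
    unfolding b by (simp add: a_def)
  have "(a *\<^sub>R v - (a\<^sup>2 * (u \<bullet> v)) *\<^sub>R u) \<bullet> (a *\<^sub>R w - (a\<^sup>2 * (u \<bullet> w)) *\<^sub>R u) + (s * s) * (a\<^sup>2 * (u \<bullet> v)) * (a\<^sup>2 * (u \<bullet> w))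
     = a\<^sup>2 * (v \<bullet> w) + a\<^sup>2 * (u \<bullet> v) * (u \<bullet> w) * ((a\<^sup>2 * (u \<bullet> u) + a\<^sup>2 * (s * s)) - 2 * a)"
    by (simp add: inner_diff_left inner_diff_right inner_commute[of v u] power2_eq_square algebra_simps)
  then show ?thesis
    using s aq unfolding D by (simp add: inner_prod_def power2_eq_square mult_ac a_def[symmetric] q_def[symmetric])
qed

text \<open>The two charts omit opposite poles, and the transition map is the inversion \<open>u / |u|\<^sup>2\<close>.\<close>

lemma sphere_closed_manifold:
  "closed_manifold (sphere (0 :: (real^'n::finite) \<times> real) 1) (sphere_atlas :: ('n, (real^'n) \<times> real) atlas)"
  unfolding closed_manifold_def smooth_atlas_def
proof (intro conjI)
  let ?S = "sphere (0 :: (real^'n) \<times> real) 1"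
  show "compact ?S" by simp
  have s: "(1::real)\<^sup>2 = 1" "(- 1 :: real)\<^sup>2 = 1" by simp_all
  show "(\<Union>(V, \<psi>)\<in>(sphere_atlas :: ('n, (real^'n) \<times> real) atlas). \<psi> ` V) = ?S"
    unfolding sphere_atlas_def using range_stereographic[OF s(1)] range_stereographic[OF s(2)] by auto
  have openin: "openin (top_of_set ?S) (range (stereographic s))" if "s\<^sup>2 = 1" for s :: real
  proof -
    have "open {x :: (real^'n) \<times> real. 1 + s * snd x \<noteq> 0}"
      by (intro open_Collect_neq continuous_intros)
    then show ?thesis unfolding range_stereographic[OF that] by (rule openin_open_Int)
  qed
  show "\<forall>(V, \<psi>)\<in>(sphere_atlas :: ('n, (real^'n) \<times> real) atlas). open V \<and> openin (top_of_set ?S) (\<psi> ` V) \<and> (\<exists>\<phi>. homeomorphism V (\<psi> ` V) \<psi> \<phi>)"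
    unfolding sphere_atlas_def using openin[OF s(1)] openin[OF s(2)]
      stereographic_homeomorphism[OF s(1)] stereographic_homeomorphism[OF s(2)] by auto
  have inv: "inv_into UNIV (stereographic s) (stereographic s u) = u" if "s\<^sup>2 = 1" for s and u :: "real^'n"
    by (rule inv_into_f_f[OF inj_on_inverseI[of _ "stereographic_inverse s"]])
       (simp_all add: stereographic_inverse_left[OF that])
  have same: "smooth_on (UNIV \<inter> stereographic s -` range (stereographic s)) (inv_into UNIV (stereographic s) \<circ> (stereographic s :: real^'n \<Rightarrow> _))"
    if "s\<^sup>2 = 1" for s
  proof -
    have "inv_into UNIV (stereographic s) \<circ> stereographic s = (\<lambda>u::real^'n. u)" using inv[OF that] by auto
    then show ?thesis unfolding smooth_on_def by (auto intro!: Ck_on_linear_map simp: bounded_linear_ident vimage_def)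
  qed
  have opp: "smooth_on (UNIV \<inter> stereographic s -` range (stereographic (- s))) (inv_into UNIV (stereographic (- s)) \<circ> (stereographic s :: real^'n \<Rightarrow> _))"
    if s: "s\<^sup>2 = 1" for s
  proof -
    have s': "(- s)\<^sup>2 = 1" using s by simp
    have tr: "stereographic (- s) (inverse (u \<bullet> u) *\<^sub>R u) = stereographic s u" if "u \<noteq> 0" for u :: "real^'n"
    proof -
      have p: "u \<bullet> u > 0" using that by simp
      have q: "1 + inverse (u \<bullet> u) = (1 + u \<bullet> u) * inverse (u \<bullet> u)" "1 - inverse (u \<bullet> u) = - ((1 - u \<bullet> u) * inverse (u \<bullet> u))"
        using p by (simp_all add: field_simps)
      have "(inverse (u \<bullet> u) *\<^sub>R u) \<bullet> (inverse (u \<bullet> u) *\<^sub>R u) = inverse (u \<bullet> u)" using p by simp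
      then show ?thesis unfolding stereographic_inner q using p by (simp add: q)
    qed
    have set: "UNIV \<inter> stereographic s -` range (stereographic (- s)) = - {0 :: real^'n}"
    proof
      have "1 + - s * snd (stereographic s (0 :: real^'n)) = 0" using s by (simp add: stereographic_inner power2_eq_square)
      then show "UNIV \<inter> stereographic s -` range (stereographic (- s)) \<subseteq> - {0 :: real^'n}"
        unfolding range_stereographic[OF s'] by auto
      show "- {0 :: real^'n} \<subseteq> UNIV \<inter> stereographic s -` range (stereographic (- s))"
      proof
        fix u :: "real^'n" assume "u \<in> - {0}"
        then have "stereographic s u = stereographic (- s) (inverse (u \<bullet> u) *\<^sub>R u)" using tr by simp
        then show "u \<in> UNIV \<inter> stereographic s -` range (stereographic (- s))" by auto
      qed
    qed
    have eq: "inverse (u \<bullet> u) *\<^sub>R u = (inv_into UNIV (stereographic (- s)) \<circ> stereographic s) u" if "u \<in> - {0}" for u :: "real^'n"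
      using tr[of u] that inv[OF s', of "inverse (u \<bullet> u) *\<^sub>R u"] by simp
    have op: "open (- {0 :: real^'n})" by (intro open_Compl closed_singleton)
    have "Ck_on k (- {0}) (\<lambda>u::real^'n. inverse (u \<bullet> u) *\<^sub>R u)" for k
    proof -
      have id: "Ck_on k (- {0}) (\<lambda>u::real^'n. u)" by (rule Ck_on_linear_map[OF op bounded_linear_ident])
      show ?thesis
        by (intro Ck_on_bilinear[OF op bounded_bilinear_scaleR] Ck_on_inverse[OF op]
            Ck_on_bilinear[OF op bounded_bilinear_inner] id) simp
    qed
    then show ?thesis
      unfolding smooth_on_def set by (intro allI Ck_on_cong_open[OF op eq])
  qed
  show "\<forall>(V, \<psi>)\<in>(sphere_atlas :: ('n, (real^'n) \<times> real) atlas). \<forall>(V', \<psi>')\<in>sphere_atlas.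
      smooth_on (V \<inter> \<psi> -` (\<psi>' ` V')) (inv_into V' \<psi>' \<circ> \<psi>)"
    unfolding sphere_atlas_def
    using same[OF s(1)] same[OF s(2)] opp[OF s(1)] opp[OF s(2)] by simp
qed

lemma sphere_immersion:
  "immersion_into_sphere (sphere (0 :: (real^'n::finite) \<times> real) 1) (sphere_atlas :: ('n, (real^'n) \<times> real) atlas) (\<lambda>x. x)"
proof -
  have "inj (fderiv (stereographic s) u)" if "s\<^sup>2 = 1" for s and u :: "real^'n"
  proof -
    have "linear (fderiv (stereographic s) u)"
      unfolding frechet_derivative_at[OF stereographic_derivative, symmetric]
      by (rule has_derivative_linear[OF stereographic_derivative])
    moreover have "v = 0" if "fderiv (stereographic s) u v = 0" for v
    proof -
      have "0 = (2 / (1 + u \<bullet> u))\<^sup>2 * (v \<bullet> v)"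
        using stereographic_conformal[OF \<open>s\<^sup>2 = 1\<close>, of u v v] unfolding that by simp
      then show ?thesis using one_plus_inner_pos[of u] by simp
    qed
    ultimately show ?thesis by (simp add: linear_injective_0)
  qed
  then show ?thesis
    unfolding immersion_into_sphere_def sphere_atlas_def
    using smooth_stereographic by (auto simp: o_def)
qed

interpretation unit_sphere: immersed_manifold "sphere (0 :: (real^'n::finite) \<times> real) 1"
  "sphere_atlas :: ('n, (real^'n) \<times> real) atlas" "\<lambda>x. x"
  by standard (rule sphere_closed_manifold sphere_immersion)+

lemma stereographic_volume_density:
  fixes u :: "real^'n::finite"
  assumes s: "s\<^sup>2 = 1"
  shows "unit_sphere.volume_density (stereographic s) u = (2 / (1 + (norm u)\<^sup>2)) ^ CARD('n)"
proof -
  let ?c = "2 / (1 + u \<bullet> u)"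
  have "metric_matrix ((\<lambda>x. x) \<circ> stereographic s) u $ i $ j = ?c\<^sup>2 * (if i = j then 1 else 0)" for i j :: 'n
    using stereographic_conformal[OF s, of u "axis i 1" "axis j 1"]
    by (simp add: metric_matrix_def partial_def o_def inner_axis_axis)
  then have "det (metric_matrix ((\<lambda>x. x) \<circ> stereographic s) u) = (\<Prod>i\<in>(UNIV::'n set). ?c\<^sup>2)"
    by (subst det_diagonal) auto
  also have "\<dots> = (?c ^ CARD('n))\<^sup>2" by (simp add: power_mult[symmetric] mult.commute)
  finally show ?thesis
    unfolding unit_sphere.volume_density_def
    using one_plus_inner_pos[of u] by (simp add: power2_norm_eq_inner)
qed

text \<open>One chart covers the sphere up to a single point, which is a null set in the other chart.\<close>

lemma sphere_vol_eq:
  assumes n: "CARD('n::finite) \<ge> 2"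
  shows "sphere_vol TYPE('n) = 2 * real CARD('n) * half_integral CARD('n) * unit_ball_vol (real CARD('n))"
proof -
  let ?S = "sphere (0 :: (real^'n) \<times> real) 1" and ?A = "sphere_atlas :: ('n, (real^'n) \<times> real) atlas"
  let ?vol = "volume_measure ?S ?A (\<lambda>x. x)" and ?W = "2 * real CARD('n) * half_integral CARD('n) * unit_ball_vol (real CARD('n))"
  have s: "(1::real)\<^sup>2 = 1" "(- 1 :: real)\<^sup>2 = 1" by simp_all
  have c: "(UNIV, stereographic 1) \<in> ?A" "(UNIV, stereographic (- 1)) \<in> ?A" by (auto simp: sphere_atlas_def)
  let ?R = "range (stereographic 1 :: real^'n \<Rightarrow> _)" and ?P = "{(0, - 1)} :: ((real^'n) \<times> real) set"
  have R: "?R \<in> sets (restrict_space borel ?S)" by (rule unit_sphere.openin_sets[OF unit_sphere.chart_image_openin[OF c(1)]])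
  have P: "?P = stereographic (- 1) ` {0 :: real^'n}" by (simp add: stereographic_inner)
  have Psets: "?P \<in> sets (restrict_space borel ?S)"
    unfolding sets_restrict_space by (intro image_eqI[of _ _ ?P]) auto
  have "emeasure ?vol ?R = unit_sphere.chart_volume UNIV (stereographic 1) ?R"
    by (rule unit_sphere.emeasure_vol_chart[OF c(1) R]) simp
  also have "\<dots> = (\<integral>\<^sup>+u. ennreal ((2 / (1 + (norm (u :: real^'n))\<^sup>2)) ^ CARD('n)) \<partial>lborel)"
    unfolding unit_sphere.chart_volume_def by (intro nn_integral_cong) (simp add: stereographic_volume_density[OF s(1)])
  also have "\<dots> = ennreal ?W" by (rule nn_integral_stereographic_density[OF n])
  finally have eR: "emeasure ?vol ?R = ennreal ?W" .
  have "emeasure ?vol ?P = unit_sphere.chart_volume UNIV (stereographic (- 1)) ?P"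
    by (rule unit_sphere.emeasure_vol_chart[OF c(2) Psets]) (auto simp: P)
  also have "\<dots> = (\<integral>\<^sup>+u\<in>{0 :: real^'n}. ennreal (unit_sphere.volume_density (stereographic (- 1)) u) \<partial>lborel)"
  proof -
    have "u = 0" if "stereographic (- 1) u = stereographic (- 1) 0" for u :: "real^'n"
      using arg_cong[OF that, of "stereographic_inverse (- 1)"] by (simp add: stereographic_inverse_left[OF s(2)])
    then have "UNIV \<inter> stereographic (- 1) -` ?P = {0 :: real^'n}" unfolding P by auto
    then show ?thesis unfolding unit_sphere.chart_volume_def by simp
  qed
  also have "\<dots> = 0"
    by (rule nn_integral_null_set) (simp add: null_sets_def)
  finally have eP: "emeasure ?vol ?P = 0" .
  have "?S = ?R \<union> ?P"
  proof -
    have "x \<in> ?P" if "x \<in> ?S" "1 + 1 * snd x = 0" for x :: "(real^'n) \<times> real"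
    proof -
      have t: "snd x = - 1" using that by simp
      have "fst x \<bullet> fst x + snd x * snd x = 1" using that(1) by (simp add: norm_eq_sqrt_inner inner_prod_def)
      then have "fst x = 0" using t by simp
      then show ?thesis using t by (metis prod.collapse singletonI)
    qed
    moreover have "?P \<subseteq> ?S" by (simp add: norm_Pair)
    ultimately show ?thesis unfolding range_stereographic[OF s(1)] by blast
  qed
  then have "emeasure ?vol ?S = emeasure ?vol (?R \<union> ?P)" by (rule arg_cong)
  also have "\<dots> = emeasure ?vol ?R"
    by (rule emeasure_Un_null_set) (use R Psets eP in \<open>auto simp: null_sets_def\<close>)
  finally have "emeasure ?vol ?S = ennreal ?W" unfolding eR .
  moreover have "?W \<ge> 0"
  proof -
    have "half_integral CARD('n) \<ge> 0"
    proof -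
      have "cos_power_integral (CARD('n) - 1) 0 \<le> cos_power_integral (CARD('n) - 1) (pi / 2)"
        by (rule DERIV_nonneg_imp_nondecreasing)
           (use DERIV_cos_power_integral cos_ge_zero in \<open>auto intro!: exI zero_le_power\<close>)
      then show ?thesis by (simp add: half_integral_def)
    qed
    then show ?thesis by simp
  qed
  ultimately show ?thesis unfolding sphere_vol_def Vol_def measure_def by simp
qed

section \<open>The volume bound\<close>

theorem theorem2p5:
  fixes M :: "'a::t2_space set"
    and A :: "('n::finite, 'a) atlas"
    and f :: "'a \<Rightarrow> real^'k::finite"
    and p :: "real^'k"
    and n q m :: nat
  assumes "n \<ge> 2" and "q \<ge> 1"
    and "CARD('n) = n" and "CARD('k) = n + q + 1"
    and "closed_manifold M A"
    and "immersion_into_sphere M A f"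
    and "minimal A f"
    and "p \<in> f ` M"
    and "m = card {x \<in> M. f x = p}"
  shows "set_integrable (volume_measure M A f) {x \<in> M. f x \<bullet> p > 0} (R_integrand A f p) \<and>
    Vol M A f \<ge> real m * sphere_vol TYPE('n)
      + sphere_vol TYPE('n) / ball_vol TYPE('n) * R_functional M A f p
      + 1 / (real n + 2) * (LINT x|volume_measure M A f. (norm (normal_part A f x p))\<^sup>2)"
proof -
  have "norm p = 1" using assms(6,8) unfolding immersion_into_sphere_def by auto
  then interpret minimal_immersion M A f p
    by unfold_locales (use assms in auto)
  have n: "CARD('n) \<ge> 2" using assms by simp
  define \<beta> where "\<beta> = unit_ball_vol (real CARD('n))"
  have \<beta>: "\<beta> > 0" by (simp add: \<beta>_def)
  have ball: "ball_vol TYPE('n) = \<beta>" by (simp add: ball_vol_def content_ball \<beta>_def)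
  define c where "c = real CARD('n) * half_integral CARD('n)"
  have \<omega>: "sphere_vol TYPE('n) = 2 * c * \<beta>" using sphere_vol_eq[OF n] by (simp add: c_def \<beta>_def)
  have "0 \<le> sphere_vol TYPE('n)" by (simp add: sphere_vol_def Vol_def)
  then have c: "c \<ge> 0" using \<omega> \<beta> by (simp add: zero_le_mult_iff)
  let ?P = "{x \<in> M. height x > 0}" and ?R = "R_integrand A f p"
  define b where "b = (\<integral>x. max 0 (height x) \<partial>vol)"
  have b0: "b \<ge> 0" unfolding b_def by (intro Bochner_Integration.integral_nonneg) simp
  have Rnn: "indicator ?P x *\<^sub>R ?R x \<ge> 0" if "x \<in> M" for x
    using that normal_sq_bounds[OF that] by (auto simp: R_integrand_eq indicator_def)
  have fin: "(\<integral>\<^sup>+x. ennreal (indicator ?P x *\<^sub>R ?R x) \<partial>vol) \<le> ennreal b"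
    using positive_part_bound[OF n, of "{}"] by (simp add: b_def)
  have int: "integrable vol (\<lambda>x. indicator ?P x *\<^sub>R ?R x)"
    by (rule integrableI_nonneg[OF set_R_integrand_measurable])
       (use Rnn fin in \<open>auto intro: le_less_trans\<close>)
  have P: "{x \<in> M. f x \<bullet> p > 0} = ?P" by (simp add: height_def)
  have R: "R_functional M A f p = (\<integral>x. indicator ?P x *\<^sub>R ?R x \<partial>vol)"
    unfolding R_functional_def set_lebesgue_integral_def P ..
  have R0: "R_functional M A f p \<ge> 0"
    unfolding R by (intro Bochner_Integration.integral_nonneg) (use Rnn in simp)
  \<comment> \<open>an infinite fibre would have cardinality \<open>0\<close> by convention\<close>
  obtain F where F: "finite F" "F \<subseteq> {x \<in> M. f x = p}" "m = card F"
    using assms(9) by (cases "finite {x \<in> M. f x = p}") (metis order_refl, metis card.empty card.infinite empty_subsetI finite.emptyI)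
  have "(\<integral>\<^sup>+x. ennreal (indicator ?P x *\<^sub>R ?R x) \<partial>vol) = ennreal (R_functional M A f p)"
    unfolding R by (rule nn_integral_eq_integral[OF int]) (use Rnn in \<open>auto intro!: AE_I2\<close>)
  then have "of_nat m * ennreal \<beta> + ennreal (R_functional M A f p) \<le> ennreal b"
    using positive_part_bound[OF n F(1,2)] unfolding F(3) \<beta>_def b_def by simp
  then have "ennreal (real m * \<beta> + R_functional M A f p) \<le> ennreal b"
    using \<beta> R0 by (simp add: ennreal_mult' ennreal_of_nat_eq_real_of_nat ennreal_plus)
  then have key: "real m * \<beta> + R_functional M A f p \<le> b" using b0 by (simp add: ennreal_le_iff)
  have "(\<integral>x. \<bar>height x\<bar> \<partial>vol) = (\<integral>x. 2 * max 0 (height x) - height x \<partial>vol)"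
    by (intro Bochner_Integration.integral_cong) (auto simp: max_def)
  also have "\<dots> = 2 * b" using integrable_height_terms integral_height by (simp add: b_def)
  finally have "Vol M A f - c * (2 * b) \<ge> (\<integral>x. normal_sq x \<partial>vol) / (real n + 2)"
    using volume_lower_bound[OF n] assms(3) by (simp add: Vol_def c_def)
  moreover have "2 * c * (real m * \<beta> + R_functional M A f p) \<le> 2 * c * b"
    using key c by (intro mult_left_mono) auto
  moreover have "sphere_vol TYPE('n) / ball_vol TYPE('n) = 2 * c" using \<beta> by (simp add: \<omega> ball)
  ultimately have "Vol M A f \<ge> real m * sphere_vol TYPE('n)
      + sphere_vol TYPE('n) / ball_vol TYPE('n) * R_functional M A f p
      + 1 / (real n + 2) * (LINT x|vol. (norm (normal_part A f x p))\<^sup>2)"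
    unfolding \<omega> by (simp add: normal_sq_def algebra_simps)
  moreover have "set_integrable vol {x \<in> M. f x \<bullet> p > 0} (R_integrand A f p)"
    unfolding set_integrable_def P by (rule int)
  ultimately show ?thesis by blast
qed

end
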